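(* For any $\alpha\in PSL(2,\mathbb{Z})$, $$\mathrm{Li}^{\alpha}(z,X_0,X_1)=F_\alpha(X_0,X_1)\,\mathrm{Li}(z,X_0,X_1),$$ where $F_\alpha(X_0,X_1)$ is a formal power series given by the Chen series $$F_\alpha(X_0,X_1):=\sum_{n\ge0}\int_\alpha\omega(\bar\alpha X_0,\bar\alpha X_1)^n .$$ Here $\omega(X_0,X_1)=\frac{dz}{z}X_0+\frac{dz}{1-z}X_1$, $\bar\alpha$ is the reduction of $\alpha$ to $SL(2,\mathbb{Z}/2\mathbb{Z})$, $PSL(2,\mathbb{Z})$ is implicitly identified with the group $G_{\overrightarrow{01}}$ of classes of paths defined in the context (so that $\int_\alpha$ is taken along the class of paths identified with $\alpha$), $\int_\alpha\tilde\omega^n$ is the (regularized) $n$-fold Chen iterated integral of the form $\tilde\omega$ along $\alpha$, with $\int_\alpha\tilde\omega^0=1$, and $\mathrm{Li}^\alpha$ is the action of $\alpha$ on the polylogarithm generating function $\mathrm{Li}$ defined in the context.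
   Context: Write $Y=\mathbb{P}^1\setminus\{0,1,\infty\}$ over $\mathbb{C}$, with coordinate $z$. Tangential paths. For distinct $a,b\in\{0,1,\infty\}$, $\overrightarrow{ab}$ is the unit tangent vector at $a$ pointing in the direction of $b$ along the real line (at $\infty$, unit length is measured in the coordinate $1/z$). A path from $\overrightarrow{ab}$ to $\overrightarrow{a_1b_1}$ is a path $\gamma:[0,1]\to\mathbb{P}^1$ with $\gamma'(0)=\overrightarrow{ab}$, $\gamma'(1)=-\overrightarrow{a_1b_1}$, $\gamma((0,1))\subset Y$. Let $G_{\overrightarrow{01}}$ be the set of homotopy classes of such paths starting at $\overrightarrow{01}$ and ending at any $\overrightarrow{a_1b_1}$. The finite group. Let $\Lambda$ be the group of linear fractional automorphisms of $Y$, whose elements are characterized by the permutations of $\{0,1,\infty\}$ they induce. Identify $SL(2,\mathbb{Z}/2\mathbb{Z})\simeq\Lambda\simeq S_3$ by identifying the generators $\bar\sigma=\begin{pmatrix}0&1\\1&0\end{pmatrix}\leftrightarrow(z\mapsto1-z)\leftrightarrow(0\,1)$ and $\bar\rho=\begin{pmatrix}1&1\\0&1\end{pmatrix}\leftrightarrow(z\mapsto\frac{z}{z-1})\leftrightarrow(1\,\infty)$. Group structure on $G_{\overrightarrow{01}}$. For $u\in G_{\overrightarrow{01}}$ with endpoint $\overrightarrow{a_1b_1}$, let $[u]\in S_3\simeq\Lambda$ be the permutation sending $0$ to $a_1$ and $1$ to $b_1$. For $\lambda\in\Lambda$, $\lambda*u$ is the image of $u$ under $\lambda$. The product is $uv:=u\cdot([u]*v)$,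 where $\cdot$ is concatenation of paths in the order written; one has $[uv]=[u]\circ[v]$. With this product $G_{\overrightarrow{01}}$ is a group, generated by $s$, the class of the segment $[0,1]$ from $\overrightarrow{01}$ to $\overrightarrow{10}$, and $r$, the class of the loop from $\overrightarrow{01}$ to $\overrightarrow{0\infty}$ in the upper half plane (half a counterclockwise turn around $0$), with relations $s^2=(sr)^3=1$. Identification with $PSL(2,\mathbb{Z})$. $PSL(2,\mathbb{Z})$ is generated by $\rho:\tau\mapsto1+\tau$ and $\sigma:\tau\mapsto-1/\tau$, with relations $\sigma^2=(\rho\circ\sigma)^3=1$. $\Psi:G_{\overrightarrow{01}}\to PSL(2,\mathbb{Z})$ is the isomorphism with $\Psi(r)=\rho$, $\Psi(s)=\sigma$. Multiplication in $PSL(2,\mathbb{Z})$ is written in the functional order, whereas concatenation of paths occurs in the order in which the paths are written. The map $\alpha\mapsto\bar\alpha:=[\Psi^{-1}(\alpha)]$ is the usual projection $PSL(2,\mathbb{Z})\to SL(2,\mathbb{Z}/2\mathbb{Z})$. The map $\Psi$ is suppressed from the notation. Action on the variables. Let $X_0,X_1$ be formal non-commuting variables. The elements of $SL(2,\mathbb{Z}/2\mathbb{Z})$ act on $z$ and on the pair $(X_0,X_1)$ as follows: $1$: $z\mapsto z$, $(X_0,X_1)\mapsto(X_0,X_1)$; $\bar\sigma$: $z\mapsto1-z$, $(X_0,X_1)\mapsto(-X_1,-X_0)$; $\bar\rho$: $z\mapsto\frac{z}{z-1}$, $(X_0,X_1)\mapsto(X_0,X_0-X_1)$; $\bar\sigma\circ\bar\rho$: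 $z\mapsto\frac1{1-z}$, $(X_0,X_1)\mapsto(-X_1,X_0-X_1)$; $\bar\rho\circ\bar\sigma$: $z\mapsto\frac{z-1}{z}$, $(X_0,X_1)\mapsto(X_1-X_0,-X_0)$; $\bar\rho\circ\bar\sigma\circ\bar\rho=\bar\sigma\circ\bar\rho\circ\bar\sigma$: $z\mapsto\frac1z$, $(X_0,X_1)\mapsto(X_1-X_0,X_1)$. Here $\bar\alpha X_0,\bar\alpha X_1$ denote the entries of the image pair. Chen series. Put $\omega_0=\frac{dz}{z}$, $\omega_1=\frac{dz}{1-z}$, and $\int_\gamma\omega_{i_1}\cdots\omega_{i_k}=\int_{0<t_1<\dots<t_k<1}\gamma^*\omega_{i_1}(t_1)\cdots\gamma^*\omega_{i_k}(t_k)$ (equal to $1$ for $k=0$). For an ordinary path $\gamma$ in $Y$, $C_\gamma(X_0,X_1):=\sum_{n\ge0}\int_\gamma\omega(X_0,X_1)^n=\sum_{k\ge0}\sum_{i_1,\dots,i_k\in\{0,1\}}\int_\gamma\omega_{i_1}\cdots\omega_{i_k}\,X_{i_1}\cdots X_{i_k}$. For paths with tangential endpoints the integrals are regularized in the usual way: let $R_0=X_0$, $R_1=-X_1$, $R_\infty=X_1-X_0$; for a path $\gamma$ from a tangential basepoint at $a$ to one at $a'$, let $\gamma_\varepsilon$ be $\gamma$ truncated at the points where the local coordinates at $a$ and $a'$ (normalized to have derivative $1$ along the respective basepoint tangent vectors) equal $\varepsilon$; then $C_\gamma=\lim_{\varepsilon\to0^+}e^{R_a\log\varepsilon}\,C_{\gamma_\varepsilon}\,e^{-R_{a'}\log\varepsilon}$,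 the last factor being omitted if the end is an ordinary point. Thus $F_\alpha(X_0,X_1)=C_\alpha(\bar\alpha X_0,\bar\alpha X_1)$. Polylogarithm generating function and the action on it. $\mathrm{Li}(z,X_0,X_1):=C_{[\overrightarrow{01},z]}(X_0,X_1)=\sum_{n\ge0}\int_{[\overrightarrow{01},z]}\omega(X_0,X_1)^n$, where $[\overrightarrow{01},z]$ is a tangential path from $\overrightarrow{01}$ to $z$ that winds around neither $1$ nor $\infty$ and does not cut the real axis unless $z$ is real ($z\notin(-\infty,0]\cup[1,\infty)$). For $\alpha\in PSL(2,\mathbb{Z})$, $\mathrm{Li}^\alpha(z,X_0,X_1)$ is obtained by analytically continuing $\mathrm{Li}(z,\bar\alpha X_0,\bar\alpha X_1)$ along any path in the homotopy class $\Psi^{-1}(\alpha)$, to the point $\bar\alpha(z)$: if $\overrightarrow{cd}$ is the endpoint of $\Psi^{-1}(\alpha)$ and $[\overrightarrow{cd},\bar\alpha z]$ is a path from $\overrightarrow{cd}$ to $\bar\alpha(z)$ that does not cross the real axis, then $\mathrm{Li}^\alpha(z,X_0,X_1)=\sum_{n\ge0}\int_{\alpha\cdot[\overrightarrow{cd},\bar\alpha z]}\omega(\bar\alpha X_0,\bar\alpha X_1)^n$, with paths composed in the order written.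
   Formalization: In the table of the action on (X_0,X_1), the pairs for the two elements of order three are interchanged: z→1/(1-z) gets (X_1-X_0,-X_0) and z→(z-1)/z gets (-X_1,X_0-X_1). With the printed pairs the identity already fails in degree one. *)

theory Defs
  imports
    "HOL-Analysis.Analysis"
    "HOL-Algebra.Coset"
    "HOL-Library.Z2"
begin

section \<open>Formal power series in two non-commuting variables\<close>

datatype letter = L0 | L1

text \<open>A series is its family of coefficients, indexed by the words in the two letters.\<close>

type_synonym ncseries = "letter list \<Rightarrow> complex"

definition nc_one :: ncseries where
  "nc_one w = (if w = [] then 1 else 0)"

definition nc_var :: "letter \<Rightarrow> ncseries" where
  "nc_var i w = (if w = [i] then 1 else 0)"

definition nc_scale :: "complex \<Rightarrow> ncseries \<Rightarrow> ncseries" where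
  "nc_scale c S = (\<lambda>w. c * S w)"

definition nc_mult :: "ncseries \<Rightarrow> ncseries \<Rightarrow> ncseries" (infixl "\<star>" 70) where
  "(S \<star> T) w = (\<Sum>k\<le>length w. S (take k w) * T (drop k w))"

primrec nc_pow :: "ncseries \<Rightarrow> nat \<Rightarrow> ncseries" where
  "nc_pow S 0 = nc_one"
| "nc_pow S (Suc n) = S \<star> nc_pow S n"

primrec nc_word :: "(letter \<Rightarrow> ncseries) \<Rightarrow> letter list \<Rightarrow> ncseries" where
  "nc_word Z [] = nc_one"
| "nc_word Z (i # w) = Z i \<star> nc_word Z w"

text \<open>
  Exponential of \<open>S\<close> and substitution of \<open>Z i\<close> for the variable \<open>i\<close>. Both are meant for
  arguments without constant term; then the terms omitted from the sums vanish.
\<close>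

definition nc_exp :: "ncseries \<Rightarrow> ncseries" where
  "nc_exp S w = (\<Sum>n\<le>length w. nc_pow S n w / fact n)"

definition nc_subst :: "ncseries \<Rightarrow> (letter \<Rightarrow> ncseries) \<Rightarrow> ncseries" where
  "nc_subst S Z v = (\<Sum>w | length w \<le> length v. S w * nc_word Z w v)"


section \<open>Tangential base points and paths\<close>

datatype cusp = C0 | C1 | Cinf

definition Ycurve :: "complex set" where
  "Ycurve = - {0, 1}"

text \<open>
  Local coordinate at the cusp \<open>a\<close>, vanishing there and with derivative 1 along the unit tangent
  vector at \<open>a\<close> pointing to \<open>b\<close>. The real segment between \<open>0\<close> and \<open>\<infinity>\<close> is the negative
  half-line, hence the signs.
\<close>

fun coord :: "cusp \<Rightarrow> cusp \<Rightarrow> complex \<Rightarrow> complex" where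
  "coord C0 C1 z = z"
| "coord C0 Cinf z = - z"
| "coord C1 C0 z = 1 - z"
| "coord C1 Cinf z = z - 1"
| "coord Cinf C0 z = - (1 / z)"
| "coord Cinf C1 z = 1 / z"
| "coord _ _ z = 0"

text \<open>An end of a path: the tangent vector at \<open>a\<close> towards \<open>b\<close>, or an ordinary point.\<close>

datatype endpt = Tang cusp cusp | Pt complex

fun proper_end :: "endpt \<Rightarrow> bool" where
  "proper_end (Tang a b) \<longleftrightarrow> a \<noteq> b"
| "proper_end (Pt p) \<longleftrightarrow> p \<in> Ycurve"

text \<open>
  A path in the projective line whose interior lies in \<open>Ycurve\<close> is encoded by a complex-valued
  function; at a tangential end only the values at interior parameters matter, the end itself being
  determined as a limit. A path \<open>\<gamma>\<close> issues from \<open>e\<close> at \<open>t = 0\<close> iff \<open>rescaled e t (\<gamma> t)\<close> tends to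
  \<open>rescaled_lim e\<close>: for a tangent vector this says that \<open>\<gamma> 0\<close> is the cusp and \<open>\<gamma>' 0\<close> is that
  tangent vector.
\<close>

fun rescaled :: "endpt \<Rightarrow> real \<Rightarrow> complex \<Rightarrow> complex" where
  "rescaled (Tang a b) t z = coord a b z / of_real t"
| "rescaled (Pt p) t z = z"

fun rescaled_lim :: "endpt \<Rightarrow> complex" where
  "rescaled_lim (Tang a b) = 1"
| "rescaled_lim (Pt p) = p"

text \<open>The parameter interval of a path truncated by \<open>\<epsilon>\<close> at its tangential ends.\<close>

fun trunc_lo :: "endpt \<Rightarrow> real \<Rightarrow> real" where
  "trunc_lo (Tang a b) \<epsilon> = \<epsilon>"
| "trunc_lo (Pt p) \<epsilon> = 0"

definition trunc_hi :: "endpt \<Rightarrow> real \<Rightarrow> real" where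
  "trunc_hi f \<epsilon> = 1 - trunc_lo f \<epsilon>"

definition is_path :: "endpt \<Rightarrow> endpt \<Rightarrow> (real \<Rightarrow> complex) \<Rightarrow> bool" where
  "is_path e f \<gamma> \<longleftrightarrow>
     proper_end e \<and> proper_end f \<and>
     \<gamma> ` {0<..<1} \<subseteq> Ycurve \<and>
     (\<forall>\<epsilon>. 0 < \<epsilon> \<and> \<epsilon> < 1/2 \<longrightarrow> \<gamma> piecewise_C1_differentiable_on {trunc_lo e \<epsilon>..trunc_hi f \<epsilon>}) \<and>
     ((\<lambda>t. rescaled e t (\<gamma> t)) \<longlongrightarrow> rescaled_lim e) (at_right 0) \<and>
     ((\<lambda>t. rescaled f t (\<gamma> (1 - t))) \<longlongrightarrow> rescaled_lim f) (at_right 0)"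

text \<open>
  Homotopy through (continuous) paths from \<open>e\<close> to \<open>f\<close>. The tangency conditions have to hold
  uniformly in the homotopy parameter: if they were only imposed on each path separately, a path
  could be unwound around a cusp.
\<close>

definition path_homotopic :: "endpt \<Rightarrow> endpt \<Rightarrow> (real \<Rightarrow> complex) \<Rightarrow> (real \<Rightarrow> complex) \<Rightarrow> bool" where
  "path_homotopic e f \<gamma> \<gamma>' \<longleftrightarrow>
     (\<exists>H :: real \<times> real \<Rightarrow> complex.
        continuous_on ({0..1} \<times> {0<..<1}) H \<and>
        H ` ({0..1} \<times> {0<..<1}) \<subseteq> Ycurve \<and>
        (\<forall>t\<in>{0<..<1}. H (0, t) = \<gamma> t \<and> H (1, t) = \<gamma>' t) \<and>
        uniform_limit {0..1} (\<lambda>t s. rescaled e t (H (s, t))) (\<lambda>_. rescaled_lim e) (at_right 0) \<and>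
        uniform_limit {0..1} (\<lambda>t s. rescaled f t (H (s, 1 - t))) (\<lambda>_. rescaled_lim f) (at_right 0))"

definition path_class :: "endpt \<Rightarrow> endpt \<Rightarrow> (real \<Rightarrow> complex) \<Rightarrow> (real \<Rightarrow> complex) set" where
  "path_class e f \<gamma> = {\<gamma>'. is_path e f \<gamma>' \<and> path_homotopic e f \<gamma> \<gamma>'}"

text \<open>
  Concatenation, in the order written. The polynomial \<open>t + 2 t\<^sup>2\<close> maps \<open>[0, 1/2]\<close> onto \<open>[0, 1]\<close>
  with derivative 1 at 0, so that the unit tangent vectors at the outer ends are preserved. If \<open>u\<close>
  ends, and \<open>v\<close> starts, at a tangent vector, the joined path runs into the cusp at \<open>t = 1/2\<close> and
  leaves it on the same side; \<open>cut_join \<delta> u v\<close> avoids the cusp by a chord near that tangent vector.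
  For all small \<open>\<delta>\<close> this gives the same homotopy class, which is the composite.
\<close>

definition path_join :: "(real \<Rightarrow> complex) \<Rightarrow> (real \<Rightarrow> complex) \<Rightarrow> real \<Rightarrow> complex" where
  "path_join u v t = (if t \<le> 1/2 then u (t + 2 * t^2) else v (1 - ((1 - t) + 2 * (1 - t)^2)))"

definition cut_join :: "real \<Rightarrow> (real \<Rightarrow> complex) \<Rightarrow> (real \<Rightarrow> complex) \<Rightarrow> real \<Rightarrow> complex" where
  "cut_join \<delta> u v t =
     (if \<bar>t - 1/2\<bar> < \<delta>
      then linepath (path_join u v (1/2 - \<delta>)) (path_join u v (1/2 + \<delta>)) ((t - (1/2 - \<delta>)) / (2 * \<delta>))
      else path_join u v t)"

definition concat_class ::
    "endpt \<Rightarrow> endpt \<Rightarrow> (real \<Rightarrow> complex) set \<Rightarrow> (real \<Rightarrow> complex) set \<Rightarrow> (real \<Rightarrow> complex) set" where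
  "concat_class e f A B =
     {w. is_path e f w \<and>
         (\<exists>u\<in>A. \<exists>v\<in>B. \<forall>\<^sub>F \<delta> in at_right 0. path_homotopic e f (cut_join \<delta> u v) w)}"


section \<open>The finite group and its actions\<close>

definition mat2 :: "'a::zero \<Rightarrow> 'a \<Rightarrow> 'a \<Rightarrow> 'a \<Rightarrow> 'a^2^2" where
  "mat2 a b c d = vector [vector [a, b], vector [c, d]]"

text \<open>The group \<open>SL(2, \<int>/2\<int>)\<close> consists of the matrices of determinant 1 with entries in the
  two-element field \<open>bit\<close>.\<close>

definition sigma_bar :: "bit^2^2" where
  "sigma_bar = mat2 0 1 1 0"

definition rho_bar :: "bit^2^2" where
  "rho_bar = mat2 1 1 0 1"

definition six_cases :: "bit^2^2 \<Rightarrow> 'a \<Rightarrow> 'a \<Rightarrow> 'a \<Rightarrow> 'a \<Rightarrow> 'a \<Rightarrow> 'a \<Rightarrow> 'a" where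
  "six_cases g x\<^sub>1 x\<^sub>\<sigma> x\<^sub>\<rho> x\<^sub>\<sigma>\<^sub>\<rho> x\<^sub>\<rho>\<^sub>\<sigma> x\<^sub>\<rho>\<^sub>\<sigma>\<^sub>\<rho> =
     (if g = mat 1 then x\<^sub>1
      else if g = sigma_bar then x\<^sub>\<sigma>
      else if g = rho_bar then x\<^sub>\<rho>
      else if g = sigma_bar ** rho_bar then x\<^sub>\<sigma>\<^sub>\<rho>
      else if g = rho_bar ** sigma_bar then x\<^sub>\<rho>\<^sub>\<sigma>
      else x\<^sub>\<rho>\<^sub>\<sigma>\<^sub>\<rho>)"

definition moebius_act :: "bit^2^2 \<Rightarrow> complex \<Rightarrow> complex" where
  "moebius_act g z = six_cases g z (1 - z) (z / (z - 1)) (1 / (1 - z)) ((z - 1) / z) (1 / z)"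

text \<open>The permutation of the cusps induced by \<open>moebius_act g\<close>, tabulated by the images of
  \<open>0, 1, \<infinity>\<close>.\<close>

definition cusp_act :: "bit^2^2 \<Rightarrow> cusp \<Rightarrow> cusp" where
  "cusp_act g = six_cases g
     (case_cusp C0 C1 Cinf) (case_cusp C1 C0 Cinf) (case_cusp C0 Cinf C1)
     (case_cusp C1 Cinf C0) (case_cusp Cinf C0 C1) (case_cusp Cinf C1 C0)"

fun end_act :: "bit^2^2 \<Rightarrow> endpt \<Rightarrow> endpt" where
  "end_act g (Tang a b) = Tang (cusp_act g a) (cusp_act g b)"
| "end_act g (Pt p) = Pt (moebius_act g p)"

text \<open>
  The action on the pair of variables: \<open>var_act g L0\<close> and \<open>var_act g L1\<close> are the entries of the
  image of \<open>(X\<^sub>0, X\<^sub>1)\<close>. As operations on pairs, \<open>\<sigma>\<close> sends \<open>(A, B)\<close> to \<open>(-B, -A)\<close>, \<open>\<rho>\<close> sends \<open>(A, B)\<close>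
  to \<open>(A, A - B)\<close>, and the remaining values are obtained by composing these in functional order.
  Equivalently, the pullback under \<open>moebius_act g\<close> of \<open>dz/z gX\<^sub>0 + dz/(1-z) gX\<^sub>1\<close> is
  \<open>dz/z X\<^sub>0 + dz/(1-z) X\<^sub>1\<close>. If instead \<open>\<sigma>\<close> and \<open>\<rho>\<close> are composed in the same order as algebra
  automorphisms, the pairs of the two elements of order three are interchanged, and this
  invariance fails for them.
\<close>

definition var_act :: "bit^2^2 \<Rightarrow> letter \<Rightarrow> ncseries" where
  "var_act g = (let X0 = nc_var L0; X1 = nc_var L1 in six_cases g
     (case_letter X0 X1) (case_letter (- X1) (- X0)) (case_letter X0 (X0 - X1))
     (case_letter (X1 - X0) (- X0)) (case_letter (- X1) (X0 - X1)) (case_letter (X1 - X0) X1))"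


section \<open>The group of path classes\<close>

definition end_perm :: "endpt \<Rightarrow> bit^2^2" where
  "end_perm f = (THE g. det g = 1 \<and> end_act g (Tang C0 C1) = f)"

text \<open>An element is a homotopy class together with its endpoint (which the class determines).\<close>

type_synonym path_elt = "endpt \<times> (real \<Rightarrow> complex) set"

definition G01 :: "path_elt monoid" where
  "G01 = \<lparr>
     carrier = {(f, path_class (Tang C0 C1) f \<gamma>) | f \<gamma>. f \<in> range (case_prod Tang) \<and> is_path (Tang C0 C1) f \<gamma>},
     mult = (\<lambda>(f, A) (f', B).
       let f'' = end_act (end_perm f) f'
       in (f'', concat_class (Tang C0 C1) f'' A ((\<lambda>v. moebius_act (end_perm f) \<circ> v) ` B))),
     one = (Tang C0 C1, path_class (Tang C0 C1) (Tang C0 C1) (\<lambda>t. of_real (t * (1 - t))))\<rparr>"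

definition s_class :: "path_elt" where
  "s_class = (Tang C1 C0, path_class (Tang C0 C1) (Tang C1 C0) of_real)"

definition r_class :: "path_elt" where
  "r_class = (Tang C0 Cinf,
     path_class (Tang C0 C1) (Tang C0 Cinf) (\<lambda>t. of_real (t * (1 - t)) * exp (\<i> * of_real (pi * t))))"


section \<open>The modular group\<close>

definition SL2Z :: "(int^2^2) monoid" where
  "SL2Z = \<lparr>carrier = {A. det A = 1}, mult = (**), one = mat 1\<rparr>"

definition PSL2Z :: "(int^2^2) set monoid" where
  "PSL2Z = SL2Z Mod {mat 1, - mat 1}"

definition rho_psl :: "(int^2^2) set" where
  "rho_psl = {mat 1, - mat 1} #>\<^bsub>SL2Z\<^esub> mat2 1 1 0 1"

definition sigma_psl :: "(int^2^2) set" where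
  "sigma_psl = {mat 1, - mat 1} #>\<^bsub>SL2Z\<^esub> mat2 0 (-1) 1 0"

definition reduction :: "(int^2^2) set \<Rightarrow> bit^2^2" where
  "reduction \<alpha> = the_elem ((\<lambda>A. \<chi> i j. of_int (A $ i $ j)) ` \<alpha>)"


section \<open>Regularized Chen series\<close>

fun form_coeff :: "letter \<Rightarrow> complex \<Rightarrow> complex" where
  "form_coeff L0 z = 1 / z"
| "form_coeff L1 z = 1 / (1 - z)"

text \<open>
  The integral over \<open>a < t\<^sub>1 < \<dots> < t\<^sub>k < b\<close> as an iterated one. The first letter of the word belongs
  to the smallest parameter.
\<close>

primrec chen_coeff :: "(real \<Rightarrow> complex) \<Rightarrow> real \<Rightarrow> letter list \<Rightarrow> real \<Rightarrow> complex" where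
  "chen_coeff \<gamma> b [] = (\<lambda>a. 1)"
| "chen_coeff \<gamma> b (i # w) =
     (\<lambda>a. integral {a..b}
        (\<lambda>t. form_coeff i (\<gamma> t) * vector_derivative \<gamma> (at t) * chen_coeff \<gamma> b w t))"

definition chen_series :: "(real \<Rightarrow> complex) \<Rightarrow> real \<Rightarrow> real \<Rightarrow> ncseries" where
  "chen_series \<gamma> a b w = chen_coeff \<gamma> b w a"

fun cusp_residue :: "cusp \<Rightarrow> ncseries" where
  "cusp_residue C0 = nc_var L0"
| "cusp_residue C1 = - nc_var L1"
| "cusp_residue Cinf = nc_var L1 - nc_var L0"

fun reg_factor :: "endpt \<Rightarrow> complex \<Rightarrow> ncseries" where
  "reg_factor (Tang a b) c = nc_exp (nc_scale c (cusp_residue a))"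
| "reg_factor (Pt p) c = nc_one"

text \<open>
  Truncation at parameter \<open>\<epsilon>\<close>: the paths have unit speed at their tangential ends, so that the
  local coordinate of the truncation point is \<open>\<epsilon>\<close> up to a factor tending to 1.
\<close>

definition has_chen_series :: "endpt \<Rightarrow> endpt \<Rightarrow> (real \<Rightarrow> complex) \<Rightarrow> ncseries \<Rightarrow> bool" where
  "has_chen_series e f \<gamma> S \<longleftrightarrow>
     (\<forall>w. ((\<lambda>\<epsilon>. (reg_factor e (of_real (ln \<epsilon>))
               \<star> chen_series \<gamma> (trunc_lo e \<epsilon>) (trunc_hi f \<epsilon>)
               \<star> reg_factor f (- of_real (ln \<epsilon>))) w) \<longlongrightarrow> S w) (at_right 0))"

text \<open>The common value of the regularized Chen series of all paths in \<open>A\<close>.\<close>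

definition chen_of :: "endpt \<Rightarrow> endpt \<Rightarrow> (real \<Rightarrow> complex) set \<Rightarrow> ncseries" where
  "chen_of e f A = (THE S. \<forall>\<gamma>\<in>A. has_chen_series e f \<gamma> S)"


section \<open>The polylogarithm generating function and the action on it\<close>

text \<open>The open real segment between two cusps that does not contain the third.\<close>

fun cusp_gap :: "cusp \<Rightarrow> cusp \<Rightarrow> complex set" where
  "cusp_gap C0 C1 = of_real ` {0<..<1}"
| "cusp_gap C1 C0 = of_real ` {0<..<1}"
| "cusp_gap C0 Cinf = of_real ` {..<0}"
| "cusp_gap Cinf C0 = of_real ` {..<0}"
| "cusp_gap C1 Cinf = of_real ` {1<..}"
| "cusp_gap Cinf C1 = of_real ` {1<..}"
| "cusp_gap _ _ = {}"

text \<open>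
  The paths from the tangent vector at \<open>a\<close> towards \<open>b\<close> to the point \<open>p\<close> that do not meet the real
  axis, except that for real \<open>p\<close> they may meet it in the segment between \<open>a\<close> and \<open>b\<close> (which then
  contains \<open>p\<close>).
\<close>

definition direct_paths :: "endpt \<Rightarrow> complex \<Rightarrow> (real \<Rightarrow> complex) set" where
  "direct_paths e p = {\<gamma>. is_path e (Pt p) \<gamma> \<and>
     (\<exists>a b. e = Tang a b \<and>
       (if p \<in> \<real> then \<gamma> ` {0<..1} \<subseteq> - \<real> \<union> cusp_gap a b else \<gamma> ` {0<..1} \<subseteq> - \<real>))}"

definition Li :: "complex \<Rightarrow> ncseries" where
  "Li z = chen_of (Tang C0 C1) (Pt z) (direct_paths (Tang C0 C1) z)"

text \<open>Below, \<open>\<Psi>\<close> is the identification of \<open>G01\<close> with \<open>PSL2Z\<close>.\<close>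

definition path_element ::
    "(path_elt \<Rightarrow> (int^2^2) set) \<Rightarrow> (int^2^2) set \<Rightarrow> path_elt" where
  "path_element \<Psi> \<alpha> = inv_into (carrier G01) \<Psi> \<alpha>"

definition F_series ::
    "(path_elt \<Rightarrow> (int^2^2) set) \<Rightarrow> (int^2^2) set \<Rightarrow> ncseries" where
  "F_series \<Psi> \<alpha> = (case path_element \<Psi> \<alpha> of (f, A) \<Rightarrow>
     nc_subst (chen_of (Tang C0 C1) f A) (var_act (reduction \<alpha>)))"

definition Li_act ::
    "(path_elt \<Rightarrow> (int^2^2) set) \<Rightarrow> (int^2^2) set \<Rightarrow> complex \<Rightarrow> ncseries" where
  "Li_act \<Psi> \<alpha> z = (case path_element \<Psi> \<alpha> of (f, A) \<Rightarrow>
     let p = moebius_act (reduction \<alpha>) z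
     in nc_subst (chen_of (Tang C0 C1) (Pt p)
                   (concat_class (Tang C0 C1) (Pt p) A (direct_paths f p)))
          (var_act (reduction \<alpha>)))"

end

theory Submission
  imports Defs "HOL-Complex_Analysis.Complex_Analysis"
begin

text \<open>
  The regularized Chen series of a path is a parallel transport. Call a series-valued function \<open>\<Psi>\<close>
  flat if \<open>d\<Psi> = - (dz/z X\<^sub>0 + dz/(1 - z) X\<^sub>1) \<Psi>\<close>. Flat functions exist on starlike domains, are unique
  up to a constant right factor (\<open>flat_on_exists\<close>, \<open>flat_on_unique\<close>), and can be continued along every
  path. The Chen series of a path compares the flat function that is 1 at its final point, continued
  back to the initial point, with the one that is 1 there. At a tangential base point the value 1
  is replaced by the asymptotic behaviour \<open>exp (- R log c)\<close> in the local coordinate \<open>c\<close>, where \<open>R\<close> is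
  the residue; this is exactly the effect of the regularizing factors. So every end \<open>e\<close> of a path has
  a distinguished flat function \<open>end_section e\<close> near it, and \<open>transports e f \<gamma> S\<close> expresses that the
  section of \<open>f\<close>, continued back along \<open>\<gamma>\<close>, is the section of \<open>e\<close> times \<open>S\<close>.

  This transport has three properties. It is the regularized Chen series
  (\<open>transports_has_chen_series\<close>), which shows in particular that the limit exists. It depends on the
  homotopy class only (\<open>homotopy_transport\<close>): a homotopy of paths carries a continuation of flat
  functions just as a path does, because a cocycle of local transports on a convex set extends
  globally by repeated halving of triangles (\<open>cocycle_doubling\<close>). It is multiplicative under
  concatenation (\<open>transports_cut_join\<close>).

  Now let \<open>u\<close> be a path in the class of \<open>\<alpha>\<close>, ending at the tangent vector \<open>cd\<close>, and let \<open>v\<close> be a direct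
  path from there to \<open>\<alpha>(z)\<close>, where the finite group acts through the reduction \<open>g\<close> of \<open>\<alpha>\<close>. Analytic
  continuation along \<open>u\<close> and \<open>v\<close> has the Chen series \<open>C\<^sub>u C\<^sub>v\<close>. The substitution of \<open>gX\<^sub>0, gX\<^sub>1\<close> for the
  variables is multiplicative and turns \<open>C\<^sub>u\<close> into \<open>F\<^sub>\<alpha>\<close>. It turns \<open>C\<^sub>v\<close> into \<open>Li(z)\<close>: the
  transformation \<open>g\<close> maps the tangent vector \<open>01\<close> to \<open>cd\<close> and direct paths to direct paths, and the
  pullback of the connection form with coefficients \<open>gX\<^sub>0, gX\<^sub>1\<close> is the connection form with
  coefficients \<open>X\<^sub>0, X\<^sub>1\<close> (\<open>Li_moebius\<close>).

  The fact that \<open>g\<close> maps \<open>01\<close> to \<open>cd\<close> is a statement about the isomorphism \<open>\<Psi>\<close>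
  (\<open>path_element_endpoint\<close>). It holds for \<open>s\<close> and \<open>r\<close> and is inherited by products; as \<open>\<sigma>\<close> and \<open>\<rho>\<close>
  generate the modular group, it holds for all \<open>\<alpha>\<close>. This argument forms products in \<open>G01\<close>, and so
  rests on the fact that the composite of two path classes is a path class.
\<close>

section \<open>The algebra of series in two non-commuting variables\<close>

lemma nc_mult_Nil: "(S \<star> T) [] = S [] * T []"
  by (simp add: nc_mult_def)

text \<open>
  Together with its version for the empty word, this rule reduces identities about products to
  inductions on the word: removing the first letter acts on a product like a derivation twisted by
  the constant term.
\<close>

lemma nc_mult_Cons: "(S \<star> T) (i # w) = S [] * T (i # w) + ((\<lambda>u. S (i # u)) \<star> T) w"
proof -
  have "(S \<star> T) (i # w) = (\<Sum>k\<le>Suc (length w). S (take k (i # w)) * T (drop k (i # w)))"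
    by (simp add: nc_mult_def)
  also have "\<dots> = S [] * T (i # w) + ((\<lambda>u. S (i # u)) \<star> T) w"
    by (subst sum.atMost_Suc_shift) (simp add: nc_mult_def)
  finally show ?thesis .
qed

lemma nc_mult_linear_left:
  "((\<lambda>u. c * A u + B u) \<star> T) w = c * (A \<star> T) w + (B \<star> T) w"
  by (simp add: nc_mult_def sum.distrib sum_distrib_left algebra_simps)

lemma nc_mult_linear_right:
  "(T \<star> (\<lambda>u. c * A u + B u)) w = c * (T \<star> A) w + (T \<star> B) w"
  by (simp add: nc_mult_def sum.distrib sum_distrib_left algebra_simps)

lemma nc_mult_assoc: "S \<star> T \<star> U = S \<star> (T \<star> U)"
proof
  fix w
  show "(S \<star> T \<star> U) w = (S \<star> (T \<star> U)) w"
  proof (induction w arbitrary: S)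
    case Nil
    show ?case by (simp add: nc_mult_Nil)
  next
    case (Cons i w)
    show ?case
      by (simp add: nc_mult_Cons nc_mult_Nil nc_mult_linear_left Cons.IH algebra_simps)
  qed
qed

lemma nc_mult_one_right [simp]: "S \<star> nc_one = S"
proof
  fix w show "(S \<star> nc_one) w = S w"
    by (induction w arbitrary: S) (simp_all add: nc_mult_Nil nc_mult_Cons nc_one_def)
qed

lemma nc_mult_zero_left: "((\<lambda>u. 0) \<star> T) w = 0"
  by (simp add: nc_mult_def)

lemma nc_mult_one_left [simp]: "nc_one \<star> S = S"
proof
  fix w show "(nc_one \<star> S) w = S w"
    by (cases w) (simp_all add: nc_mult_Nil nc_mult_Cons nc_one_def nc_mult_zero_left)
qed

subsection \<open>Inverses\<close>

text \<open>
  Solving \<open>S \<star> T = 1\<close> for the coefficients of \<open>T\<close> by increasing length of the word, when \<open>S\<close>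
  has constant term 1. The series with constant term 1 form a group, which contains all Chen series
  and all values of flat sections.
\<close>

function nc_inv :: "ncseries \<Rightarrow> ncseries" where
  "nc_inv S w = (if w = [] then 1
     else - (\<Sum>k\<in>{1..length w}. S (take k w) * nc_inv S (drop k w)))"
  by pat_completeness auto
termination by (relation "Wellfounded.measure (\<lambda>(S, w). length w)") auto

declare nc_inv.simps [simp del]

lemma nc_inv_Nil [simp]: "nc_inv S [] = 1"
  by (simp add: nc_inv.simps)

lemma nc_mult_inv_right:
  assumes "S [] = 1"
  shows "S \<star> nc_inv S = nc_one"
proof
  fix w
  show "(S \<star> nc_inv S) w = nc_one w"
  proof (cases "w = []")
    case True
    then show ?thesis by (simp add: nc_mult_Nil nc_one_def assms)
  next
    case False
    have "{..length w} = insert 0 {1..length w}" by auto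
    then have "(S \<star> nc_inv S) w = nc_inv S w + (\<Sum>k\<in>{1..length w}. S (take k w) * nc_inv S (drop k w))"
      by (simp add: nc_mult_def assms)
    also have "\<dots> = 0"
      using False by (subst nc_inv.simps) simp
    finally show ?thesis using False by (simp add: nc_one_def)
  qed
qed

text \<open>
  A right inverse that itself has a right inverse is a left inverse.
\<close>

lemma nc_mult_inv_left:
  assumes "S [] = 1"
  shows "nc_inv S \<star> S = nc_one"
proof -
  let ?T = "nc_inv S"
  have "?T \<star> nc_inv ?T = nc_one" by (rule nc_mult_inv_right) simp
  moreover have "S = S \<star> (?T \<star> nc_inv ?T)" by (simp add: calculation)
  then have "S = S \<star> ?T \<star> nc_inv ?T"
    by (simp only: nc_mult_assoc)
  then have "S = nc_inv ?T"
    by (simp only: nc_mult_inv_right [of S, OF assms] nc_mult_one_left)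
  ultimately show ?thesis by simp
qed

lemma nc_inv_unique:
  assumes "S [] = 1" "S \<star> T = nc_one"
  shows "T = nc_inv S"
  by (metis assms nc_mult_assoc nc_mult_inv_left nc_mult_one_left nc_mult_one_right)

lemma nc_mult_left_cancel:
  assumes "S [] = 1" "S \<star> T = S \<star> U"
  shows "T = U"
  by (metis assms nc_mult_assoc nc_mult_inv_left nc_mult_one_left)

subsection \<open>Coefficientwise limits and derivatives\<close>

lemma nc_mult_tendsto:
  assumes "\<And>w. ((\<lambda>x. S x w) \<longlongrightarrow> S' w) F" "\<And>w. ((\<lambda>x. T x w) \<longlongrightarrow> T' w) F"
  shows "((\<lambda>x. (S x \<star> T x) w) \<longlongrightarrow> (S' \<star> T') w) F"
  unfolding nc_mult_def by (intro tendsto_intros assms)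

lemma nc_inv_tendsto:
  assumes "\<And>w. ((\<lambda>x. S x w) \<longlongrightarrow> S' w) F"
  shows "((\<lambda>x. nc_inv (S x) w) \<longlongrightarrow> nc_inv S' w) F"
proof (induction w rule: length_induct)
  case (1 w)
  show ?case
  proof (cases "w = []")
    case False
    have "((\<lambda>x. - (\<Sum>k\<in>{1..length w}. S x (take k w) * nc_inv (S x) (drop k w)))
        \<longlongrightarrow> - (\<Sum>k\<in>{1..length w}. S' (take k w) * nc_inv S' (drop k w))) F"
      using False 1 by (intro tendsto_intros assms) auto
    then show ?thesis
      using False by (subst (1 2) nc_inv.simps) simp
  qed simp
qed

lemma nc_mult_has_derivative:
  assumes "\<And>w. ((\<lambda>x. S x w) has_field_derivative S' w) (at x)"
    and "\<And>w. ((\<lambda>x. T x w) has_field_derivative T' w) (at x)"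
  shows "((\<lambda>x. (S x \<star> T x) w) has_field_derivative (S' \<star> T x) w + (S x \<star> T') w) (at x)"
proof -
  have "((\<lambda>x. (S x \<star> T x) w) has_field_derivative
      (\<Sum>k\<le>length w. S x (take k w) * T' (drop k w) + S' (take k w) * T x (drop k w))) (at x)"
    unfolding nc_mult_def by (intro DERIV_sum DERIV_mult' assms)
  then show ?thesis by (simp add: nc_mult_def sum.distrib add.commute)
qed

subsection \<open>Linear series and their exponentials\<close>

text \<open>
  The residues at the cusps and the images of the variables under the finite group are linear
  combinations of the two variables; these are the series supported on words of length one.
\<close>

definition linear_series :: "ncseries \<Rightarrow> bool" where
  "linear_series R \<longleftrightarrow> (\<forall>w. length w \<noteq> 1 \<longrightarrow> R w = 0)"

lemma linear_series_mult_Cons: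
  assumes "linear_series R"
  shows "(R \<star> S) (i # w) = R [i] * S w"
proof -
  have "((\<lambda>u. R (i # u)) \<star> S) w = R [i] * S w"
  proof (cases w)
    case (Cons j v)
    have "(\<lambda>u. R (i # j # u)) = (\<lambda>u. 0)"
      using assms by (auto simp: linear_series_def)
    then show ?thesis by (simp add: Cons nc_mult_Cons nc_mult_zero_left)
  qed (simp add: nc_mult_Nil)
  then show ?thesis
    using assms by (simp add: nc_mult_Cons linear_series_def)
qed

lemma linear_series_mult_snoc:
  assumes "linear_series R"
  shows "(S \<star> R) (w @ [i]) = S w * R [i]"
proof (induction w arbitrary: S)
  case Nil
  show ?case using assms by (simp add: nc_mult_Cons nc_mult_Nil linear_series_def)
next
  case (Cons j w)
  have "(S \<star> R) (j # w @ [i]) = S [] * R (j # w @ [i]) + ((\<lambda>u. S (j # u)) \<star> R) (w @ [i])"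
    by (rule nc_mult_Cons)
  then show ?case using Cons.IH assms by (simp add: linear_series_def)
qed

lemma linear_series_mult_Nil:
  assumes "linear_series R"
  shows "(R \<star> S) [] = 0" "(S \<star> R) [] = 0"
  using assms by (simp_all add: nc_mult_Nil linear_series_def)

lemma linear_series_var: "linear_series (nc_var i)"
  by (auto simp: linear_series_def nc_var_def)

lemma linear_series_uminus: "linear_series R \<Longrightarrow> linear_series (- R)"
  by (auto simp: linear_series_def)

lemma linear_series_diff: "linear_series R \<Longrightarrow> linear_series S \<Longrightarrow> linear_series (R - S)"
  by (auto simp: linear_series_def)

lemma linear_series_scale: "linear_series R \<Longrightarrow> linear_series (nc_scale c R)"
  by (auto simp: linear_series_def nc_scale_def)

lemmas linear_series_intros =
  linear_series_var linear_series_uminus linear_series_diff linear_series_scale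

lemma nc_pow_linear:
  assumes "linear_series R"
  shows "nc_pow R n w = (if length w = n then (\<Prod>i\<leftarrow>w. R [i]) else 0)"
proof (induction n arbitrary: w)
  case 0
  show ?case by (auto simp: nc_one_def)
next
  case (Suc n)
  show ?case
    by (cases w) (simp_all add: linear_series_mult_Nil linear_series_mult_Cons assms Suc.IH)
qed

lemma prod_list_scale: "(\<Prod>i\<leftarrow>w. c * f i) = (c :: complex) ^ length w * (\<Prod>i\<leftarrow>w. f i)"
  by (induction w) auto

text \<open>
  A word occurs in exactly one power of a linear series, so that each coefficient of the
  exponential is a single term. All properties of exponentials below are read off from this.
\<close>

lemma nc_exp_linear:
  assumes "linear_series R"
  shows "nc_exp (nc_scale c R) w = c ^ length w / fact (length w) * (\<Prod>i\<leftarrow>w. R [i])"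
proof -
  have "nc_exp (nc_scale c R) w =
      (\<Sum>n\<le>length w. if n = length w then (\<Prod>i\<leftarrow>w. c * R [i]) / fact n else 0)"
    unfolding nc_exp_def
    by (rule sum.cong)
      (auto simp: nc_pow_linear [OF linear_series_scale [OF assms]], simp add: nc_scale_def)
  then show ?thesis by (simp add: prod_list_scale)
qed

lemma nc_exp_linear_Nil: "linear_series R \<Longrightarrow> nc_exp (nc_scale c R) [] = 1"
  by (simp add: nc_exp_linear)

lemma nc_exp_zero: "linear_series R \<Longrightarrow> nc_exp (nc_scale 0 R) = nc_one"
  by (rule ext) (simp add: nc_exp_linear nc_one_def power_0_left)

lemma nc_exp_add:
  assumes "linear_series R"
  shows "nc_exp (nc_scale c R) \<star> nc_exp (nc_scale d R) = nc_exp (nc_scale (c + d) R)"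
proof
  fix w
  let ?P = "\<Prod>i\<leftarrow>w. R [i]" and ?n = "length w"
  have "(nc_exp (nc_scale c R) \<star> nc_exp (nc_scale d R)) w =
      (\<Sum>k\<le>?n. c ^ k / fact k * (d ^ (?n - k) / fact (?n - k)) * ?P)"
    unfolding nc_mult_def
  proof (rule sum.cong)
    fix k assume k: "k \<in> {..?n}"
    have "?P = (\<Prod>i\<leftarrow>take k w @ drop k w. R [i])" by simp
    also have "\<dots> = (\<Prod>i\<leftarrow>take k w. R [i]) * (\<Prod>i\<leftarrow>drop k w. R [i])"
      by (simp only: map_append prod_list.append)
    finally show "nc_exp (nc_scale c R) (take k w) * nc_exp (nc_scale d R) (drop k w) =
        c ^ k / fact k * (d ^ (?n - k) / fact (?n - k)) * ?P"
      using k by (simp add: nc_exp_linear assms min_absorb2)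
  qed simp
  also have "\<dots> = (\<Sum>k\<le>?n. of_nat (?n choose k) * c ^ k * d ^ (?n - k)) / fact ?n * ?P"
    unfolding sum_divide_distrib sum_distrib_right
    by (rule sum.cong) (simp_all add: binomial_fact field_simps)
  also have "\<dots> = (c + d) ^ ?n / fact ?n * ?P"
    by (simp add: binomial_ring)
  finally show "(nc_exp (nc_scale c R) \<star> nc_exp (nc_scale d R)) w = nc_exp (nc_scale (c + d) R) w"
    by (simp add: nc_exp_linear assms)
qed

lemma nc_exp_minus:
  assumes "linear_series R"
  shows "nc_exp (nc_scale c R) \<star> nc_exp (nc_scale (- c) R) = nc_one"
  by (simp add: nc_exp_add assms nc_exp_zero)

lemma nc_exp_tendsto:
  assumes "linear_series R" "(f \<longlongrightarrow> c) F"
  shows "((\<lambda>x. nc_exp (nc_scale (f x) R) w) \<longlongrightarrow> nc_exp (nc_scale c R) w) F"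
  unfolding nc_exp_linear [OF assms(1)] by (intro tendsto_intros assms(2)) simp

lemma nc_exp_has_derivative:
  assumes R: "linear_series R"
  shows "((\<lambda>c. nc_exp (nc_scale c R) w) has_field_derivative (R \<star> nc_exp (nc_scale c R)) w) (at c)"
proof (cases w)
  case Nil
  then show ?thesis by (simp add: nc_exp_linear_Nil R linear_series_mult_Nil)
next
  case (Cons i v)
  let ?n = "length v" and ?P = "\<Prod>i\<leftarrow>v. R [i]"
  have "((\<lambda>c. c ^ Suc ?n * (R [i] * ?P / fact (Suc ?n))) has_field_derivative
      of_nat (Suc ?n) * c ^ ?n * (R [i] * ?P / fact (Suc ?n))) (at c)"
    by (rule derivative_eq_intros refl | simp)+
  moreover have "of_nat (Suc ?n) * c ^ ?n * (R [i] * ?P / fact (Suc ?n)) =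
      R [i] * (c ^ ?n / fact ?n * ?P)"
    by (simp add: field_simps del: of_nat_Suc)
  ultimately show ?thesis
    unfolding nc_exp_linear [OF R] Cons linear_series_mult_Cons [OF R]
    by (simp add: mult_ac del: of_nat_Suc fact_Suc)
qed

subsection \<open>Linear substitutions\<close>

lemma finite_words: "finite {w :: letter list. length w \<le> n}"
proof -
  have "(UNIV :: letter set) = {L0, L1}" using letter.exhaust by auto
  then have "finite (UNIV :: letter set)" by (metis finite.emptyI finite.insertI)
  then show ?thesis using finite_lists_length_le [of "UNIV :: letter set" n] by simp
qed

lemma nc_subst_Nil: "nc_subst S Z [] = S []"
  by (simp add: nc_subst_def nc_one_def)

text \<open>
  A linear substitution preserves the length of words, and therefore may be carried out letter by
  letter. This is the recursion behind all facts on substitutions.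
\<close>

lemma nc_subst_Cons:
  assumes Z: "\<And>i. linear_series (Z i)"
  shows "nc_subst S Z (j # v) =
    Z L0 [j] * nc_subst (\<lambda>u. S (L0 # u)) Z v + Z L1 [j] * nc_subst (\<lambda>u. S (L1 # u)) Z v"
proof -
  let ?W = "{w :: letter list. length w \<le> length v}"
  let ?h = "\<lambda>w. S w * nc_word Z w (j # v)"
  have eq: "{w. length w \<le> length (j # v)} = insert [] (Cons L0 ` ?W \<union> Cons L1 ` ?W)"
  proof (intro equalityI subsetI)
    fix w :: "letter list" assume "w \<in> {w. length w \<le> length (j # v)}"
    then show "w \<in> insert [] (Cons L0 ` ?W \<union> Cons L1 ` ?W)"
      by (cases w; cases "hd w") auto
  qed auto
  have fin: "finite ?W" by (rule finite_words)
  have "nc_subst S Z (j # v) = sum ?h (insert [] (Cons L0 ` ?W \<union> Cons L1 ` ?W))"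
    unfolding nc_subst_def eq ..
  also have "\<dots> = sum ?h (Cons L0 ` ?W) + sum ?h (Cons L1 ` ?W)"
    using fin by (subst sum.insert) (auto intro!: sum.union_disjoint simp: nc_one_def)
  also have "\<dots> = (\<Sum>w\<in>?W. ?h (L0 # w)) + (\<Sum>w\<in>?W. ?h (L1 # w))"
    by (subst (1 2) sum.reindex) (auto simp: inj_on_def)
  also have "\<dots> = Z L0 [j] * nc_subst (\<lambda>u. S (L0 # u)) Z v + Z L1 [j] * nc_subst (\<lambda>u. S (L1 # u)) Z v"
    by (simp add: nc_subst_def linear_series_mult_Cons Z sum_distrib_left algebra_simps)
  finally show ?thesis .
qed

lemma nc_subst_linear:
  "nc_subst (\<lambda>u. c * A u + B u) Z v = c * nc_subst A Z v + nc_subst B Z v"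
  by (simp add: nc_subst_def sum.distrib sum_distrib_left algebra_simps)

lemma nc_subst_mult:
  assumes Z: "\<And>i. linear_series (Z i)"
  shows "nc_subst (S \<star> T) Z = nc_subst S Z \<star> nc_subst T Z"
proof
  fix v
  show "nc_subst (S \<star> T) Z v = (nc_subst S Z \<star> nc_subst T Z) v"
  proof (induction v arbitrary: S)
    case Nil
    show ?case by (simp add: nc_subst_Nil nc_mult_Nil)
  next
    case (Cons j v)
    define A B where "A = (\<lambda>u. S (L0 # u))" and "B = (\<lambda>u. S (L1 # u))"
    have dS: "(\<lambda>u. nc_subst S Z (j # u)) =
        (\<lambda>u. Z L0 [j] * nc_subst A Z u + Z L1 [j] * nc_subst B Z u)"
      by (rule ext) (simp add: nc_subst_Cons Z A_def B_def)
    have lin2: "((\<lambda>u. c * P u + d * Q u) \<star> U) v = c * (P \<star> U) v + d * (Q \<star> U) v" for c d P Q U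
      using nc_mult_linear_left [of c P "\<lambda>u. d * Q u + 0 * Q u" U v]
        nc_mult_linear_left [of d Q "\<lambda>u. 0 * Q u" U v] nc_mult_zero_left [of U v] by simp
    have "(\<lambda>u. (S \<star> T) (L0 # u)) = (\<lambda>u. S [] * T (L0 # u) + (A \<star> T) u)"
      and "(\<lambda>u. (S \<star> T) (L1 # u)) = (\<lambda>u. S [] * T (L1 # u) + (B \<star> T) u)"
      by (simp_all add: nc_mult_Cons A_def B_def)
    then show ?case
      unfolding nc_mult_Cons [of "nc_subst S Z"] dS lin2 nc_subst_Cons [OF Z, of "S \<star> T"]
        nc_subst_Cons [OF Z, of T]
      by (simp add: nc_subst_linear Cons.IH nc_subst_Nil) (simp add: algebra_simps)
  qed
qed

lemma nc_subst_one: "nc_subst nc_one Z = nc_one"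
proof
  fix v
  have "nc_subst nc_one Z v = (\<Sum>w | length w \<le> length v. if w = [] then nc_word Z w v else 0)"
    unfolding nc_subst_def by (rule sum.cong) (auto simp: nc_one_def)
  then show "nc_subst nc_one Z v = nc_one v"
    using finite_words [of "length v"] by (simp add: sum.delta)
qed

lemma nc_subst_inv:
  assumes Z: "\<And>i. linear_series (Z i)" and S: "S [] = 1"
  shows "nc_subst (nc_inv S) Z = nc_inv (nc_subst S Z)"
  by (rule nc_inv_unique)
    (simp_all add: nc_subst_Nil S nc_subst_mult [OF Z, symmetric] nc_mult_inv_right nc_subst_one)

lemma nc_subst_tendsto:
  assumes "\<And>w. ((\<lambda>x. S x w) \<longlongrightarrow> S' w) F"
  shows "((\<lambda>x. nc_subst (S x) Z v) \<longlongrightarrow> nc_subst S' Z v) F"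
  unfolding nc_subst_def by (intro tendsto_intros assms)

text \<open>
  The statement is proved for the tails of the exponential series, with coefficients shifted by
  \<open>n\<close>, because removing a letter from a word shifts the factorials.
\<close>

lemma nc_subst_exp:
  assumes Z: "\<And>i. linear_series (Z i)" and R: "linear_series R" and Q: "linear_series Q"
    and eq: "\<And>j. Z L0 [j] * R [L0] + Z L1 [j] * R [L1] = Q [j]"
  shows "nc_subst (nc_exp (nc_scale c R)) Z = nc_exp (nc_scale c Q)"
proof
  fix v
  have lin2: "nc_subst (\<lambda>u. d * P u) Z v = d * nc_subst P Z v" for d P v
    by (simp add: nc_subst_def sum_distrib_left algebra_simps)
  have "nc_subst (\<lambda>u. c ^ (n + length u) / fact (n + length u) * (\<Prod>i\<leftarrow>u. R [i])) Z v
      = c ^ (n + length v) / fact (n + length v) * (\<Prod>i\<leftarrow>v. Q [i])" for n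
  proof (induction v arbitrary: n)
    case Nil
    show ?case by (simp add: nc_subst_Nil)
  next
    case (Cons j v)
    let ?f = "\<lambda>n u. c ^ (n + length u) / fact (n + length u) * (\<Prod>i\<leftarrow>u. R [i])"
    have shift: "(\<lambda>u. ?f n (i # u)) = (\<lambda>u. R [i] * ?f (Suc n) u)" for i
      by (rule ext) simp
    have "nc_subst (?f n) Z (j # v) =
        (Z L0 [j] * R [L0] + Z L1 [j] * R [L1]) * nc_subst (?f (Suc n)) Z v"
      unfolding nc_subst_Cons [OF Z] shift lin2 by (simp add: algebra_simps)
    then show ?case unfolding eq Cons.IH by simp
  qed
  from this [of 0] show "nc_subst (nc_exp (nc_scale c R)) Z v = nc_exp (nc_scale c Q) v"
    by (simp add: nc_exp_linear [OF Q] ext [OF nc_exp_linear [OF R, of c]])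
qed

section \<open>Flat sections\<close>

text \<open>
  Flat sections solve \<open>d\<Psi> = - (dz/z X\<^sub>0 + dz/(1 - z) X\<^sub>1) \<Psi>\<close>. The sign is that of differentiation with
  respect to the initial point: the Chen series of a path in \<open>V\<close> from \<open>x\<close> to \<open>y\<close> turns out to be
  \<open>\<Psi> x \<star> nc_inv (\<Psi> y)\<close>. Normalizing the constant term to 1 makes the values invertible.
\<close>

definition flat_on :: "complex set \<Rightarrow> (complex \<Rightarrow> ncseries) \<Rightarrow> bool" where
  "flat_on V \<Psi> \<longleftrightarrow> (\<forall>z\<in>V. \<Psi> z [] = 1 \<and>
     (\<forall>i w. ((\<lambda>z. \<Psi> z (i # w)) has_field_derivative - form_coeff i z * \<Psi> z w) (at z)))"

lemma flat_on_Nil: "flat_on V \<Psi> \<Longrightarrow> z \<in> V \<Longrightarrow> \<Psi> z [] = 1"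
  by (simp add: flat_on_def)

lemma flat_on_Cons:
  "flat_on V \<Psi> \<Longrightarrow> z \<in> V \<Longrightarrow>
    ((\<lambda>z. \<Psi> z (i # w)) has_field_derivative - form_coeff i z * \<Psi> z w) (at z)"
  by (simp add: flat_on_def)

lemma flat_on_subset: "flat_on V \<Psi> \<Longrightarrow> U \<subseteq> V \<Longrightarrow> flat_on U \<Psi>"
  by (auto simp: flat_on_def)

lemma flat_on_has_derivative:
  assumes "flat_on V \<Psi>" "open V" "z \<in> V"
  shows "((\<lambda>z. \<Psi> z w) has_field_derivative
    (case w of [] \<Rightarrow> 0 | i # v \<Rightarrow> - form_coeff i z * \<Psi> z v)) (at z)"
proof (cases w)
  case Nil
  have "((\<lambda>z. \<Psi> z []) has_field_derivative 0) (at z)"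
    by (rule has_field_derivative_transform_within_open [OF DERIV_const [of 1] assms(2,3)])
      (simp add: flat_on_Nil [OF assms(1)])
  then show ?thesis by (simp add: Nil)
qed (use flat_on_Cons [OF assms(1,3)] in simp)

text \<open>
  The equation is linear and acts from the left, hence is preserved by constant right factors.
\<close>

lemma flat_on_mult_const:
  assumes \<Psi>: "flat_on V \<Psi>" "open V" and C: "C [] = 1"
  shows "flat_on V (\<lambda>z. \<Psi> z \<star> C)"
  unfolding flat_on_def
proof (intro ballI conjI allI)
  fix z i w assume z: "z \<in> V"
  show "(\<Psi> z \<star> C) [] = 1"
    by (simp add: nc_mult_Nil flat_on_Nil [OF \<Psi>(1) z] C)
  define S' where "S' = (\<lambda>u. case u of [] \<Rightarrow> 0 | i # v \<Rightarrow> - form_coeff i z * \<Psi> z v)"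
  have "((\<lambda>z. (\<Psi> z \<star> C) (i # w)) has_field_derivative
      (S' \<star> C) (i # w) + (\<Psi> z \<star> (\<lambda>u. 0)) (i # w)) (at z)"
    by (rule nc_mult_has_derivative)
      (use flat_on_has_derivative [OF \<Psi> z] in \<open>simp_all add: S'_def\<close>)
  moreover have "(\<lambda>u. S' (i # u)) = (\<lambda>u. - form_coeff i z * \<Psi> z u + 0 * nc_one u)"
    by (simp add: S'_def)
  then have "(S' \<star> C) (i # w) = - form_coeff i z * (\<Psi> z \<star> C) w"
    using nc_mult_linear_left [of "- form_coeff i z" "\<Psi> z" "\<lambda>u. 0 * nc_one u" C w]
      nc_mult_zero_left [of C w]
    by (simp add: nc_mult_Cons S'_def)
  moreover have "(\<Psi> z \<star> (\<lambda>u. 0)) (i # w) = 0"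
    by (simp add: nc_mult_def)
  ultimately show "((\<lambda>z. (\<Psi> z \<star> C) (i # w)) has_field_derivative
      - form_coeff i z * (\<Psi> z \<star> C) w) (at z)"
    by simp
qed

text \<open>
  The equation is triangular: the derivative of a coefficient involves shorter words only. So the
  coefficients of two solutions agree by induction on the word.
\<close>

lemma flat_on_unique:
  assumes V: "connected V" "open V"
    and \<Psi>: "flat_on V \<Psi>" "flat_on V \<Psi>'" and z: "z \<in> V" "\<Psi> z = \<Psi>' z"
  shows "x \<in> V \<Longrightarrow> \<Psi> x = \<Psi>' x"
proof -
  have "\<forall>x\<in>V. \<Psi> x w = \<Psi>' x w" for w
  proof (induction w)
    case Nil
    show ?case using \<Psi> by (simp add: flat_on_Nil)
  next
    case (Cons i w)
    have "((\<lambda>x. \<Psi> x (i # w) - \<Psi>' x (i # w)) has_field_derivative 0) (at x)" if "x \<in> V" for x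
      using DERIV_diff [OF flat_on_Cons [OF \<Psi>(1) that, of i w] flat_on_Cons [OF \<Psi>(2) that, of i w]]
        Cons that by simp
    then have D: "\<forall>x\<in>V - {}. ((\<lambda>x. \<Psi> x (i # w) - \<Psi>' x (i # w)) has_field_derivative 0) (at x)"
      by simp
    then have "continuous_on V (\<lambda>x. \<Psi> x (i # w) - \<Psi>' x (i # w))"
      by (intro continuous_at_imp_continuous_on ballI DERIV_isCont) auto
    from DERIV_zero_connected_constant_on [OF V finite.emptyI this D]
    obtain c where "\<And>x. x \<in> V \<Longrightarrow> \<Psi> x (i # w) - \<Psi>' x (i # w) = c"
      by (auto simp: constant_on_def)
    note c = this
    show ?case
    proof
      fix x assume "x \<in> V"
      then show "\<Psi> x (i # w) = \<Psi>' x (i # w)"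
        using c [of x] c [OF z(1)] z(2) by simp
    qed
  qed
  then show "x \<in> V \<Longrightarrow> \<Psi> x = \<Psi>' x" by auto
qed

lemma flat_on_eq_mult_const:
  assumes V: "connected V" "open V"
    and \<Psi>: "flat_on V \<Psi>" "flat_on V \<Psi>'"
  obtains C where "C [] = 1" "\<And>x. x \<in> V \<Longrightarrow> \<Psi> x = \<Psi>' x \<star> C"
proof (cases "V = {}")
  case True
  show ?thesis by (rule that [of nc_one]) (simp_all add: True nc_one_def)
next
  case False
  then obtain z where z: "z \<in> V" by auto
  define C where "C = nc_inv (\<Psi>' z) \<star> \<Psi> z"
  have C: "C [] = 1"
    by (simp add: C_def nc_mult_Nil flat_on_Nil [OF \<Psi>(1) z])
  have "\<Psi>' z \<star> C = \<Psi> z"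
    unfolding C_def nc_mult_assoc [symmetric]
    by (simp add: nc_mult_inv_right [of "\<Psi>' z", OF flat_on_Nil [OF \<Psi>(2) z]])
  then show ?thesis
    using flat_on_unique [OF V \<Psi>(1) flat_on_mult_const [where C = C, OF \<Psi>(2) V(2) C] z]
      that [of C, OF C] by simp
qed

text \<open>
  Up to sign the iterated integrals from \<open>z\<^sub>0\<close>, as iterated primitives. On a starlike domain each of them is
  holomorphic, so that the choice is possible.
\<close>

primrec flat_coeff :: "complex set \<Rightarrow> complex \<Rightarrow> letter list \<Rightarrow> complex \<Rightarrow> complex" where
  "flat_coeff V z\<^sub>0 [] = (\<lambda>z. 1)"
| "flat_coeff V z\<^sub>0 (i # w) = (SOME g. g z\<^sub>0 = 0 \<and>
     (\<forall>z\<in>V. (g has_field_derivative - form_coeff i z * flat_coeff V z\<^sub>0 w z) (at z)))"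

lemma form_coeff_holomorphic: "V \<subseteq> Ycurve \<Longrightarrow> form_coeff i holomorphic_on V"
proof (cases i)
  case L0
  assume "V \<subseteq> Ycurve"
  then have "(\<lambda>z. 1 / z) holomorphic_on V"
    by (intro holomorphic_intros) (auto simp: Ycurve_def)
  then show ?thesis by (simp add: L0 cong: holomorphic_cong)
next
  case L1
  assume "V \<subseteq> Ycurve"
  then have "(\<lambda>z. 1 / (1 - z)) holomorphic_on V"
    by (intro holomorphic_intros) (auto simp: Ycurve_def)
  then show ?thesis by (simp add: L1 cong: holomorphic_cong)
qed

lemma flat_on_exists:
  assumes V: "starlike V" "open V" "V \<subseteq> Ycurve"
  shows "\<exists>\<Psi>. flat_on V \<Psi> \<and> \<Psi> z\<^sub>0 = nc_one"
proof -
  have step: "flat_coeff V z\<^sub>0 (i # w) z\<^sub>0 = 0 \<and> (\<forall>z\<in>V. (flat_coeff V z\<^sub>0 (i # w) has_field_derivative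
      - form_coeff i z * flat_coeff V z\<^sub>0 w z) (at z))"
    if hol: "flat_coeff V z\<^sub>0 w holomorphic_on V" for i w
  proof -
    let ?f = "\<lambda>z. - form_coeff i z * flat_coeff V z\<^sub>0 w z"
    have f: "?f holomorphic_on V"
      by (intro holomorphic_intros form_coeff_holomorphic V hol)
    then obtain g where g: "\<forall>z\<in>V. (g has_field_derivative ?f z) (at z)"
      using holomorphic_starlike_primitive [OF holomorphic_on_imp_continuous_on [OF f] V(1,2), of "{}"]
        holomorphic_on_imp_differentiable_at [OF f V(2)] by auto
    then have "\<forall>z\<in>V. ((\<lambda>z. g z - g z\<^sub>0) has_field_derivative ?f z) (at z)"
      by (auto intro!: derivative_eq_intros)
    then have "\<exists>g. g z\<^sub>0 = 0 \<and> (\<forall>z\<in>V. (g has_field_derivative ?f z) (at z))"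
      by (intro exI [of _ "\<lambda>z. g z - g z\<^sub>0"]) simp
    from someI_ex [OF this] show ?thesis by simp
  qed
  have hol: "flat_coeff V z\<^sub>0 w holomorphic_on V" for w
  proof (induction w)
    case (Cons i w)
    then show ?case
      using step [OF Cons] holomorphic_onI field_differentiable_def has_field_derivative_at_within
      by (metis (no_types, lifting))
  qed simp
  show ?thesis
  proof (intro exI conjI)
    show "flat_on V (\<lambda>z w. flat_coeff V z\<^sub>0 w z)"
      using step [OF hol] by (simp add: flat_on_def del: flat_coeff.simps(2))
    show "(\<lambda>w. flat_coeff V z\<^sub>0 w z\<^sub>0) = nc_one"
    proof
      fix w show "flat_coeff V z\<^sub>0 w z\<^sub>0 = nc_one w"
        using step [OF hol] by (cases w) (simp_all add: nc_one_def del: flat_coeff.simps(2))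
    qed
  qed
qed

section \<open>Flat sections near a tangential base point\<close>

text \<open>
  In a coordinate \<open>c\<close> at a cusp the flatness equation has the form
  \<open>\<Psi>' = - (R / c + q T) \<Psi>\<close> with constant linear series \<open>R\<close>, \<open>T\<close> and holomorphic \<open>q\<close>. A gauge
  transformation \<open>H\<close>, holomorphic on the unit disc with \<open>H = 1\<close> at the cusp, removes the regular
  part: \<open>H exp (- R log c)\<close> is flat if \<open>H' = [H, R] / c - q T H\<close>. The coefficients of \<open>H\<close> are found
  by integration, one word after the other.
\<close>

definition gauge_primitive :: "(complex \<Rightarrow> complex) \<Rightarrow> complex \<Rightarrow> complex" where
  "gauge_primitive F = (SOME G. G holomorphic_on ball 0 1 \<and> G 0 = 0 \<and>
     (\<forall>c\<in>ball 0 1 - {0}. (G has_field_derivative F c) (at c)))"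

text \<open>
  A simple pole is removable if its numerator vanishes, and a holomorphic function on the disc has
  a primitive vanishing at the centre.
\<close>

lemma gauge_primitive:
  assumes N: "N holomorphic_on ball 0 1" "N 0 = 0" and M: "M holomorphic_on ball 0 1"
    and F: "F = (\<lambda>c. N c / c - M c)"
  shows "gauge_primitive F holomorphic_on ball 0 1" "gauge_primitive F 0 = 0"
    "c \<in> ball 0 1 - {0} \<Longrightarrow> (gauge_primitive F has_field_derivative F c) (at c)"
proof -
  let ?f = "\<lambda>c. (if c = 0 then deriv N 0 else (N c - N 0) / (c - 0)) - M c"
  have "?f holomorphic_on ball 0 1"
    by (intro holomorphic_intros M pole_lemma_open N) auto
  then obtain g where g: "\<And>c. c \<in> ball 0 1 \<Longrightarrow> (g has_field_derivative ?f c) (at c within ball 0 1)"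
    using holomorphic_convex_primitive' [of "ball 0 1" ?f] by auto
  define G where "G = (\<lambda>c. g c - g 0)"
  have G: "(G has_field_derivative ?f c) (at c)" if "c \<in> ball 0 1" for c
  proof -
    have "(g has_field_derivative ?f c) (at c)"
      using g [OF that] at_within_open [OF that open_ball] by simp
    then show ?thesis
      unfolding G_def by (auto intro!: derivative_eq_intros)
  qed
  have "G holomorphic_on ball 0 1"
    using G holomorphic_onI field_differentiable_def has_field_derivative_at_within by metis
  moreover have "\<forall>c\<in>ball 0 1 - {0}. (G has_field_derivative F c) (at c)"
  proof
    fix c assume "c \<in> ball (0 :: complex) 1 - {0}"
    then show "(G has_field_derivative F c) (at c)"
      using G [of c] N(2) by (simp add: F)
  qed
  ultimately have "G holomorphic_on ball 0 1 \<and> G 0 = 0 \<and>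
     (\<forall>c\<in>ball 0 1 - {0}. (G has_field_derivative F c) (at c))"
    by (simp add: G_def)
  from someI [of "\<lambda>G. G holomorphic_on ball 0 1 \<and> G 0 = 0 \<and>
     (\<forall>c\<in>ball 0 1 - {0}. (G has_field_derivative F c) (at c))", OF this]
  show "gauge_primitive F holomorphic_on ball 0 1" "gauge_primitive F 0 = 0"
    "c \<in> ball 0 1 - {0} \<Longrightarrow> (gauge_primitive F has_field_derivative F c) (at c)"
    by (simp_all add: gauge_primitive_def)
qed

function gauge_coeff ::
    "ncseries \<Rightarrow> ncseries \<Rightarrow> (complex \<Rightarrow> complex) \<Rightarrow> letter list \<Rightarrow> complex \<Rightarrow> complex" where
  "gauge_coeff R T q w = (if w = [] then (\<lambda>c. 1) else gauge_primitive
     (\<lambda>c. (gauge_coeff R T q (butlast w) c * R [last w] - R [hd w] * gauge_coeff R T q (tl w) c) / c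
        - q c * (T [hd w] * gauge_coeff R T q (tl w) c)))"
  by pat_completeness auto
termination by (relation "Wellfounded.measure (\<lambda>(R, T, q, w). length w)") auto

declare gauge_coeff.simps [simp del]

text \<open>
  The commutator \<open>[H, R]\<close> involves shorter words only, and its coefficients vanish at the cusp: on
  words of length at least two because the nonconstant coefficients of \<open>H\<close> vanish there, and on
  letters because the two terms cancel. So the equation can be integrated word by word.
\<close>

lemma gauge_exists:
  assumes R: "linear_series R" and T: "linear_series T" and q: "q holomorphic_on ball 0 1"
  shows "\<exists>H. (\<forall>c. H c [] = 1) \<and> H 0 = nc_one \<and> (\<forall>w. (\<lambda>c. H c w) holomorphic_on ball 0 1) \<and>
    (\<forall>w. \<forall>c\<in>ball 0 1 - {0}. ((\<lambda>c. H c w) has_field_derivative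
       ((H c \<star> R) w - (R \<star> H c) w) / c - q c * (T \<star> H c) w) (at c))"
proof -
  let ?G = "gauge_coeff R T q"
  define H where "H = (\<lambda>c w. ?G w c)"
  have Nil: "?G [] = (\<lambda>c. 1)" by (simp add: gauge_coeff.simps)
  have Cons: "?G w holomorphic_on ball 0 1 \<and> ?G w 0 = nc_one w \<and>
      (\<forall>c\<in>ball 0 1 - {0}. (?G w has_field_derivative
       ((H c \<star> R) w - (R \<star> H c) w) / c - q c * (T \<star> H c) w) (at c))" for w
  proof (induction w rule: length_induct)
    case (1 w)
    show ?case
    proof (cases "w = []")
      case True
      then show ?thesis by (simp add: Nil nc_one_def linear_series_mult_Nil R T)
    next
      case False
      let ?N = "\<lambda>c. ?G (butlast w) c * R [last w] - R [hd w] * ?G (tl w) c"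
      let ?M = "\<lambda>c. q c * (T [hd w] * ?G (tl w) c)"
      have IH: "?G (butlast w) holomorphic_on ball 0 1" "?G (tl w) holomorphic_on ball 0 1"
        "?G (butlast w) 0 = nc_one (butlast w)" "?G (tl w) 0 = nc_one (tl w)"
        using 1 False by auto
      have N: "?N holomorphic_on ball 0 1" and M: "?M holomorphic_on ball 0 1"
        by (intro holomorphic_intros IH q)+
      have N0: "?N 0 = 0"
      proof (cases "tl w")
        case Nil
        then have "w = [hd w]" using False by (cases w) auto
        then have "butlast w = []" "last w = hd w" by (metis butlast.simps(2), metis last.simps)
        then show ?thesis by (simp add: IH Nil)
      next
        case (Cons a list)
        then have "butlast w \<noteq> []" "tl w \<noteq> []" by (cases w; simp)+
        then show ?thesis by (simp add: IH nc_one_def)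
      qed
      have G: "?G w = gauge_primitive (\<lambda>c. ?N c / c - ?M c)"
        using False by (subst gauge_coeff.simps) simp
      have w1: "w = butlast w @ [last w]" and w2: "w = hd w # tl w" using False by simp_all
      have "(H c \<star> R) w = ?G (butlast w) c * R [last w]" for c
        by (subst w1, subst linear_series_mult_snoc [OF R]) (simp add: H_def)
      moreover have "(R \<star> H c) w = R [hd w] * ?G (tl w) c" for c
        by (subst w2, subst linear_series_mult_Cons [OF R]) (simp add: H_def)
      moreover have "(T \<star> H c) w = T [hd w] * ?G (tl w) c" for c
        by (subst w2, subst linear_series_mult_Cons [OF T]) (simp add: H_def)
      ultimately show ?thesis
        using gauge_primitive [OF N N0 M refl] False by (simp add: G nc_one_def)
    qed
  qed
  show ?thesis
    by (rule exI [of _ H]) (use Cons in \<open>simp add: H_def Nil fun_eq_iff\<close>)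
qed

text \<open>
  Every nonconstant coefficient of \<open>H\<close> is \<open>O(t)\<close>, and conjugation with \<open>exp (R log t)\<close> multiplies
  it by powers of \<open>log t\<close> only, so it still tends to zero.
\<close>

lemma gauge_conjugation_tendsto:
  assumes R: "linear_series R"
    and H: "\<And>c. H c [] = 1" "H 0 = nc_one" "\<And>w. (\<lambda>c. H c w) holomorphic_on ball 0 1"
    and c: "((\<lambda>t. c t / of_real t) \<longlongrightarrow> 1) (at_right 0)"
  shows "((\<lambda>t. (nc_exp (nc_scale (of_real (ln t)) R) \<star> H (c t) \<star> nc_exp (nc_scale (- of_real (ln t)) R)) w)
    \<longlongrightarrow> nc_one w) (at_right (0 :: real))"
proof -
  define E where "E = (\<lambda>x. nc_exp (nc_scale x R))"
  define K where "K = (\<lambda>c u. H c u - nc_one u)"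
  have ev_pos: "\<forall>\<^sub>F t in at_right 0. (t :: real) > 0"
    by (simp add: eventually_at_right_less)
  have c0: "(c \<longlongrightarrow> 0) (at_right 0)"
  proof -
    have "((\<lambda>t. c t / of_real t * of_real t) \<longlongrightarrow> 1 * of_real 0) (at_right 0)"
      by (intro tendsto_intros c)
    moreover have "\<forall>\<^sub>F t in at_right 0. c t / of_real t * of_real t = c t"
      using ev_pos by eventually_elim simp
    ultimately have "(c \<longlongrightarrow> 1 * of_real 0) (at_right 0)"
      by (rule Lim_transform_eventually)
    then show ?thesis by simp
  qed
  have ev_ne: "\<forall>\<^sub>F t in at_right 0. c t \<noteq> 0"
    using tendsto_imp_eventually_ne [OF c, of 0] by (auto elim: eventually_mono)
  have Kt: "\<exists>D. ((\<lambda>t. K (c t) u / of_real t) \<longlongrightarrow> D) (at_right 0)" for u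
  proof -
    have "(\<lambda>c. K c u) holomorphic_on ball 0 1"
      unfolding K_def by (intro holomorphic_intros H)
    then obtain D where "((\<lambda>c. K c u) has_field_derivative D) (at 0)"
      by (metis centre_in_ball field_differentiable_def holomorphic_on_imp_differentiable_at
          open_ball zero_less_one)
    then have "((\<lambda>c. K c u / c) \<longlongrightarrow> D) (at 0)"
      by (simp add: DERIV_def K_def H(2))
    moreover have "filterlim c (at 0) (at_right 0)"
      using c0 ev_ne by (simp add: filterlim_at)
    ultimately have "((\<lambda>t. K (c t) u / c t) \<longlongrightarrow> D) (at_right 0)"
      by (rule filterlim_compose)
    then have "((\<lambda>t. K (c t) u / c t * (c t / of_real t)) \<longlongrightarrow> D * 1) (at_right 0)"
      by (intro tendsto_mult c)
    then have "((\<lambda>t. K (c t) u / of_real t) \<longlongrightarrow> D * 1) (at_right 0)"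
      by (rule Lim_transform_eventually) (use ev_ne in eventually_elim, simp)
    then show ?thesis by blast
  qed
  have term0: "((\<lambda>t. E (of_real (ln t)) u * K (c t) v * E (- of_real (ln t)) v') \<longlongrightarrow> 0) (at_right 0)"
    for u v v'
  proof -
    obtain D where D: "((\<lambda>t. K (c t) v / of_real t) \<longlongrightarrow> D) (at_right 0)" using Kt by blast
    let ?m = "length u" and ?n = "length v'"
    have "((\<lambda>t :: real. t * ln t ^ (?m + ?n)) \<longlongrightarrow> 0) (at_right 0)"
      by real_asymp
    then have lim: "((\<lambda>t. complex_of_real (t * ln t ^ (?m + ?n))) \<longlongrightarrow> of_real 0) (at_right 0)"
      by (rule tendsto_of_real)
    have "((\<lambda>t. K (c t) v / of_real t * (of_real (t * ln t ^ (?m + ?n)) *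
        ((\<Prod>i\<leftarrow>u. R [i]) / fact ?m * ((-1) ^ ?n * (\<Prod>i\<leftarrow>v'. R [i]) / fact ?n))))
        \<longlongrightarrow> D * (of_real 0 * ((\<Prod>i\<leftarrow>u. R [i]) / fact ?m * ((-1) ^ ?n * (\<Prod>i\<leftarrow>v'. R [i]) / fact ?n))))
        (at_right 0)"
      by (rule tendsto_mult [OF D tendsto_mult [OF lim tendsto_const]])
    moreover have "k / s * (s * L ^ (m + n) * (P / M * ((-1) ^ n * P' / N)))
        = L ^ m / M * P * k * ((- L) ^ n / N * P')" if "s \<noteq> 0" for k s L P P' M N :: complex and m n
      using that by (simp add: power_minus [of L n] power_add)
    then have "\<forall>\<^sub>F t in at_right 0. K (c t) v / of_real t * (of_real (t * ln t ^ (?m + ?n)) *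
        ((\<Prod>i\<leftarrow>u. R [i]) / fact ?m * ((-1) ^ ?n * (\<Prod>i\<leftarrow>v'. R [i]) / fact ?n)))
        = E (of_real (ln t)) u * K (c t) v * E (- of_real (ln t)) v'"
      unfolding E_def nc_exp_linear [OF R]
      by (intro eventually_mono [OF ev_pos]) (simp only: of_real_mult of_real_power of_real_eq_0_iff less_irrefl)
    ultimately have "((\<lambda>t. E (of_real (ln t)) u * K (c t) v * E (- of_real (ln t)) v') \<longlongrightarrow>
        D * (of_real 0 * ((\<Prod>i\<leftarrow>u. R [i]) / fact ?m * ((-1) ^ ?n * (\<Prod>i\<leftarrow>v'. R [i]) / fact ?n))))
        (at_right 0)"
      by (rule Lim_transform_eventually)
    then show ?thesis by simp
  qed
  have "((\<lambda>t. (E (of_real (ln t)) \<star> K (c t) \<star> E (- of_real (ln t))) w) \<longlongrightarrow> 0) (at_right 0)"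
    unfolding nc_mult_def sum_distrib_right by (intro tendsto_null_sum term0)
  then have "((\<lambda>t. (E (of_real (ln t)) \<star> K (c t) \<star> E (- of_real (ln t))) w + nc_one w)
      \<longlongrightarrow> 0 + nc_one w) (at_right 0)"
    by (intro tendsto_intros)
  moreover have "(E x \<star> H d \<star> E (- x)) w = (E x \<star> K d \<star> E (- x)) w + nc_one w" for x d
  proof -
    have "H d = (\<lambda>u. 1 * K d u + nc_one u)" by (simp add: K_def)
    then have "E x \<star> H d = (\<lambda>u. 1 * (E x \<star> K d) u + E x u)"
      using nc_mult_linear_right [of "E x" 1 "K d" nc_one] by (metis ext nc_mult_one_right)
    then have "(E x \<star> H d \<star> E (- x)) w = (E x \<star> K d \<star> E (- x)) w + (E x \<star> E (- x)) w"
      using nc_mult_linear_left [of 1 "E x \<star> K d" "E x" "E (- x)" w] by simp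
    then show ?thesis by (simp add: E_def nc_exp_minus [OF R])
  qed
  ultimately show ?thesis by (simp add: E_def)
qed

text \<open>
  This disc is used as a neighbourhood of the tangent vector because it is also the set of \<open>c\<close>
  with \<open>Re (1/c) > 1\<close>: it is convex both in \<open>c\<close> and in \<open>1/c\<close>.
\<close>

lemma half_disc:
  fixes c :: complex
  assumes "c \<in> ball (1/2) (1/2)"
  shows "c \<in> ball 0 1 - {0}" "c \<notin> \<real>\<^sub>\<le>\<^sub>0"
proof -
  have *: "norm (c - 1/2) < 1/2" using assms by (simp add: dist_norm norm_minus_commute)
  have "norm c \<le> norm (c - 1/2) + norm (1/2 :: complex)"
    by (metis diff_add_cancel norm_triangle_ineq)
  then have "norm c < 1" using * by simp
  moreover have "\<bar>Re (c - 1/2)\<bar> < 1/2" using abs_Re_le_cmod [of "c - 1/2"] * by linarith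
  then have "Re c > 0" by (simp add: abs_if split: if_splits)
  ultimately show "c \<in> ball 0 1 - {0}" "c \<notin> \<real>\<^sub>\<le>\<^sub>0"
    by (auto simp: complex_nonpos_Reals_iff)
qed

text \<open>
  The section is \<open>H(\<kappa>) exp (- R log \<kappa>)\<close> with the gauge transformation \<open>H\<close>. It is the one singled
  out by the regularization at the cusp: after multiplication by \<open>exp (R log t)\<close> it tends to 1
  along every path whose coordinate is asymptotic to \<open>t\<close>.
\<close>

lemma tangential_section_exists:
  assumes R: "linear_series R" and T: "linear_series T" and q: "q holomorphic_on ball 0 1"
    and \<kappa>: "\<And>z. z \<in> U \<Longrightarrow> (\<kappa> has_field_derivative \<kappa>' z) (at z)"
      "\<And>z. z \<in> U \<Longrightarrow> \<kappa> z \<in> ball (1/2) (1/2)"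
    and form: "\<And>z i. z \<in> U \<Longrightarrow> R [i] * \<kappa>' z / \<kappa> z + q (\<kappa> z) * T [i] * \<kappa>' z = form_coeff i z"
  shows "\<exists>\<Psi>. flat_on U \<Psi> \<and> (\<forall>x w. ((\<lambda>t. \<kappa> (x t) / of_real t) \<longlongrightarrow> 1) (at_right 0) \<longrightarrow>
    ((\<lambda>t. (nc_exp (nc_scale (of_real (ln t)) R) \<star> \<Psi> (x t)) w) \<longlongrightarrow> nc_one w) (at_right (0 :: real)))"
proof -
  define E where "E = (\<lambda>x. nc_exp (nc_scale x R))"
  obtain H where H: "\<And>c. H c [] = 1" "H 0 = nc_one" "\<And>w. (\<lambda>c. H c w) holomorphic_on ball 0 1"
    "\<And>w c. c \<in> ball 0 1 - {0} \<Longrightarrow> ((\<lambda>c. H c w) has_field_derivative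
       ((H c \<star> R) w - (R \<star> H c) w) / c - q c * (T \<star> H c) w) (at c)"
    using gauge_exists [OF R T q] by blast
  define \<Theta> where "\<Theta> = (\<lambda>c. H c \<star> E (- Ln c))"
  have \<Theta>': "((\<lambda>c. \<Theta> c (i # w)) has_field_derivative - (R [i] / c + q c * T [i]) * \<Theta> c w) (at c)"
    if c: "c \<in> ball (1/2) (1/2)" for c i w
  proof -
    note c' = half_disc [OF c]
    let ?H' = "\<lambda>w. ((H c \<star> R) w - (R \<star> H c) w) / c - q c * (T \<star> H c) w"
    let ?E' = "\<lambda>w. - (1 / c) * (R \<star> E (- Ln c)) w + 0 * nc_one w"
    have "((\<lambda>c. E (- Ln c) w) has_field_derivative ?E' w) (at c)" for w
      using DERIV_chain2 [OF nc_exp_has_derivative [OF R, of w "- Ln c"]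
          DERIV_minus [OF has_field_derivative_Ln [OF c'(2)]]]
      by (simp add: E_def divide_inverse mult.commute)
    then have "((\<lambda>c. \<Theta> c (i # w)) has_field_derivative
        (?H' \<star> E (- Ln c)) (i # w) + (H c \<star> ?E') (i # w)) (at c)"
      unfolding \<Theta>_def by (rule nc_mult_has_derivative [OF H(4) [OF c'(1)]])
    moreover have "(H c \<star> ?E') (i # w) = - (1 / c) * (H c \<star> R \<star> E (- Ln c)) (i # w)"
      unfolding nc_mult_linear_right nc_mult_assoc by (simp add: nc_mult_def)
    moreover have "?H' = (\<lambda>w. 1 / c * (H c \<star> R) w + ((- 1 / c) * (R \<star> H c) w + (- q c * (T \<star> H c) w + 0 * nc_one w)))"
      by (simp add: fun_eq_iff diff_divide_distrib)
    then have "(?H' \<star> E (- Ln c)) (i # w) = 1 / c * (H c \<star> R \<star> E (- Ln c)) (i # w)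
        + ((- 1 / c) * (R \<star> \<Theta> c) (i # w) + (- q c * (T \<star> \<Theta> c) (i # w) + 0))"
      unfolding \<Theta>_def by (simp only: nc_mult_linear_left nc_mult_assoc) (simp add: nc_mult_def)
    ultimately show ?thesis
      by (simp add: linear_series_mult_Cons R T algebra_simps)
  qed
  have "flat_on U (\<lambda>z. \<Theta> (\<kappa> z))"
    unfolding flat_on_def
  proof (intro ballI conjI allI)
    fix z i w assume z: "z \<in> U"
    show "\<Theta> (\<kappa> z) [] = 1" by (simp add: \<Theta>_def nc_mult_Nil H(1) E_def nc_exp_linear_Nil R)
    have "((\<lambda>z. \<Theta> (\<kappa> z) (i # w)) has_field_derivative
        - (R [i] / \<kappa> z + q (\<kappa> z) * T [i]) * \<Theta> (\<kappa> z) w * \<kappa>' z) (at z)"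
      by (rule DERIV_chain2 [OF \<Theta>' [OF \<kappa>(2) [OF z]] \<kappa>(1) [OF z]])
    moreover have "- (R [i] / \<kappa> z + q (\<kappa> z) * T [i]) * \<Theta> (\<kappa> z) w * \<kappa>' z =
        - form_coeff i z * \<Theta> (\<kappa> z) w"
      unfolding form [OF z, symmetric] by (simp add: algebra_simps)
    ultimately show "((\<lambda>z. \<Theta> (\<kappa> z) (i # w)) has_field_derivative - form_coeff i z * \<Theta> (\<kappa> z) w) (at z)"
      by simp
  qed
  moreover have "((\<lambda>t. (nc_exp (nc_scale (of_real (ln t)) R) \<star> \<Theta> (\<kappa> (x t))) w) \<longlongrightarrow> nc_one w)
      (at_right (0 :: real))"
    if x: "((\<lambda>t. \<kappa> (x t) / of_real t) \<longlongrightarrow> 1) (at_right 0)" for x w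
  proof -
    let ?c = "\<lambda>t. \<kappa> (x t)"
    have "((\<lambda>t. Ln (?c t / of_real t)) \<longlongrightarrow> Ln 1) (at_right 0)"
      by (rule tendsto_Ln [OF x]) auto
    then have L: "((\<lambda>t. - Ln (?c t / of_real t)) \<longlongrightarrow> 0) (at_right 0)"
      using tendsto_minus by fastforce
    have "((\<lambda>t. (E (of_real (ln t)) \<star> H (?c t) \<star> E (- of_real (ln t)) \<star> E (- Ln (?c t / of_real t))) w)
        \<longlongrightarrow> (nc_one \<star> E 0) w) (at_right 0)"
      unfolding E_def
      by (intro nc_mult_tendsto gauge_conjugation_tendsto R H(1-3) x nc_exp_tendsto L)
    moreover have "\<forall>\<^sub>F t in at_right 0. E (of_real (ln t)) \<star> H (?c t) \<star> E (- of_real (ln t)) \<star>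
        E (- Ln (?c t / of_real t)) = E (of_real (ln t)) \<star> \<Theta> (?c t)"
      using eventually_at_right_less [of "0 :: real"] tendsto_imp_eventually_ne [OF x one_neq_zero]
    proof eventually_elim
      case (elim t)
      have "Ln (?c t) = Ln (of_real t * (?c t / of_real t))" using elim by simp
      also have "\<dots> = of_real (ln t) + Ln (?c t / of_real t)"
        using Ln_times_of_real [of t "\<kappa> (x t) / of_real t"] elim by (simp only: Ln_of_real not_False_eq_True)
      finally have "- Ln (?c t) = - of_real (ln t) + - Ln (?c t / of_real t)" by simp
      then have "E (- Ln (?c t)) = E (- of_real (ln t)) \<star> E (- Ln (?c t / of_real t))"
        using nc_exp_add [OF R, of "- of_real (ln t)" "- Ln (?c t / of_real t)"] by (simp add: E_def)
      then show ?case by (simp add: \<Theta>_def nc_mult_assoc)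
    qed
    ultimately have "((\<lambda>t. (E (of_real (ln t)) \<star> \<Theta> (?c t)) w) \<longlongrightarrow> (nc_one \<star> E 0) w) (at_right 0)"
      by (elim Lim_transform_eventually) (auto elim: eventually_mono)
    then show ?thesis by (simp add: E_def nc_exp_zero R)
  qed
  ultimately show ?thesis by blast
qed

subsection \<open>The flat section attached to an end of a path\<close>

text \<open>
  For a tangent vector this is the set where the inverse of the local coordinate has real part
  above 1, a region pointing in its direction that contains the beginning of every path issuing
  from it. In the coordinate \<open>z\<close> it is a disc or a half-plane, hence convex.
\<close>

fun end_nbhd :: "endpt \<Rightarrow> complex set" where
  "end_nbhd (Tang C0 C1) = ball (1/2) (1/2)"
| "end_nbhd (Tang C0 Cinf) = ball (-1/2) (1/2)"
| "end_nbhd (Tang C1 C0) = ball (1/2) (1/2)"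
| "end_nbhd (Tang C1 Cinf) = ball (3/2) (1/2)"
| "end_nbhd (Tang Cinf C0) = {z. Re z < -1}"
| "end_nbhd (Tang Cinf C1) = {z. Re z > 1}"
| "end_nbhd (Tang _ _) = {}"
| "end_nbhd (Pt p) = ball p (min (dist p 0) (dist p 1))"

lemma half_disc_iff: "c \<in> ball (1/2) (1/2) \<longleftrightarrow> (norm c)\<^sup>2 < Re c"
proof -
  have "c \<in> ball (1/2) (1/2) \<longleftrightarrow> norm (c - 1/2) < 1/2"
    by (simp add: dist_norm norm_minus_commute)
  also have "\<dots> \<longleftrightarrow> (norm (c - 1/2))\<^sup>2 < (1/2)\<^sup>2"
    using power_strict_mono [of "norm (c - 1/2)" "1/2" 2] power_less_imp_less_base [of "norm (c - 1/2)" 2 "1/2"]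
    by auto
  also have "\<dots> \<longleftrightarrow> (norm c)\<^sup>2 < Re c"
  proof -
    have "(norm (c - 1/2))\<^sup>2 = (norm c)\<^sup>2 - Re c + 1/4"
      unfolding cmod_power2 by (simp add: power2_eq_square algebra_simps)
    then show ?thesis by (simp add: power2_eq_square)
  qed
  finally show ?thesis .
qed

lemma half_disc_inverse:
  assumes "z \<noteq> 0"
  shows "1 / z \<in> ball (1/2) (1/2) \<longleftrightarrow> Re z > 1"
proof -
  have p: "(norm z)\<^sup>2 > 0" using assms by simp
  have "Re (1 / z) = Re z / (norm z)\<^sup>2"
    by (simp add: Re_divide cmod_power2)
  then show ?thesis
    using divide_less_cancel [of 1 "(norm z)\<^sup>2" "Re z"] p
    unfolding half_disc_iff by (simp add: norm_divide power_divide)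
qed

lemma end_nbhd_tang_iff:
  assumes "a \<noteq> b"
  shows "z \<in> end_nbhd (Tang a b) \<longleftrightarrow> coord a b z \<in> ball (1/2) (1/2)"
proof -
  have 1: "dist (1/2) (1 - z) = dist (1/2) z" and 2: "dist (1/2) (- z) = dist (-1/2) z"
    and 3: "dist (1/2) (z - 1) = dist (3/2) z"
  proof -
    have "1/2 - (1 - z) = - (1/2 - z)" "1/2 - (- z) = - (-1/2 - z)" "1/2 - (z - 1) = 3/2 - z"
      by (simp_all add: complex_eq_iff)
    then show "dist (1/2) (1 - z) = dist (1/2) z" "dist (1/2) (- z) = dist (-1/2) z"
      "dist (1/2) (z - 1) = dist (3/2) z"
      unfolding dist_norm by (metis norm_minus_cancel)+
  qed
  show ?thesis
  proof (cases a; cases b)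
    assume ab: "a = Cinf" "b = C0"
    show ?thesis
      using half_disc_inverse [of "- z"] ab by (cases "z = 0") auto
  next
    assume ab: "a = Cinf" "b = C1"
    show ?thesis
      using half_disc_inverse [of z] ab by (cases "z = 0") auto
  qed (use assms 1 2 3 in auto)
qed

lemma open_end_nbhd: "open (end_nbhd e)"
  by (cases e rule: end_nbhd.cases) (auto simp: open_halfspace_Re_lt open_halfspace_Re_gt)

lemma convex_end_nbhd: "convex (end_nbhd e)"
  by (cases e rule: end_nbhd.cases) (auto simp: convex_halfspace_Re_lt convex_halfspace_Re_gt)

lemma end_nbhd_subset: "end_nbhd e \<subseteq> Ycurve"
proof (cases e)
  case (Tang a b)
  show ?thesis
  proof (cases "a = b")
    case True
    then show ?thesis by (cases a) (simp_all add: Tang)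
  next
    case False
    have "coord a b 0 \<notin> ball (1/2) (1/2)"
      unfolding half_disc_iff using False by (cases a; cases b) simp_all
    moreover have "coord a b 1 \<notin> ball (1/2) (1/2)"
      unfolding half_disc_iff using False by (cases a; cases b) simp_all
    ultimately have "0 \<notin> end_nbhd (Tang a b)" "1 \<notin> end_nbhd (Tang a b)"
      unfolding end_nbhd_tang_iff [OF False] .
    then show ?thesis
      unfolding Tang Ycurve_def by blast
  qed
next
  case (Pt p)
  then show ?thesis by (auto simp: Ycurve_def)
qed

text \<open>
  If \<open>c = t u\<close> with \<open>u\<close> close to 1, then \<open>\<bar>c\<bar>\<^sup>2\<close> is of order \<open>t\<^sup>2\<close> whereas \<open>Re c\<close> is of order \<open>t\<close>. The
  bound is uniform in the point, as homotopies require.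
\<close>

lemma eventually_end_nbhd:
  assumes "proper_end e"
  shows "\<exists>\<eta>>0. \<forall>t z. 0 < t \<longrightarrow> t < \<eta> \<longrightarrow> dist (rescaled e t z) (rescaled_lim e) < \<eta> \<longrightarrow> z \<in> end_nbhd e"
proof (cases e)
  case (Tang a b)
  then have ab: "a \<noteq> b" using assms by simp
  show ?thesis
  proof (intro exI [of _ "1/5"] conjI allI impI)
    fix t :: real and z
    assume t: "0 < t" "t < 1/5" and d: "dist (rescaled e t z) (rescaled_lim e) < 1/5"
    define u where "u = coord a b z / of_real t"
    have c: "coord a b z = of_real t * u" using t by (simp add: u_def)
    have d': "norm (u - 1) < 1/5" using d by (simp add: Tang u_def dist_norm)
    have "norm u \<le> norm (u - 1) + norm (1 :: complex)"
      by (metis diff_add_cancel norm_triangle_ineq)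
    then have n: "norm u < 6/5" using d' by simp
    have "\<bar>Re (u - 1)\<bar> < 1/5" using abs_Re_le_cmod [of "u - 1"] d' by linarith
    then have r: "Re u > 4/5" by (simp add: abs_if split: if_splits)
    have "(norm u)\<^sup>2 \<le> (6/5)\<^sup>2" using n by (intro power_mono) auto
    then have "t * (norm u)\<^sup>2 \<le> (1/5) * (6/5)\<^sup>2" using t by (intro mult_mono) auto
    also have "\<dots> < Re u" using r by (simp add: power2_eq_square)
    finally have "t * (t * (norm u)\<^sup>2) < t * Re u" using t by simp
    then have "coord a b z \<in> ball (1/2) (1/2)"
      unfolding half_disc_iff c using t by (simp add: norm_mult power_mult_distrib power2_eq_square mult_ac)
    then show "z \<in> end_nbhd e" by (simp only: Tang end_nbhd_tang_iff [OF ab])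
  qed simp
next
  case (Pt p)
  then have "min (dist p 0) (dist p 1) > 0" using assms by (auto simp: Ycurve_def)
  then show ?thesis
    by (intro exI [of _ "min (dist p 0) (dist p 1)"]) (auto simp: Pt dist_commute)
qed

lemma linear_cusp_residue: "linear_series (cusp_residue a)"
  by (cases a) (simp_all add: linear_series_intros)

lemma reg_factor_Nil: "reg_factor e c [] = 1"
  by (cases e) (simp_all add: nc_exp_linear_Nil linear_cusp_residue nc_one_def)

lemma reg_factor_minus: "reg_factor e c \<star> reg_factor e (- c) = nc_one"
  by (cases e) (simp_all add: nc_exp_minus linear_cusp_residue)

text \<open>
  The flat section that the regularization attaches to an end. At an ordinary point it has the value
  1 there, and the regularizing factor is trivial.
\<close>

definition is_end_section :: "endpt \<Rightarrow> (complex \<Rightarrow> ncseries) \<Rightarrow> bool" where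
  "is_end_section e \<Psi> \<longleftrightarrow> flat_on (end_nbhd e) \<Psi> \<and> (\<forall>p. e = Pt p \<longrightarrow> \<Psi> p = nc_one) \<and>
     (\<forall>x w. ((\<lambda>t. rescaled e t (x t)) \<longlongrightarrow> rescaled_lim e) (at_right 0) \<longrightarrow>
        ((\<lambda>t. (reg_factor e (of_real (ln t)) \<star> \<Psi> (x t)) w) \<longlongrightarrow> nc_one w) (at_right 0))"

lemma is_end_section_tangI:
  fixes q :: "complex \<Rightarrow> complex"
  assumes ab: "a \<noteq> b" and T: "linear_series T" and q: "q holomorphic_on ball 0 1"
    and \<kappa>: "\<And>z. z \<in> Ycurve \<Longrightarrow> (coord a b has_field_derivative \<kappa>' z) (at z)"
    and form: "\<And>z i. z \<in> Ycurve \<Longrightarrow>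
      cusp_residue a [i] * \<kappa>' z / coord a b z + q (coord a b z) * T [i] * \<kappa>' z = form_coeff i z"
  shows "\<exists>\<Psi>. is_end_section (Tang a b) \<Psi>"
proof -
  have Y: "z \<in> Ycurve" if "z \<in> end_nbhd (Tang a b)" for z
    using that end_nbhd_subset by blast
  have "\<exists>\<Psi>. flat_on (end_nbhd (Tang a b)) \<Psi> \<and>
      (\<forall>x w. ((\<lambda>t. coord a b (x t) / of_real t) \<longlongrightarrow> 1) (at_right 0) \<longrightarrow>
        ((\<lambda>t. (nc_exp (nc_scale (of_real (ln t)) (cusp_residue a)) \<star> \<Psi> (x t)) w) \<longlongrightarrow> nc_one w)
          (at_right (0 :: real)))"
    by (rule tangential_section_exists [OF linear_cusp_residue T q, where \<kappa>' = \<kappa>'])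
      (use \<kappa> form Y in \<open>simp_all only: end_nbhd_tang_iff [OF ab, symmetric]\<close>)
  then show ?thesis by (simp add: is_end_section_def)
qed

lemma coord_eq:
  "coord C0 C1 = (\<lambda>z. z)" "coord C0 Cinf = (\<lambda>z. - z)"
  "coord C1 C0 = (\<lambda>z. 1 - z)" "coord C1 Cinf = (\<lambda>z. z - 1)"
  "coord Cinf C0 = (\<lambda>z. - (1 / z))" "coord Cinf C1 = (\<lambda>z. 1 / z)"
  by (simp_all add: fun_eq_iff)

text \<open>
  For each of the six tangent vectors the connection form is written in the local coordinate as
  \<open>R dc/c + q(c) T dc\<close>, where \<open>R\<close> is the residue and \<open>q(c)\<close> is \<open>1/(1 - c)\<close> or \<open>1/(1 + c)\<close>.
\<close>

lemma is_end_section_exists: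
  assumes "proper_end e"
  shows "\<exists>\<Psi>. is_end_section e \<Psi>"
proof (cases e)
  case (Tang a b)
  have q1: "(\<lambda>c. 1 / (1 - c)) holomorphic_on ball 0 1"
    and q2: "(\<lambda>c. 1 / (1 + c)) holomorphic_on ball 0 1"
    by (intro holomorphic_intros; force simp: add_eq_0_iff)+
  note T = linear_series_var linear_series_uminus [OF linear_series_var]
  have neq: "z \<noteq> 0" "z - 1 \<noteq> 0" "1 - z \<noteq> 0" "z \<noteq> 1" if "z \<in> Ycurve" for z
    using that by (auto simp: Ycurve_def)
  consider "a = C0" "b = C1" | "a = C0" "b = Cinf" | "a = C1" "b = C0" | "a = C1" "b = Cinf"
    | "a = Cinf" "b = C0" | "a = Cinf" "b = C1"
    using assms Tang by (cases a; cases b) auto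
  then show ?thesis
  proof cases
    case 1
    show ?thesis unfolding Tang 1
    proof (rule is_end_section_tangI [OF _ T(1) [of L1] q1, where \<kappa>' = "\<lambda>_. 1"])
      fix z i assume "z \<in> Ycurve"
      then show "cusp_residue C0 [i] * 1 / coord C0 C1 z + 1 / (1 - coord C0 C1 z) * nc_var L1 [i] * 1 = form_coeff i z"
        using neq [of z] by (cases i) (auto simp: nc_var_def field_simps)
    qed (auto simp: coord_eq intro!: derivative_eq_intros)
  next
    case 2
    show ?thesis unfolding Tang 2
    proof (rule is_end_section_tangI [OF _ T(2) [of L1] q2, where \<kappa>' = "\<lambda>_. -1"])
      fix z i assume "z \<in> Ycurve"
      then show "cusp_residue C0 [i] * (-1) / coord C0 Cinf z + 1 / (1 + coord C0 Cinf z) * (- nc_var L1) [i] * (-1) = form_coeff i z"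
        using neq [of z] by (cases i) (auto simp: nc_var_def field_simps)
    qed (auto simp: coord_eq intro!: derivative_eq_intros)
  next
    case 3
    show ?thesis unfolding Tang 3
    proof (rule is_end_section_tangI [OF _ T(2) [of L0] q1, where \<kappa>' = "\<lambda>_. -1"])
      fix z i assume "z \<in> Ycurve"
      then show "cusp_residue C1 [i] * (-1) / coord C1 C0 z + 1 / (1 - coord C1 C0 z) * (- nc_var L0) [i] * (-1) = form_coeff i z"
        using neq [of z] by (cases i) (auto simp: nc_var_def field_simps)
    qed (auto simp: coord_eq intro!: derivative_eq_intros)
  next
    case 4
    show ?thesis unfolding Tang 4
    proof (rule is_end_section_tangI [OF _ T(1) [of L0] q2, where \<kappa>' = "\<lambda>_. 1"])
      fix z i assume "z \<in> Ycurve"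
      then show "cusp_residue C1 [i] * 1 / coord C1 Cinf z + 1 / (1 + coord C1 Cinf z) * nc_var L0 [i] * 1 = form_coeff i z"
        using neq [of z] by (cases i) (auto simp: nc_var_def field_simps)
    qed (auto simp: coord_eq intro!: derivative_eq_intros)
  next
    case 5
    show ?thesis unfolding Tang 5
    proof (rule is_end_section_tangI [OF _ T(2) [of L1] q2, where \<kappa>' = "\<lambda>z. 1 / z\<^sup>2"])
      fix z i assume "z \<in> Ycurve"
      then show "cusp_residue Cinf [i] * (1 / z\<^sup>2) / coord Cinf C0 z + 1 / (1 + coord Cinf C0 z) * (- nc_var L1) [i] * (1 / z\<^sup>2) = form_coeff i z"
        using neq [of z] by (cases i) (auto simp: nc_var_def divide_simps power2_eq_square)
    qed (use neq in \<open>auto simp: coord_eq power2_eq_square intro!: derivative_eq_intros\<close>)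
  next
    case 6
    show ?thesis unfolding Tang 6
    proof (rule is_end_section_tangI [OF _ T(1) [of L1] q1, where \<kappa>' = "\<lambda>z. - 1 / z\<^sup>2"])
      fix z i assume "z \<in> Ycurve"
      then show "cusp_residue Cinf [i] * (- 1 / z\<^sup>2) / coord Cinf C1 z + 1 / (1 - coord Cinf C1 z) * nc_var L1 [i] * (- 1 / z\<^sup>2) = form_coeff i z"
        using neq [of z] by (cases i) (auto simp: nc_var_def divide_simps power2_eq_square)
    qed (use neq in \<open>auto simp: coord_eq power2_eq_square intro!: derivative_eq_intros\<close>)
  qed
next
  case (Pt p)
  let ?r = "min (dist p 0) (dist p 1)"
  have r: "?r > 0" using assms Pt by (auto simp: Ycurve_def)
  have "starlike (ball p ?r)"
    using r centre_in_ball [of p ?r] by (intro convex_imp_starlike convex_ball) blast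
  moreover have "ball p ?r \<subseteq> Ycurve" using end_nbhd_subset [of "Pt p"] by simp
  ultimately obtain \<Psi> where \<Psi>: "flat_on (ball p ?r) \<Psi>" "\<Psi> p = nc_one"
    using flat_on_exists [OF _ open_ball] by blast
  have "isCont (\<lambda>z. \<Psi> z w) p" for w
    by (rule DERIV_isCont [OF flat_on_has_derivative [OF \<Psi>(1) open_ball]]) (simp only: centre_in_ball r)
  then have "((\<lambda>t. \<Psi> (x t) w) \<longlongrightarrow> nc_one w) (at_right 0)"
    if "(x \<longlongrightarrow> p) (at_right 0)" for x :: "real \<Rightarrow> complex" and w
    using isCont_tendsto_compose [OF _ that, of "\<lambda>z. \<Psi> z w"] \<Psi>(2) by metis
  then have "is_end_section e \<Psi>"
    using \<Psi> by (simp add: is_end_section_def Pt)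
  then show ?thesis by blast
qed

definition end_section :: "endpt \<Rightarrow> complex \<Rightarrow> ncseries" where
  "end_section e = (SOME \<Psi>. is_end_section e \<Psi>)"

lemma end_section: "proper_end e \<Longrightarrow> is_end_section e (end_section e)"
  unfolding end_section_def by (rule someI_ex [OF is_end_section_exists])

lemma flat_end_section: "proper_end e \<Longrightarrow> flat_on (end_nbhd e) (end_section e)"
  using end_section by (simp add: is_end_section_def)

lemma end_section_Pt: "p \<in> Ycurve \<Longrightarrow> end_section (Pt p) p = nc_one"
  using end_section [of "Pt p"] by (simp add: is_end_section_def)

lemma end_section_tendsto:
  "proper_end e \<Longrightarrow> ((\<lambda>t. rescaled e t (x t)) \<longlongrightarrow> rescaled_lim e) (at_right 0) \<Longrightarrow>
    ((\<lambda>t. (reg_factor e (of_real (ln t)) \<star> end_section e (x t)) w) \<longlongrightarrow> nc_one w) (at_right 0)"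
  using end_section by (simp add: is_end_section_def)

section \<open>Lifts of maps into the curve\<close>

text \<open>
  A lift of \<open>h\<close> continues a flat section along \<open>h\<close>. It is single-valued as a function on the
  parameter space \<open>K\<close>, although flat sections have monodromy on the curve itself. The map \<open>h\<close> may
  be a path as well as a homotopy.
\<close>

definition lifted :: "('k :: topological_space \<Rightarrow> ncseries) \<Rightarrow> ('k \<Rightarrow> complex) \<Rightarrow> 'k set \<Rightarrow> bool" where
  "lifted \<Phi> h K \<longleftrightarrow> (\<forall>k\<in>K. \<exists>N V \<Psi>. openin (top_of_set K) N \<and> k \<in> N \<and> open V \<and> convex V \<and>
     flat_on V \<Psi> \<and> h ` N \<subseteq> V \<and> (\<forall>x\<in>N. \<Phi> x = \<Psi> (h x)))"

lemma liftedE: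
  assumes "lifted \<Phi> h K" "k \<in> K"
  obtains N V \<Psi> where "openin (top_of_set K) N" "k \<in> N" "open V" "convex V"
    "flat_on V \<Psi>" "h ` N \<subseteq> V" "\<forall>x\<in>N. \<Phi> x = \<Psi> (h x)"
  using bspec [OF assms(1) [unfolded lifted_def] assms(2)] by (elim exE conjE) (rule that)

lemma lifted_Nil:
  assumes "lifted \<Phi> h K" "k \<in> K"
  shows "\<Phi> k [] = 1"
proof (rule liftedE [OF assms])
  fix N V \<Psi> assume "k \<in> N" "flat_on V \<Psi>" "h ` N \<subseteq> V" "\<forall>x\<in>N. \<Phi> x = \<Psi> (h x)"
  then show ?thesis using flat_on_Nil [of V \<Psi> "h k"] by auto
qed

lemma lifted_flat:
  assumes \<Psi>: "flat_on V \<Psi>" and V: "open V" and h: "continuous_on K h" "h ` K \<subseteq> V"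
  shows "lifted (\<lambda>k. \<Psi> (h k)) h K"
  unfolding lifted_def
proof
  fix k assume k: "k \<in> K"
  then have "h k \<in> V" using h by auto
  then obtain r where r: "r > 0" "ball (h k) r \<subseteq> V"
    using openE [OF V] by metis
  have "openin (top_of_set K) (K \<inter> h -` ball (h k) r)"
    by (rule continuous_openin_preimage_gen [OF h(1) open_ball])
  then show "\<exists>N U \<Psi>'. openin (top_of_set K) N \<and> k \<in> N \<and> open U \<and> convex U \<and>
      flat_on U \<Psi>' \<and> h ` N \<subseteq> U \<and> (\<forall>x\<in>N. \<Psi> (h x) = \<Psi>' (h x))"
    using k r flat_on_subset [OF \<Psi> r(2)]
    by (intro exI [of _ "K \<inter> h -` ball (h k) r"] exI [of _ "ball (h k) r"] exI [of _ \<Psi>]) auto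
qed

lemma lifted_mult_const:
  assumes \<Phi>: "lifted \<Phi> h K" and C: "C [] = 1"
  shows "lifted (\<lambda>k. \<Phi> k \<star> C) h K"
  unfolding lifted_def
proof
  fix k assume "k \<in> K"
  then obtain N V \<Psi> where *: "openin (top_of_set K) N" "k \<in> N" "open V" "convex V"
    "flat_on V \<Psi>" "h ` N \<subseteq> V" "\<forall>x\<in>N. \<Phi> x = \<Psi> (h x)"
    by (rule liftedE [OF \<Phi>])
  have "flat_on V (\<lambda>z. \<Psi> z \<star> C)"
    by (rule flat_on_mult_const [where C = C, OF *(5,3) C])
  then show "\<exists>N V \<Psi>. openin (top_of_set K) N \<and> k \<in> N \<and> open V \<and> convex V \<and>
      flat_on V \<Psi> \<and> h ` N \<subseteq> V \<and> (\<forall>x\<in>N. \<Phi> x \<star> C = \<Psi> (h x))"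
    using * by (intro exI [of _ N] exI [of _ V] exI [of _ "\<lambda>z. \<Psi> z \<star> C"]) auto
qed

lemma lifted_compose:
  assumes \<Phi>: "lifted \<Phi> h K" and f: "continuous_on L f" "f ` L \<subseteq> K"
  shows "lifted (\<lambda>l. \<Phi> (f l)) (\<lambda>l. h (f l)) L"
  unfolding lifted_def
proof
  fix l assume l: "l \<in> L"
  then have "f l \<in> K" using f(2) by auto
  then obtain N V \<Psi> where *: "openin (top_of_set K) N" "f l \<in> N" "open V" "convex V"
    "flat_on V \<Psi>" "h ` N \<subseteq> V" "\<forall>x\<in>N. \<Phi> x = \<Psi> (h x)"
    by (rule liftedE [OF \<Phi>])
  have "openin (top_of_set L) (L \<inter> f -` N)"
    by (rule continuous_openin_preimage [OF f(1) _ *(1)]) (use f(2) in auto)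
  then show "\<exists>N V \<Psi>. openin (top_of_set L) N \<and> l \<in> N \<and> open V \<and> convex V \<and>
      flat_on V \<Psi> \<and> (\<lambda>l. h (f l)) ` N \<subseteq> V \<and> (\<forall>x\<in>N. \<Phi> (f x) = \<Psi> (h (f x)))"
    using * l by (intro exI [of _ "L \<inter> f -` N"] exI [of _ V] exI [of _ \<Psi>]) auto
qed

lemma lifted_subset: "lifted \<Phi> h K \<Longrightarrow> L \<subseteq> K \<Longrightarrow> lifted \<Phi> h L"
  using lifted_compose [of \<Phi> h K L "\<lambda>l. l"] by (simp add: continuous_on_id)

text \<open>
  Being a lift is a local property of the pair \<open>(\<Phi>, h)\<close>; this is how lifts are glued.
\<close>

lemma lifted_local:
  assumes "\<And>k. k \<in> K \<Longrightarrow> \<exists>N \<Phi>' h'. openin (top_of_set K) N \<and> k \<in> N \<and> lifted \<Phi>' h' N \<and>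
    (\<forall>x\<in>N. \<Phi> x = \<Phi>' x \<and> h x = h' x)"
  shows "lifted \<Phi> h K"
  unfolding lifted_def
proof
  fix k assume "k \<in> K"
  then obtain M \<Phi>' h' where M: "openin (top_of_set K) M" "k \<in> M" "lifted \<Phi>' h' M"
    "\<forall>x\<in>M. \<Phi> x = \<Phi>' x \<and> h x = h' x"
    using assms by blast
  then obtain N V \<Psi> where N: "openin (top_of_set M) N" "k \<in> N" "open V" "convex V"
    "flat_on V \<Psi>" "h' ` N \<subseteq> V" "\<forall>x\<in>N. \<Phi>' x = \<Psi> (h' x)"
    by (elim liftedE)
  have "N \<subseteq> M" using N(1) by (rule openin_imp_subset)
  then show "\<exists>N V \<Psi>. openin (top_of_set K) N \<and> k \<in> N \<and> open V \<and> convex V \<and>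
      flat_on V \<Psi> \<and> h ` N \<subseteq> V \<and> (\<forall>x\<in>N. \<Phi> x = \<Psi> (h x))"
    using N M openin_trans [OF N(1) M(1)]
    by (intro exI [of _ N] exI [of _ V] exI [of _ \<Psi>]) (auto simp: subset_iff)
qed

text \<open>
  The set where two lifts agree is open and closed, by uniqueness of flat sections.
\<close>

lemma lifted_unique:
  assumes K: "connected K" and \<Phi>: "lifted \<Phi> h K" "lifted \<Phi>' h K"
    and k: "k \<in> K" "\<Phi> k = \<Phi>' k" and x: "x \<in> K"
  shows "\<Phi> x = \<Phi>' x"
proof (rule connected_induction_simple [where P = "\<lambda>x. \<Phi> x = \<Phi>' x", OF K k(1) x k(2)])
  fix a assume a: "a \<in> K"
  obtain N V \<Psi> where N: "openin (top_of_set K) N" "a \<in> N" "open V" "convex V"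
    "flat_on V \<Psi>" "h ` N \<subseteq> V" "\<forall>x\<in>N. \<Phi> x = \<Psi> (h x)"
    by (rule liftedE [OF \<Phi>(1) a])
  obtain N' V' \<Psi>' where N': "openin (top_of_set K) N'" "a \<in> N'" "open V'" "convex V'"
    "flat_on V' \<Psi>'" "h ` N' \<subseteq> V'" "\<forall>x\<in>N'. \<Phi>' x = \<Psi>' (h x)"
    by (rule liftedE [OF \<Phi>(2) a])
  have W: "connected (V \<inter> V')" "open (V \<inter> V')"
    using N N' by (auto intro!: convex_connected convex_Int)
  have fl: "flat_on (V \<inter> V') \<Psi>" "flat_on (V \<inter> V') \<Psi>'"
    using flat_on_subset N(5) N'(5) by blast+
  have "\<Phi> y = \<Phi>' y" if "z \<in> N \<inter> N'" "y \<in> N \<inter> N'" "\<Phi> z = \<Phi>' z" for z y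
    using flat_on_unique [OF W fl, of "h z" "h y"] that N N' by auto
  then show "\<exists>T. openin (top_of_set K) T \<and> a \<in> T \<and>
      (\<forall>x\<in>T. \<forall>y\<in>T. \<Phi> x = \<Phi>' x \<longrightarrow> \<Phi> y = \<Phi>' y)"
    using openin_Int [OF N(1) N'(1)] N(2) N'(2) by (intro exI [of _ "N \<inter> N'"]) blast
qed

lemma lifted_eq_mult_const:
  assumes K: "connected K" and \<Phi>: "lifted \<Phi> h K" "lifted \<Phi>' h K"
  obtains C where "C [] = 1" "\<And>x. x \<in> K \<Longrightarrow> \<Phi> x = \<Phi>' x \<star> C"
proof (cases "K = {}")
  case True
  show ?thesis by (rule that [of nc_one]) (simp_all add: True nc_one_def)
next
  case False
  then obtain k where k: "k \<in> K" by auto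
  define C where "C = nc_inv (\<Phi>' k) \<star> \<Phi> k"
  have C: "C [] = 1"
    by (simp add: C_def nc_mult_Nil lifted_Nil [OF \<Phi>(1) k])
  have "\<Phi> k = \<Phi>' k \<star> C"
    unfolding C_def nc_mult_assoc [symmetric]
    by (simp add: nc_mult_inv_right [of "\<Phi>' k", OF lifted_Nil [OF \<Phi>(2) k]])
  then show ?thesis
    using lifted_unique [OF K \<Phi>(1) lifted_mult_const [where C = C, OF \<Phi>(2) C] k] that [of C, OF C] by blast
qed

subsection \<open>Existence of lifts\<close>

text \<open>
  A transport function \<open>c\<close> that is multiplicative on small triangles is extended to pairs of twice
  the distance by going through the midpoint. The midpoints of the sides divide a triangle into four
  triangles of half the size, and the product around the large triangle can be moved across them one
  by one. Repeating this replaces subdivision arguments for homotopies of paths.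
\<close>

lemma cocycle_doubling:
  fixes c :: "'k :: real_normed_vector \<Rightarrow> 'k \<Rightarrow> ncseries"
  assumes K: "convex K"
    and c: "\<And>x y z. x \<in> K \<Longrightarrow> y \<in> K \<Longrightarrow> z \<in> K \<Longrightarrow> dist x y < \<delta> \<Longrightarrow> dist y z < \<delta> \<Longrightarrow> dist x z < \<delta> \<Longrightarrow>
      c x y \<star> c y z = c x z"
    and xyz: "x \<in> K" "y \<in> K" "z \<in> K" "dist x y < 2 * \<delta>" "dist y z < 2 * \<delta>" "dist x z < 2 * \<delta>"
  defines "c' \<equiv> \<lambda>x y. c x (midpoint x y) \<star> c (midpoint x y) y"
  shows "c' x y \<star> c' y z = c' x z"
proof -
  let ?m = "midpoint"
  have m: "?m x y \<in> K" "?m y z \<in> K" "?m x z \<in> K"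
    using K xyz by (meson closed_segment_subset midpoint_in_closed_segment subsetD)+
  have half: "dist (?m a b) (?m a d) = dist b d / 2" "dist (?m a b) (?m d b) = dist a d / 2" for a b d :: 'k
    by (simp_all add: midpoint_def dist_norm flip: scaleR_right_diff_distrib)
  have d: "dist (?m x y) (?m y z) = dist x z / 2" "dist (?m y z) (?m x y) = dist x z / 2"
    using half(2) [of x y z] by (simp_all add: midpoint_sym [of y z] dist_commute)
  note dm = dist_midpoint [of x y] dist_midpoint [of y z] dist_midpoint [of x z]
  have h: "dist (?m x y) (?m x z) = dist y z / 2" "dist (?m x z) (?m y z) = dist x y / 2"
    using half(1) [of x y z] half(2) [of x z y] by simp_all
  have e1: "c (?m x y) y \<star> c y (?m y z) = c (?m x y) (?m y z)"
    using m xyz dm d by (intro c) auto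
  have e2: "c (?m x y) (?m x z) \<star> c (?m x z) (?m y z) = c (?m x y) (?m y z)"
    using m xyz d h by (intro c) auto
  have e3: "c x (?m x y) \<star> c (?m x y) (?m x z) = c x (?m x z)"
    using m xyz dm h by (intro c) auto
  have e4: "c (?m x z) (?m y z) \<star> c (?m y z) z = c (?m x z) z"
    using m xyz dm h by (intro c) auto
  have "c' x y \<star> c' y z = c x (?m x y) \<star> (c (?m x y) y \<star> c y (?m y z)) \<star> c (?m y z) z"
    by (simp only: c'_def nc_mult_assoc)
  also have "\<dots> = (c x (?m x y) \<star> c (?m x y) (?m x z)) \<star> (c (?m x z) (?m y z) \<star> c (?m y z) z)"
    unfolding e1 e2 [symmetric] by (simp only: nc_mult_assoc)
  also have "\<dots> = c' x z"
    unfolding e3 e4 c'_def ..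
  finally show ?thesis .
qed

lemma cocycle_extend:
  fixes c :: "'k :: real_normed_vector \<Rightarrow> 'k \<Rightarrow> ncseries"
  assumes K: "convex K"
    and c: "\<And>x y z. x \<in> K \<Longrightarrow> y \<in> K \<Longrightarrow> z \<in> K \<Longrightarrow> dist x y < \<delta> \<Longrightarrow> dist y z < \<delta> \<Longrightarrow> dist x z < \<delta> \<Longrightarrow>
      c x y \<star> c y z = c x z"
  shows "\<exists>c'. (\<forall>x\<in>K. \<forall>y\<in>K. dist x y < \<delta> \<longrightarrow> c' x y = c x y) \<and>
    (\<forall>x\<in>K. \<forall>y\<in>K. \<forall>z\<in>K. dist x y < 2 ^ n * \<delta> \<longrightarrow> dist y z < 2 ^ n * \<delta> \<longrightarrow> dist x z < 2 ^ n * \<delta> \<longrightarrow>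
      c' x y \<star> c' y z = c' x z)"
proof (induction n)
  case 0
  show ?case using c by (intro exI [of _ c]) auto
next
  case (Suc n)
  then obtain c' where eq: "\<And>x y. x \<in> K \<Longrightarrow> y \<in> K \<Longrightarrow> dist x y < \<delta> \<Longrightarrow> c' x y = c x y"
    and co: "\<And>x y z. x \<in> K \<Longrightarrow> y \<in> K \<Longrightarrow> z \<in> K \<Longrightarrow> dist x y < 2 ^ n * \<delta> \<Longrightarrow> dist y z < 2 ^ n * \<delta> \<Longrightarrow>
      dist x z < 2 ^ n * \<delta> \<Longrightarrow> c' x y \<star> c' y z = c' x z"
    by blast
  let ?c = "\<lambda>x y. c' x (midpoint x y) \<star> c' (midpoint x y) y"
  have eq2: "?c x y = c x y" if "x \<in> K" "y \<in> K" "dist x y < \<delta>" for x y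
  proof -
    have m: "midpoint x y \<in> K"
      using K that by (meson closed_segment_subset midpoint_in_closed_segment subsetD)
    have "dist x (midpoint x y) < \<delta>" "dist (midpoint x y) y < \<delta>"
      using that dist_midpoint [of x y] zero_le_dist [of x y] by linarith+
    then show ?thesis
      using that m by (simp add: eq c)
  qed
  have co2: "?c x y \<star> ?c y z = ?c x z"
    if "x \<in> K" "y \<in> K" "z \<in> K" "dist x y < 2 ^ Suc n * \<delta>" "dist y z < 2 ^ Suc n * \<delta>"
      "dist x z < 2 ^ Suc n * \<delta>" for x y z
    by (rule cocycle_doubling [of K "2 ^ n * \<delta>" c', OF K]) (use co that in simp_all)
  show ?case
    by (rule exI [of _ ?c]) (use eq2 co2 in blast)
qed

text \<open>
  Locally the transport from \<open>x\<close> to \<open>y\<close> is the value at \<open>h x\<close> of the flat section that is 1 at \<open>h y\<close>.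
  By compactness this makes sense and is multiplicative on triangles of some uniform size \<open>\<delta>\<close>, and
  convexity of \<open>K\<close> allows to extend it to all of \<open>K\<close> by doubling. Its values relative to a fixed
  point form the lift.
\<close>

lemma lifted_exists_compact:
  fixes h :: "'k :: real_normed_vector \<Rightarrow> complex"
  assumes K: "convex K" "compact K" and h: "continuous_on K h" "h ` K \<subseteq> Ycurve" and k0: "k\<^sub>0 \<in> K"
  shows "\<exists>\<Phi>. lifted \<Phi> h K \<and> \<Phi> k\<^sub>0 = nc_one"
proof -
  have "open Ycurve" by (simp add: Ycurve_def open_Compl)
  then obtain r where r: "r > 0" "\<And>k. k \<in> K \<Longrightarrow> ball (h k) r \<subseteq> Ycurve"
    using compact_subset_open_imp_ball_epsilon_subset [OF compact_continuous_image [OF h(1) K(2)] _ h(2)]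
    by (smt (verit) UN_subset_iff image_eqI)
  have "\<exists>\<Psi>. flat_on (ball (h k) r) \<Psi> \<and> \<Psi> (h k) = nc_one" if "k \<in> K" for k
    using r that by (intro flat_on_exists convex_imp_starlike) auto
  then obtain \<Psi> where \<Psi>: "\<And>k. k \<in> K \<Longrightarrow> flat_on (ball (h k) r) (\<Psi> k)" "\<And>k. k \<in> K \<Longrightarrow> \<Psi> k (h k) = nc_one"
    by metis
  obtain \<delta> where \<delta>: "\<delta> > 0" "\<And>x y. x \<in> K \<Longrightarrow> y \<in> K \<Longrightarrow> dist x y < \<delta> \<Longrightarrow> dist (h x) (h y) < r"
    using compact_uniformly_continuous [OF h(1) K(2)] r(1) unfolding uniformly_continuous_on_def
    by (metis dist_commute)
  define c where "c = (\<lambda>x y. \<Psi> y (h x))"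
  have cNil: "c x y [] = 1" if "x \<in> K" "y \<in> K" "dist x y < \<delta>" for x y
    unfolding c_def using \<delta> that by (intro flat_on_Nil [OF \<Psi>(1)]) (auto simp: dist_commute)
  have co: "c x y \<star> c y z = c x z"
    if "x \<in> K" "y \<in> K" "z \<in> K" "dist x y < \<delta>" "dist y z < \<delta>" "dist x z < \<delta>" for x y z
  proof -
    let ?W = "ball (h y) r \<inter> ball (h z) r"
    have W: "connected ?W" "open ?W" by (auto intro!: convex_connected convex_Int)
    have in_W: "h x \<in> ?W" "h y \<in> ?W" using that \<delta>(2) r(1) by (auto simp: dist_commute)
    have "flat_on ?W (\<lambda>w. \<Psi> y w \<star> c y z)"
      by (rule flat_on_mult_const [where C = "c y z"])
        (use that in \<open>auto intro: flat_on_subset [OF \<Psi>(1)] cNil\<close>)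
    moreover have "flat_on ?W (\<Psi> z)"
      using that by (intro flat_on_subset [OF \<Psi>(1)]) auto
    ultimately have "\<Psi> y (h x) \<star> c y z = \<Psi> z (h x)"
      using flat_on_unique [OF W _ _ in_W(2), of "\<lambda>w. \<Psi> y w \<star> c y z" "\<Psi> z" "h x"] in_W(1) \<Psi>(2) that
      by (simp add: c_def)
    then show ?thesis by (simp add: c_def)
  qed
  obtain B where B: "\<And>x y. x \<in> K \<Longrightarrow> y \<in> K \<Longrightarrow> dist x y \<le> B"
    using compact_imp_bounded [OF K(2)] by (meson bounded_two_points)
  obtain n where n: "B / \<delta> < 2 ^ n" using real_arch_pow [of 2] by auto
  then have "B < 2 ^ n * \<delta>" using \<delta>(1) by (simp add: field_simps)
  then have Bn: "dist x y < 2 ^ n * \<delta>" if "x \<in> K" "y \<in> K" for x y using B that by fastforce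
  have "\<exists>c'. (\<forall>x\<in>K. \<forall>y\<in>K. dist x y < \<delta> \<longrightarrow> c' x y = c x y) \<and>
    (\<forall>x\<in>K. \<forall>y\<in>K. \<forall>z\<in>K. dist x y < 2 ^ n * \<delta> \<longrightarrow> dist y z < 2 ^ n * \<delta> \<longrightarrow> dist x z < 2 ^ n * \<delta> \<longrightarrow>
      c' x y \<star> c' y z = c' x z)"
    by (rule cocycle_extend [OF K(1)]) (rule co)
  then obtain c' where ext: "\<forall>x\<in>K. \<forall>y\<in>K. dist x y < \<delta> \<longrightarrow> c' x y = c x y"
    "\<forall>x\<in>K. \<forall>y\<in>K. \<forall>z\<in>K. dist x y < 2 ^ n * \<delta> \<longrightarrow> dist y z < 2 ^ n * \<delta> \<longrightarrow> dist x z < 2 ^ n * \<delta> \<longrightarrow>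
      c' x y \<star> c' y z = c' x z"
    by (elim exE conjE)
  have c': "\<And>x y. x \<in> K \<Longrightarrow> y \<in> K \<Longrightarrow> dist x y < \<delta> \<Longrightarrow> c' x y = c x y"
    "\<And>x y z. x \<in> K \<Longrightarrow> y \<in> K \<Longrightarrow> z \<in> K \<Longrightarrow> c' x y \<star> c' y z = c' x z"
    using ext Bn by simp_all
  have c'1: "c' k k = nc_one" if "k \<in> K" for k
    using c'(1) [OF that that] \<delta>(1) \<Psi>(2) [OF that] by (simp add: c_def)
  \<comment> \<open>The constant term of the extended cocycle does not change under small steps.\<close>
  have c'Nil: "c' k l [] = 1" if "k \<in> K" "l \<in> K" for k l
  proof -
    show ?thesis
    proof (rule connected_induction_simple [OF connected_segment(1) [of k l], where P = "\<lambda>x. c' x l [] = 1" and a = l])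
      fix a assume a: "a \<in> closed_segment k l"
      have sub: "closed_segment k l \<subseteq> K" using K(1) that by (rule closed_segment_subset [rotated 2])
      have "c' x l [] = c' y l []" if "x \<in> closed_segment k l \<inter> ball a (\<delta> / 2)"
        "y \<in> closed_segment k l \<inter> ball a (\<delta> / 2)" for x y
      proof -
        have "dist x y < \<delta>"
          using that dist_triangle_half_r [of a x \<delta> y] by (auto simp: dist_commute)
        moreover have "x \<in> K" "y \<in> K" using that sub by auto
        ultimately have "c' x l [] = c x y [] * c' y l []"
          using c'(1) [of x y] c'(2) [of x y l] \<open>l \<in> K\<close> by (metis nc_mult_Nil)
        then show ?thesis
          using cNil \<open>dist x y < \<delta>\<close> \<open>x \<in> K\<close> \<open>y \<in> K\<close> by simp
      qed
      note const = this
      have "openin (top_of_set (closed_segment k l)) (closed_segment k l \<inter> ball a (\<delta> / 2))"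
        by (simp add: openin_open_Int)
      moreover have "a \<in> closed_segment k l \<inter> ball a (\<delta> / 2)"
        using a \<delta>(1) by simp
      ultimately show "\<exists>T. openin (top_of_set (closed_segment k l)) T \<and> a \<in> T \<and>
          (\<forall>x\<in>T. \<forall>y\<in>T. c' x l [] = 1 \<longrightarrow> c' y l [] = 1)"
        using const by (intro exI [of _ "closed_segment k l \<inter> ball a (\<delta> / 2)"] conjI ballI impI) metis+
    qed (use c'1 [OF that(2)] in \<open>simp_all add: nc_one_def\<close>)
  qed
  have "lifted (\<lambda>k. c' k k\<^sub>0) h K"
    unfolding lifted_def
  proof
    fix k assume k: "k \<in> K"
    let ?N = "K \<inter> ball k \<delta>" and ?V = "ball (h k) r"
    have 1: "flat_on ?V (\<lambda>z. \<Psi> k z \<star> c' k k\<^sub>0)"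
      by (rule flat_on_mult_const [where C = "c' k k\<^sub>0"]) (auto simp: \<Psi> k c'Nil k0)
    have 2: "c' x k\<^sub>0 = \<Psi> k (h x) \<star> c' k k\<^sub>0" if "x \<in> ?N" for x
    proof -
      have "c' x k = \<Psi> k (h x)" using c'(1) [of x k] that k by (simp add: c_def dist_commute)
      then show ?thesis using c'(2) [of x k k\<^sub>0] that k k0 by simp
    qed
    have 3: "h ` ?N \<subseteq> ?V" using \<delta>(2) k by auto
    have 4: "openin (top_of_set K) ?N" by (simp add: openin_open_Int)
    have 5: "k \<in> ?N" using k \<delta>(1) by simp
    show "\<exists>N V \<Psi>. openin (top_of_set K) N \<and> k \<in> N \<and> open V \<and> convex V \<and>
        flat_on V \<Psi> \<and> h ` N \<subseteq> V \<and> (\<forall>x\<in>N. c' x k\<^sub>0 = \<Psi> (h x))"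
      by (intro exI [of _ ?N] exI [of _ ?V] exI [of _ "\<lambda>z. \<Psi> k z \<star> c' k k\<^sub>0"] conjI ballI
          1 2 3 4 5 open_ball convex_ball)
  qed
  then show ?thesis using c'1 [OF k0] by blast
qed

text \<open>
  The strip on which homotopies live lacks its ends, where the paths run into the cusps. It is
  exhausted by compact rectangles, and the normalized lifts on these agree by uniqueness.
\<close>

lemma lifted_exists_strip:
  fixes h :: "real \<times> real \<Rightarrow> complex"
  assumes h: "continuous_on ({0..1} \<times> {0<..<1}) h" "h ` ({0..1} \<times> {0<..<1}) \<subseteq> Ycurve"
  shows "\<exists>\<Phi>. lifted \<Phi> h ({0..1} \<times> {0<..<1})"
proof -
  define K where "K = (\<lambda>n. {0..1 :: real} \<times> {1 / real (n + 3)..1 - 1 / real (n + 3)})"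
  let ?S = "{0..1 :: real} \<times> {0<..<1 :: real}"
  let ?k = "(0, 1/2) :: real \<times> real"
  have sub: "K n \<subseteq> ?S" for n
    by (auto simp: K_def) (smt (verit) divide_pos_pos of_nat_0_le_iff)+
  have mono: "K m \<subseteq> K n" if "m \<le> n" for m n
    using that by (auto simp: K_def frac_le) (smt (verit) frac_le of_nat_0_le_iff of_nat_mono)+
  have k: "?k \<in> K n" for n
    by (auto simp: K_def field_simps)
  have conv: "convex (K n)" and comp: "compact (K n)" for n
    by (auto simp: K_def intro!: convex_Times compact_Times)
  have "\<exists>\<Phi>. lifted \<Phi> h (K n) \<and> \<Phi> ?k = nc_one" for n
    using lifted_exists_compact [OF conv comp _ _ k] continuous_on_subset [OF h(1) sub] h(2) sub
    by (metis image_mono order_trans)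
  then obtain \<Phi> where \<Phi>: "\<And>n. lifted (\<Phi> n) h (K n)" "\<And>n. \<Phi> n ?k = nc_one" by metis
  have "\<Phi> m x = \<Phi> n x" if "x \<in> K m" "m \<le> n" for m n x
    using lifted_unique [OF convex_connected [OF conv] \<Phi>(1) lifted_subset [OF \<Phi>(1) mono [OF that(2)]] k _ that(1)] \<Phi>(2)
    by simp
  then have eq: "\<Phi> m x = \<Phi> n x" if "x \<in> K m" "x \<in> K n" for m n x
    using that by (metis nat_le_linear)
  define \<Phi>' where "\<Phi>' = (\<lambda>x. \<Phi> (SOME n. x \<in> K n) x)"
  have \<Phi>': "\<Phi>' x = \<Phi> n x" if "x \<in> K n" for x n
    unfolding \<Phi>'_def using that by (intro eq) (auto intro: someI)
  have "lifted \<Phi>' h ?S"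
  proof (rule lifted_local)
    fix x assume x: "x \<in> ?S"
    define d where "d = min (snd x) (1 - snd x)"
    have d: "d > 0" using x by (auto simp: d_def)
    then obtain n where n: "n > 0" "1 / real n < d"
      using real_arch_inverse [of d] by (auto simp: inverse_eq_divide)
    have "1 / real (n + 3) < 1 / real n" using n(1) by (simp add: frac_less2)
    then have nd: "1 / real (n + 3) < d" using n(2) by simp
    let ?N = "{0..1 :: real} \<times> {1 / real (n + 3)<..<1 - 1 / real (n + 3)}"
    have NK: "?N \<subseteq> K n" by (auto simp: K_def)
    have "?N = ?S \<inter> (UNIV \<times> {1 / real (n + 3)<..<1 - 1 / real (n + 3)})"
      using NK sub [of n] by auto
    then have "openin (top_of_set ?S) ?N"
      by (metis open_Times open_UNIV open_greaterThanLessThan openin_open)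
    moreover have "x \<in> ?N" using x nd by (auto simp: d_def)
    moreover have "lifted (\<Phi> n) h ?N" by (rule lifted_subset [OF \<Phi>(1) NK])
    ultimately show "\<exists>N \<Phi>'' h'. openin (top_of_set ?S) N \<and> x \<in> N \<and> lifted \<Phi>'' h' N \<and>
        (\<forall>y\<in>N. \<Phi>' y = \<Phi>'' y \<and> h y = h' y)"
      using \<Phi>' NK by (intro exI [of _ ?N] exI [of _ "\<Phi> n"] exI [of _ h]) blast
  qed
  then show ?thesis by blast
qed

section \<open>Regularized transport along a path\<close>

text \<open>
  Continuing the flat section of the final end \<open>f\<close> backwards along \<open>\<gamma>\<close> yields the section of the
  initial end \<open>e\<close> times \<open>S\<close>. For piecewise smooth paths this \<open>S\<close> is the regularized Chen series, but the
  notion makes sense for continuous ones; so it is invariant under the homotopies through continuous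
  paths that define the path classes.
\<close>

definition transports :: "endpt \<Rightarrow> endpt \<Rightarrow> (real \<Rightarrow> complex) \<Rightarrow> ncseries \<Rightarrow> bool" where
  "transports e f \<gamma> S \<longleftrightarrow> S [] = 1 \<and> (\<exists>\<Phi>. lifted \<Phi> \<gamma> {0<..<1} \<and>
     (\<forall>\<^sub>F t in at_right 0. \<gamma> t \<in> end_nbhd e \<and> \<Phi> t = end_section e (\<gamma> t) \<star> S) \<and>
     (\<forall>\<^sub>F t in at_right 0. \<gamma> (1 - t) \<in> end_nbhd f \<and> \<Phi> (1 - t) = end_section f (\<gamma> (1 - t))))"

text \<open>
  Two lifts that agree near the final end agree everywhere.
\<close>

lemma transports_unique:
  assumes ef: "proper_end e" and S: "transports e f \<gamma> S" "transports e f \<gamma> S'"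
  shows "S = S'"
proof -
  obtain \<Phi> where \<Phi>: "lifted \<Phi> \<gamma> {0<..<1}"
    "\<forall>\<^sub>F t in at_right 0. \<gamma> t \<in> end_nbhd e \<and> \<Phi> t = end_section e (\<gamma> t) \<star> S"
    "\<forall>\<^sub>F t in at_right 0. \<gamma> (1 - t) \<in> end_nbhd f \<and> \<Phi> (1 - t) = end_section f (\<gamma> (1 - t))"
    using S(1) unfolding transports_def by (elim exE conjE)
  obtain \<Phi>' where \<Phi>': "lifted \<Phi>' \<gamma> {0<..<1}"
    "\<forall>\<^sub>F t in at_right 0. \<gamma> t \<in> end_nbhd e \<and> \<Phi>' t = end_section e (\<gamma> t) \<star> S'"
    "\<forall>\<^sub>F t in at_right 0. \<gamma> (1 - t) \<in> end_nbhd f \<and> \<Phi>' (1 - t) = end_section f (\<gamma> (1 - t))"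
    using S(2) unfolding transports_def by (elim exE conjE)
  have I: "\<forall>\<^sub>F t in at_right 0. t \<in> {0<..<1 :: real}"
    by (rule eventually_at_right_real) simp
  have "\<forall>\<^sub>F t in at_right 0. t \<in> {0<..<1} \<and> \<Phi> (1 - t) = \<Phi>' (1 - t)"
    using I \<Phi>(3) \<Phi>'(3) by eventually_elim simp
  then obtain t where t: "t \<in> {0<..<1}" "\<Phi> (1 - t) = \<Phi>' (1 - t)"
    using eventually_happens' [OF trivial_limit_at_right_real] by blast
  have eq: "\<Phi> x = \<Phi>' x" if "x \<in> {0<..<1}" for x
    by (rule lifted_unique [OF _ \<Phi>(1) \<Phi>'(1) _ t(2) that]) (use t(1) in \<open>auto intro: connected_Ioo\<close>)
  have "\<forall>\<^sub>F t in at_right 0. \<gamma> t \<in> end_nbhd e \<and> end_section e (\<gamma> t) \<star> S = end_section e (\<gamma> t) \<star> S'"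
    using I \<Phi>(2) \<Phi>'(2)
  proof eventually_elim
    case (elim t)
    then show ?case using eq [of t] by metis
  qed
  then obtain t where t: "\<gamma> t \<in> end_nbhd e" "end_section e (\<gamma> t) \<star> S = end_section e (\<gamma> t) \<star> S'"
    using eventually_happens' [OF trivial_limit_at_right_real] by blast
  show ?thesis
    by (rule nc_mult_left_cancel [OF flat_on_Nil [OF flat_end_section [OF ef] t(1)] t(2)])
qed

lemma lifted_cong:
  assumes "lifted \<Phi> h K" "\<And>k. k \<in> K \<Longrightarrow> \<Phi> k = \<Phi>' k" "\<And>k. k \<in> K \<Longrightarrow> h k = h' k"
  shows "lifted \<Phi>' h' K"
proof (rule lifted_local)
  fix k assume "k \<in> K"
  then show "\<exists>N \<Phi>'' h''. openin (top_of_set K) N \<and> k \<in> N \<and> lifted \<Phi>'' h'' N \<and>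
      (\<forall>x\<in>N. \<Phi>' x = \<Phi>'' x \<and> h' x = h'' x)"
    using assms by (intro exI [of _ K] exI [of _ \<Phi>] exI [of _ h]) simp
qed

lemma path_homotopicE:
  assumes "path_homotopic e f \<gamma> \<gamma>'"
  obtains H :: "real \<times> real \<Rightarrow> complex" where "continuous_on ({0..1} \<times> {0<..<1}) H" "H ` ({0..1} \<times> {0<..<1}) \<subseteq> Ycurve"
    "\<forall>t\<in>{0<..<1}. H (0, t) = \<gamma> t \<and> H (1, t) = \<gamma>' t"
    "uniform_limit {0..1} (\<lambda>t s. rescaled e t (H (s, t))) (\<lambda>_. rescaled_lim e) (at_right 0)"
    "uniform_limit {0..1} (\<lambda>t s. rescaled f t (H (s, 1 - t))) (\<lambda>_. rescaled_lim f) (at_right 0)"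
  using assms unfolding path_homotopic_def by (elim exE conjE) (rule that, assumption+)

lemma uniform_end_nbhd:
  assumes d: "proper_end d"
    and lim: "uniform_limit {0..1} (\<lambda>t s. rescaled d t (G s t)) (\<lambda>_. rescaled_lim d) (at_right 0)"
  obtains a where "a > 0" "a < 1"
    "\<And>t s. 0 < t \<Longrightarrow> t < a \<Longrightarrow> s \<in> {0..1 :: real} \<Longrightarrow> G s t \<in> end_nbhd d"
proof -
  obtain \<eta> where \<eta>: "\<eta> > 0" "\<forall>t z. 0 < t \<longrightarrow> t < \<eta> \<longrightarrow> dist (rescaled d t z) (rescaled_lim d) < \<eta> \<longrightarrow> z \<in> end_nbhd d"
    using eventually_end_nbhd [OF d] by blast
  have "\<forall>\<^sub>F t in at_right 0. \<forall>s\<in>{0..1}. dist (rescaled d t (G s t)) (rescaled_lim d) < \<eta>"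
    by (rule uniform_limitD [OF lim \<eta>(1)])
  then obtain b where b: "b > 0"
    "\<And>t s. 0 < t \<Longrightarrow> t < b \<Longrightarrow> s \<in> {0..1} \<Longrightarrow> dist (rescaled d t (G s t)) (rescaled_lim d) < \<eta>"
    unfolding eventually_at_right_field by blast
  show ?thesis
    by (rule that [of "min (1/2) (min b \<eta>)"]) (use b \<eta> in auto)
qed

text \<open>
  The homotopy has a lift on the whole strip. Near either end the homotopy stays in the
  neighbourhood of that end, uniformly in its parameter \<open>s\<close>, so that the lift is there the section
  of the end times a constant independent of \<open>s\<close>. The two constants determine the transport along
  every path of the family.
\<close>

lemma homotopy_transport:
  assumes hom: "path_homotopic e f \<gamma> \<gamma>'" and ef: "proper_end e" "proper_end f"
  shows "\<exists>S. transports e f \<gamma> S \<and> transports e f \<gamma>' S"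
proof -
  obtain H :: "real \<times> real \<Rightarrow> complex" where H: "continuous_on ({0..1} \<times> {0<..<1}) H" "H ` ({0..1} \<times> {0<..<1}) \<subseteq> Ycurve"
    "\<forall>t\<in>{0<..<1}. H (0, t) = \<gamma> t \<and> H (1, t) = \<gamma>' t"
    "uniform_limit {0..1} (\<lambda>t s. rescaled e t (H (s, t))) (\<lambda>_. rescaled_lim e) (at_right 0)"
    "uniform_limit {0..1} (\<lambda>t s. rescaled f t (H (s, 1 - t))) (\<lambda>_. rescaled_lim f) (at_right 0)"
    by (rule path_homotopicE [OF hom])
  obtain \<Phi> where \<Phi>: "lifted \<Phi> H ({0..1} \<times> {0<..<1})"
    using lifted_exists_strip [OF H(1,2)] by blast
  \<comment> \<open>The tangency conditions are uniform in \<open>s\<close>, so the same \<open>a\<close> serves the whole family.\<close>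
  obtain a where a: "a > 0" "a < 1" "\<And>t s. 0 < t \<Longrightarrow> t < a \<Longrightarrow> s \<in> {0..1} \<Longrightarrow> H (s, t) \<in> end_nbhd e"
    using uniform_end_nbhd [OF ef(1) H(4)] by metis
  obtain b where b: "b > 0" "b < 1" "\<And>t s. 0 < t \<Longrightarrow> t < b \<Longrightarrow> s \<in> {0..1} \<Longrightarrow> H (s, 1 - t) \<in> end_nbhd f"
    using uniform_end_nbhd [OF ef(2) H(5)] by metis
  have lift_sec: "lifted (\<lambda>k. end_section d (H k)) H K" "lifted \<Phi> H K"
    if "K \<subseteq> {0..1} \<times> {0<..<1}" "H ` K \<subseteq> end_nbhd d" "proper_end d" for K d
    using lifted_flat [OF flat_end_section [OF that(3)] open_end_nbhd continuous_on_subset [OF H(1) that(1)] that(2)]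
      lifted_subset [OF \<Phi> that(1)] by simp_all
  let ?A = "{0..1 :: real} \<times> {0<..<a}" and ?B = "{0..1 :: real} \<times> {1 - b<..<1}"
  have con: "connected ?A" "connected ?B"
    by (auto intro!: connected_Times connected_Ioo connected_Icc)
  have A: "?A \<subseteq> {0..1} \<times> {0<..<1}" "H ` ?A \<subseteq> end_nbhd e" using a by auto
  have B: "?B \<subseteq> {0..1} \<times> {0<..<1}" using b by auto
  have B2: "H ` ?B \<subseteq> end_nbhd f"
  proof
    fix y assume "y \<in> H ` ?B"
    then obtain s t where "y = H (s, 1 - (1 - t))" "s \<in> {0..1}" "1 - b < t" "t < 1" by auto
    then show "y \<in> end_nbhd f" using b(3) [of "1 - t" s] by simp
  qed
  obtain C where C: "C [] = 1" "\<And>x. x \<in> ?A \<Longrightarrow> \<Phi> x = end_section e (H x) \<star> C"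
    using lifted_eq_mult_const [OF con(1) lift_sec(2) [OF A ef(1)] lift_sec(1) [OF A ef(1)]] by metis
  obtain D where D: "D [] = 1" "\<And>x. x \<in> ?B \<Longrightarrow> \<Phi> x = end_section f (H x) \<star> D"
    using lifted_eq_mult_const [OF con(2) lift_sec(2) [OF B B2 ef(2)] lift_sec(1) [OF B B2 ef(2)]] by metis
  have D1: "D \<star> nc_inv D = nc_one" using nc_mult_inv_right [of D, OF D(1)] .
  have "transports e f \<beta> (C \<star> nc_inv D)"
    if s: "s \<in> {0..1}" and \<beta>: "\<And>t. t \<in> {0<..<1} \<Longrightarrow> H (s, t) = \<beta> t" for s \<beta>
    unfolding transports_def
  proof (intro conjI exI [of _ "\<lambda>t. \<Phi> (s, t) \<star> nc_inv D"])
    show "(C \<star> nc_inv D) [] = 1" by (simp add: nc_mult_Nil C)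
    have "lifted (\<lambda>t. \<Phi> (s, t)) (\<lambda>t. H (s, t)) {0<..<1}"
      by (rule lifted_compose [OF \<Phi>]) (use s in \<open>auto intro!: continuous_intros\<close>)
    then have "lifted (\<lambda>t. \<Phi> (s, t)) \<beta> {0<..<1}"
      by (rule lifted_cong) (use \<beta> in auto)
    then show "lifted (\<lambda>t. \<Phi> (s, t) \<star> nc_inv D) \<beta> {0<..<1}"
      by (rule lifted_mult_const) simp
    have "\<forall>\<^sub>F t in at_right 0. t \<in> {0<..<a}"
      by (rule eventually_at_right_real) (rule a)
    then show "\<forall>\<^sub>F t in at_right 0. \<beta> t \<in> end_nbhd e \<and>
        \<Phi> (s, t) \<star> nc_inv D = end_section e (\<beta> t) \<star> (C \<star> nc_inv D)"
    proof eventually_elim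
      case (elim t)
      have "\<beta> t = H (s, t)" using \<beta> [of t] elim a by auto
      moreover have "(s, t) \<in> ?A" using elim s by auto
      ultimately show ?case using C(2) [of "(s, t)"] A(2) by (auto simp: nc_mult_assoc)
    qed
    have "\<forall>\<^sub>F t in at_right 0. t \<in> {0<..<b}"
      by (rule eventually_at_right_real) (rule b)
    then show "\<forall>\<^sub>F t in at_right 0. \<beta> (1 - t) \<in> end_nbhd f \<and>
        \<Phi> (s, 1 - t) \<star> nc_inv D = end_section f (\<beta> (1 - t))"
    proof eventually_elim
      case (elim t)
      have "\<beta> (1 - t) = H (s, 1 - t)" using \<beta> [of "1 - t"] elim b by auto
      moreover have "(s, 1 - t) \<in> ?B" using elim s by auto
      ultimately show ?case using D(2) [of "(s, 1 - t)"] B2 by (auto simp: nc_mult_assoc D1)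
    qed
  qed
  from this [of 0 \<gamma>] this [of 1 \<gamma>'] show ?thesis using H(3) by auto
qed

subsection \<open>Transport and Chen series\<close>

lemma lifted_continuous:
  assumes \<Phi>: "lifted \<Phi> h K" and h: "continuous_on K h"
  shows "continuous_on K (\<lambda>k. \<Phi> k w)"
  unfolding continuous_on_def
proof
  fix k assume k: "k \<in> K"
  obtain N V \<Psi> where N: "openin (top_of_set K) N" "k \<in> N" "open V" "convex V"
    "flat_on V \<Psi>" "h ` N \<subseteq> V" "\<forall>x\<in>N. \<Phi> x = \<Psi> (h x)"
    by (rule liftedE [OF \<Phi> k])
  obtain T where T: "open T" "N = K \<inter> T" using N(1) by (auto simp: openin_open)
  have "isCont (\<lambda>z. \<Psi> z w) (h k)"
    by (rule DERIV_isCont [OF flat_on_has_derivative [OF N(5,3)]]) (use N in auto)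
  moreover have "(h \<longlongrightarrow> h k) (at k within K)" using h k by (simp add: continuous_on_def)
  ultimately have "((\<lambda>x. \<Psi> (h x) w) \<longlongrightarrow> \<Psi> (h k) w) (at k within K)"
    by (rule isCont_tendsto_compose)
  moreover have "\<forall>\<^sub>F x in at k within K. \<Psi> (h x) w = \<Phi> x w"
    using eventually_at_topological [of _ k K] T N(2,7)
    by (auto intro!: exI [of _ T])
  ultimately have "((\<lambda>x. \<Phi> x w) \<longlongrightarrow> \<Psi> (h k) w) (at k within K)"
    by (rule Lim_transform_eventually)
  then show "((\<lambda>x. \<Phi> x w) \<longlongrightarrow> \<Phi> k w) (at k within K)"
    using N(2,7) by simp
qed

lemma lifted_has_vector_derivative:
  assumes \<Phi>: "lifted \<Phi> \<gamma> {a..b}" and t: "t \<in> {a<..<b}"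
    and \<gamma>: "(\<gamma> has_vector_derivative \<gamma>') (at t)"
  shows "((\<lambda>t. \<Phi> t (i # w)) has_vector_derivative - (form_coeff i (\<gamma> t) * \<gamma>' * \<Phi> t w)) (at t)"
proof -
  have "t \<in> {a..b}" using t by auto
  obtain N V \<Psi> where N: "openin (top_of_set {a..b}) N" "t \<in> N" "open V" "convex V"
    "flat_on V \<Psi>" "\<gamma> ` N \<subseteq> V" "\<forall>x\<in>N. \<Phi> x = \<Psi> (\<gamma> x)"
    by (rule liftedE [OF \<Phi> \<open>t \<in> {a..b}\<close>])
  obtain T where T: "open T" "N = {a..b} \<inter> T" using N(1) by (auto simp: openin_open)
  have "((\<lambda>z. \<Psi> z (i # w)) has_field_derivative - form_coeff i (\<gamma> t) * \<Psi> (\<gamma> t) w) (at (\<gamma> t))"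
    using flat_on_Cons [OF N(5)] N(2,6) by auto
  from field_vector_diff_chain_at [OF \<gamma> this]
  have "((\<lambda>t. \<Psi> (\<gamma> t) (i # w)) has_vector_derivative \<gamma>' * (- form_coeff i (\<gamma> t) * \<Psi> (\<gamma> t) w)) (at t)"
    by (simp add: o_def)
  then have "((\<lambda>t. \<Phi> t (i # w)) has_vector_derivative \<gamma>' * (- form_coeff i (\<gamma> t) * \<Psi> (\<gamma> t) w)) (at t)"
    by (rule has_vector_derivative_transform_within_open [where S = "{a<..<b} \<inter> T"])
      (use T t N in auto)
  moreover have "\<Psi> (\<gamma> t) w = \<Phi> t w" using N(2,7) by simp
  ultimately show ?thesis by (simp add: mult_ac)
qed

text \<open>
  By the fundamental theorem of calculus the coefficients of a lift satisfy the recursion that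
  defines the iterated integrals; finitely many corners of the path do no harm.
\<close>

lemma chen_coeff_lifted:
  assumes \<gamma>: "\<gamma> piecewise_C1_differentiable_on {a..b}"
    and \<Phi>: "lifted \<Phi> \<gamma> {a..b}" "\<Phi> b = nc_one" and ab: "a \<le> b"
  shows "t \<in> {a..b} \<Longrightarrow> chen_coeff \<gamma> b w t = \<Phi> t w"
proof (induction w arbitrary: t)
  case Nil
  then show ?case using lifted_Nil [OF \<Phi>(1)] by simp
next
  case (Cons i w)
  obtain S where S: "finite S" "\<gamma> C1_differentiable_on {a..b} - S" and cont: "continuous_on {a..b} \<gamma>"
    using \<gamma> unfolding piecewise_C1_differentiable_on_def by blast
  have "((\<lambda>s. - (form_coeff i (\<gamma> s) * vector_derivative \<gamma> (at s) * \<Phi> s w)) has_integral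
      (\<Phi> b (i # w) - \<Phi> t (i # w))) {t..b}"
  proof (rule fundamental_theorem_of_calculus_interior_strong [OF S(1)])
    show "t \<le> b" using Cons by simp
    show "continuous_on {t..b} (\<lambda>s. \<Phi> s (i # w))"
      by (rule continuous_on_subset [OF lifted_continuous [OF \<Phi>(1) cont]]) (use Cons in auto)
    fix s assume s: "s \<in> {t<..<b} - S"
    then have "\<gamma> differentiable at s"
      using S(2) Cons by (auto simp: C1_differentiable_on_eq)
    then have "(\<gamma> has_vector_derivative vector_derivative \<gamma> (at s)) (at s)"
      by (simp add: vector_derivative_works)
    then show "((\<lambda>s. \<Phi> s (i # w)) has_vector_derivative
        - (form_coeff i (\<gamma> s) * vector_derivative \<gamma> (at s) * \<Phi> s w)) (at s)"
      by (rule lifted_has_vector_derivative [OF \<Phi>(1), rotated]) (use s Cons in auto)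
  qed
  then have "((\<lambda>s. form_coeff i (\<gamma> s) * vector_derivative \<gamma> (at s) * \<Phi> s w) has_integral \<Phi> t (i # w)) {t..b}"
    by (drule_tac has_integral_neg) (simp add: \<Phi>(2) nc_one_def)
  then have "integral {t..b} (\<lambda>s. form_coeff i (\<gamma> s) * vector_derivative \<gamma> (at s) * \<Phi> s w) = \<Phi> t (i # w)"
    by (rule integral_unique)
  moreover have "integral {t..b} (\<lambda>s. form_coeff i (\<gamma> s) * vector_derivative \<gamma> (at s) * chen_coeff \<gamma> b w s)
      = integral {t..b} (\<lambda>s. form_coeff i (\<gamma> s) * vector_derivative \<gamma> (at s) * \<Phi> s w)"
    by (rule integral_cong) (use Cons in auto)
  ultimately show ?case by simp
qed

lemma chen_series_lifted:
  assumes \<gamma>: "\<gamma> piecewise_C1_differentiable_on {a..b}"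
    and \<Phi>: "lifted \<Phi> \<gamma> {a..b}" and ab: "a \<le> b"
  shows "chen_series \<gamma> a b = \<Phi> a \<star> nc_inv (\<Phi> b)"
proof
  fix w
  have "lifted (\<lambda>t. \<Phi> t \<star> nc_inv (\<Phi> b)) \<gamma> {a..b}"
    by (rule lifted_mult_const [OF \<Phi>]) simp
  moreover have "\<Phi> b \<star> nc_inv (\<Phi> b) = nc_one"
    by (rule nc_mult_inv_right [of "\<Phi> b"], rule lifted_Nil [OF \<Phi>]) (use ab in simp)
  ultimately show "chen_series \<gamma> a b w = (\<Phi> a \<star> nc_inv (\<Phi> b)) w"
    unfolding chen_series_def by (intro chen_coeff_lifted [OF \<gamma>, where t = a]) (use ab in auto)
qed

lemma nc_inv_one: "nc_inv nc_one = nc_one"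
  by (rule nc_inv_unique [symmetric]) (simp_all add: nc_one_def [of "[]"])

text \<open>
  At an ordinary end the encoding prescribes a limit only, which is the value by continuity.
\<close>

lemma is_path_at_end:
  assumes "is_path (Tang a b) (Pt p) \<gamma>"
  shows "\<gamma> 1 = p"
proof -
  have "\<gamma> piecewise_C1_differentiable_on {1/3..1}"
    using assms [unfolded is_path_def] by (auto simp: trunc_hi_def elim!: allE [of _ "1/3"])
  then have "(\<gamma> \<longlongrightarrow> \<gamma> 1) (at 1 within {1/3..1})"
    by (simp add: piecewise_C1_differentiable_on_def continuous_on_def)
  then have "(\<gamma> \<longlongrightarrow> \<gamma> 1) (at_left 1)"
    by (simp add: at_within_Icc_at_left)
  moreover have "filterlim (\<lambda>t. 1 - t) (at_left 1) (at_right (0 :: real))"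
    unfolding filterlim_at by (auto intro!: tendsto_eq_intros eventually_mono [OF eventually_at_right_less])
  ultimately have "((\<lambda>t. \<gamma> (1 - t)) \<longlongrightarrow> \<gamma> 1) (at_right 0)"
    by (rule filterlim_compose)
  moreover have "((\<lambda>t. \<gamma> (1 - t)) \<longlongrightarrow> p) (at_right 0)"
    using assms by (simp add: is_path_def)
  ultimately show ?thesis
    using tendsto_unique [OF trivial_limit_at_right_real] by blast
qed

text \<open>
  If \<open>\<Phi>\<close> is the lift, then the truncated Chen series is \<open>\<Phi>(\<epsilon>)\<close> times the inverse of \<open>\<Phi>(1 - \<epsilon>)\<close>.
  Near the ends \<open>\<Phi>\<close> is given by the end sections, and these tend to 1 after multiplication with the
  regularizing factors. What remains in the limit is \<open>S\<close>.
\<close>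

lemma transports_has_chen_series:
  assumes path: "is_path (Tang a b) f \<gamma>" and S: "transports (Tang a b) f \<gamma> S"
  shows "has_chen_series (Tang a b) f \<gamma> S"
proof -
  let ?e = "Tang a b"
  have ef: "proper_end ?e" "proper_end f"
    and pC1: "\<And>\<epsilon>. 0 < \<epsilon> \<Longrightarrow> \<epsilon> < 1/2 \<Longrightarrow> \<gamma> piecewise_C1_differentiable_on {\<epsilon>..trunc_hi f \<epsilon>}"
    and lim: "((\<lambda>t. rescaled ?e t (\<gamma> t)) \<longlongrightarrow> rescaled_lim ?e) (at_right 0)"
      "((\<lambda>t. rescaled f t (\<gamma> (1 - t))) \<longlongrightarrow> rescaled_lim f) (at_right 0)"
    using path unfolding is_path_def by simp_all
  obtain \<Phi> where \<Phi>: "lifted \<Phi> \<gamma> {0<..<1}"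
    "\<forall>\<^sub>F t in at_right 0. \<gamma> t \<in> end_nbhd ?e \<and> \<Phi> t = end_section ?e (\<gamma> t) \<star> S"
    "\<forall>\<^sub>F t in at_right 0. \<gamma> (1 - t) \<in> end_nbhd f \<and> \<Phi> (1 - t) = end_section f (\<gamma> (1 - t))"
    using S unfolding transports_def by (elim exE conjE)
  have half: "\<forall>\<^sub>F \<epsilon> in at_right 0. \<epsilon> \<in> {0<..<1/2 :: real}"
    by (rule eventually_at_right_real) simp
  have start: "((\<lambda>\<epsilon>. (reg_factor ?e (of_real (ln \<epsilon>)) \<star> end_section ?e (\<gamma> \<epsilon>)) w) \<longlongrightarrow> nc_one w) (at_right 0)" for w
    by (rule end_section_tendsto [OF ef(1) lim(1)])
  show ?thesis
  proof (cases f)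
    case (Tang c d)
    have "((\<lambda>\<epsilon>. (reg_factor f (of_real (ln \<epsilon>)) \<star> end_section f (\<gamma> (1 - \<epsilon>))) w) \<longlongrightarrow> nc_one w) (at_right 0)" for w
      by (rule end_section_tendsto [OF ef(2) lim(2)])
    then have L: "((\<lambda>\<epsilon>. (reg_factor ?e (of_real (ln \<epsilon>)) \<star> end_section ?e (\<gamma> \<epsilon>) \<star> S \<star>
        nc_inv (reg_factor f (of_real (ln \<epsilon>)) \<star> end_section f (\<gamma> (1 - \<epsilon>)))) w)
        \<longlongrightarrow> (nc_one \<star> S \<star> nc_inv nc_one) w) (at_right 0)" for w
      by (intro nc_mult_tendsto nc_inv_tendsto tendsto_const start)
    have ev: "\<forall>\<^sub>F \<epsilon> in at_right 0. reg_factor ?e (of_real (ln \<epsilon>)) \<star> end_section ?e (\<gamma> \<epsilon>) \<star> S \<star>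
        nc_inv (reg_factor f (of_real (ln \<epsilon>)) \<star> end_section f (\<gamma> (1 - \<epsilon>))) =
        reg_factor ?e (of_real (ln \<epsilon>)) \<star> chen_series \<gamma> (trunc_lo ?e \<epsilon>) (trunc_hi f \<epsilon>) \<star>
        reg_factor f (- of_real (ln \<epsilon>))"
      using half \<Phi>(2,3)
    proof eventually_elim
      case (elim \<epsilon>)
      let ?x = "complex_of_real (ln \<epsilon>)" and ?T = "end_section f (\<gamma> (1 - \<epsilon>))"
      have hi: "trunc_hi f \<epsilon> = 1 - \<epsilon>" by (simp add: Tang trunc_hi_def)
      have "lifted \<Phi> \<gamma> {\<epsilon>..1 - \<epsilon>}"
        by (rule lifted_subset [OF \<Phi>(1)]) (use elim in auto)
      then have c: "chen_series \<gamma> \<epsilon> (1 - \<epsilon>) = end_section ?e (\<gamma> \<epsilon>) \<star> S \<star> nc_inv ?T"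
        using chen_series_lifted [of \<gamma> \<epsilon> "1 - \<epsilon>" \<Phi>] pC1 [of \<epsilon>] elim by (simp add: hi)
      have T1: "?T [] = 1" by (rule flat_on_Nil [OF flat_end_section [OF ef(2)]]) (use elim in simp)
      have "(reg_factor f ?x \<star> ?T) \<star> (nc_inv ?T \<star> reg_factor f (- ?x)) =
          reg_factor f ?x \<star> (?T \<star> nc_inv ?T) \<star> reg_factor f (- ?x)"
        by (simp only: nc_mult_assoc)
      also have "\<dots> = nc_one"
        by (simp only: nc_mult_inv_right [of ?T, OF T1] nc_mult_one_right reg_factor_minus)
      finally have "nc_inv ?T \<star> reg_factor f (- ?x) = nc_inv (reg_factor f ?x \<star> ?T)"
        by (intro nc_inv_unique) (simp_all add: nc_mult_Nil reg_factor_Nil T1)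
      then show ?case by (simp add: hi c nc_mult_assoc)
    qed
    show ?thesis
      unfolding has_chen_series_def
    proof
      fix w
      show "((\<lambda>\<epsilon>. (reg_factor ?e (of_real (ln \<epsilon>)) \<star> chen_series \<gamma> (trunc_lo ?e \<epsilon>) (trunc_hi f \<epsilon>) \<star>
          reg_factor f (- of_real (ln \<epsilon>))) w) \<longlongrightarrow> S w) (at_right 0)"
        using Lim_transform_eventually [OF L [of w] eventually_mono [OF ev]] by (simp add: nc_inv_one)
    qed
  next
    case (Pt p)
    have hi: "trunc_hi f \<epsilon> = 1" for \<epsilon> by (simp add: Pt trunc_hi_def)
    have contI: "continuous_on {\<epsilon>..1} \<gamma>" if "0 < \<epsilon>" "\<epsilon> < 1/2" for \<epsilon>
      using pC1 [OF that] by (simp add: hi piecewise_C1_differentiable_on_def)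
    have \<gamma>1: "\<gamma> 1 = p" by (rule is_path_at_end [OF path [unfolded Pt]])
    have pY: "p \<in> Ycurve" using ef(2) by (simp add: Pt)
    have pU: "p \<in> end_nbhd f" using pY by (simp add: Pt Ycurve_def)
    obtain b where b: "b > 0" "\<And>t. 0 < t \<Longrightarrow> t < b \<Longrightarrow> \<gamma> (1 - t) \<in> end_nbhd f \<and> \<Phi> (1 - t) = end_section f (\<gamma> (1 - t))"
      using \<Phi>(3) unfolding eventually_at_right_field by blast
    \<comment> \<open>The lift is only known on the open interval; at the end it is continued by the section of \<open>p\<close>.\<close>
    define \<Phi>' where "\<Phi>' = \<Phi>(1 := nc_one)"
    have L: "lifted \<Phi>' \<gamma> {0<..1}"
    proof (rule lifted_local)
      fix t :: real assume t: "t \<in> {0<..1}"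
      show "\<exists>N \<Phi>'' h'. openin (top_of_set {0<..1}) N \<and> t \<in> N \<and> lifted \<Phi>'' h' N \<and>
          (\<forall>x\<in>N. \<Phi>' x = \<Phi>'' x \<and> \<gamma> x = h' x)"
      proof (cases "t = 1")
        case False
        have "openin (top_of_set {0<..1}) ({0<..1} \<inter> {..<1 :: real})"
          by (simp add: openin_open_Int)
        moreover have "{0<..1} \<inter> {..<1 :: real} = {0<..<1}" by auto
        ultimately show ?thesis
          using t False \<Phi>(1) by (intro exI [of _ "{0<..<1}"] exI [of _ \<Phi>] exI [of _ \<gamma>]) (auto simp: \<Phi>'_def)
      next
        case True
        define m where "m = max (2/3) (1 - b)"
        have op: "openin (top_of_set {0<..1}) ({0<..1} \<inter> {m<..})"
          by (simp add: openin_open_Int)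
        have eq: "{0<..1} \<inter> {m<..} = {m<..1}" by (auto simp: m_def)
        have c: "continuous_on {m<..1} \<gamma>"
          by (rule continuous_on_subset [OF contI [of "1/3"]]) (auto simp: m_def)
        have U: "\<gamma> x \<in> end_nbhd f \<and> \<Phi>' x = end_section f (\<gamma> x)" if "x \<in> {m<..1}" for x
        proof (cases "x = 1")
          case True
          then show ?thesis using pU \<gamma>1 end_section_Pt [OF pY] by (simp add: \<Phi>'_def Pt)
        next
          case False
          then show ?thesis using b(2) [of "1 - x"] that by (simp add: \<Phi>'_def m_def)
        qed
        have "lifted (\<lambda>t. end_section f (\<gamma> t)) \<gamma> {m<..1}"
          by (rule lifted_flat [OF flat_end_section [OF ef(2)] open_end_nbhd c]) (use U in auto)
        then show ?thesis
          using op U True b(1) unfolding eq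
          by (intro exI [of _ "{m<..1}"] exI [of _ "\<lambda>t. end_section f (\<gamma> t)"] exI [of _ \<gamma>]) (auto simp: m_def)
      qed
    qed
    have Lim: "((\<lambda>\<epsilon>. (reg_factor ?e (of_real (ln \<epsilon>)) \<star> end_section ?e (\<gamma> \<epsilon>) \<star> S) w)
        \<longlongrightarrow> (nc_one \<star> S) w) (at_right 0)" for w
      by (intro nc_mult_tendsto tendsto_const start)
    have ev: "\<forall>\<^sub>F \<epsilon> in at_right 0. reg_factor ?e (of_real (ln \<epsilon>)) \<star> end_section ?e (\<gamma> \<epsilon>) \<star> S =
        reg_factor ?e (of_real (ln \<epsilon>)) \<star> chen_series \<gamma> (trunc_lo ?e \<epsilon>) (trunc_hi f \<epsilon>) \<star>
        reg_factor f (- of_real (ln \<epsilon>))"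
      using half \<Phi>(2)
    proof eventually_elim
      case (elim \<epsilon>)
      have "lifted \<Phi>' \<gamma> {\<epsilon>..1}"
        by (rule lifted_subset [OF L]) (use elim in auto)
      then have "chen_series \<gamma> \<epsilon> 1 = end_section ?e (\<gamma> \<epsilon>) \<star> S"
        using chen_series_lifted [of \<gamma> \<epsilon> 1 \<Phi>'] pC1 [of \<epsilon>] elim by (simp add: hi \<Phi>'_def nc_inv_one)
      then show ?case by (simp add: hi [unfolded Pt] Pt nc_mult_assoc)
    qed
    show ?thesis
      unfolding has_chen_series_def
    proof
      fix w
      show "((\<lambda>\<epsilon>. (reg_factor ?e (of_real (ln \<epsilon>)) \<star> chen_series \<gamma> (trunc_lo ?e \<epsilon>) (trunc_hi f \<epsilon>) \<star>
          reg_factor f (- of_real (ln \<epsilon>))) w) \<longlongrightarrow> S w) (at_right 0)"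
        using Lim_transform_eventually [OF Lim [of w] eventually_mono [OF ev]] by simp
    qed
  qed
qed

section \<open>Homotopies and concatenation\<close>

lemma uniform_limit_const_family:
  assumes "((\<lambda>t. f t) \<longlongrightarrow> l) F"
  shows "uniform_limit S (\<lambda>t s. f t) (\<lambda>_. l) F"
  unfolding uniform_limit_iff
proof (intro allI impI)
  fix \<eta> :: real assume "\<eta> > 0"
  from tendstoD [OF assms this] show "\<forall>\<^sub>F t in F. \<forall>s\<in>S. dist (f t) l < \<eta>"
    by (rule eventually_mono) simp
qed

lemma path_homotopic_refl:
  assumes "continuous_on {0<..<1} \<gamma>" "\<gamma> ` {0<..<1} \<subseteq> Ycurve"
    "((\<lambda>t. rescaled e t (\<gamma> t)) \<longlongrightarrow> rescaled_lim e) (at_right 0)"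
    "((\<lambda>t. rescaled f t (\<gamma> (1 - t))) \<longlongrightarrow> rescaled_lim f) (at_right 0)"
  shows "path_homotopic e f \<gamma> \<gamma>"
  unfolding path_homotopic_def
proof (intro exI [of _ "\<lambda>x. \<gamma> (snd x)"] conjI)
  show "continuous_on ({0..1} \<times> {0<..<1}) (\<lambda>x :: real \<times> real. \<gamma> (snd x))"
    by (rule continuous_on_compose2 [OF assms(1)]) (auto intro!: continuous_intros)
qed (use assms in \<open>auto intro!: uniform_limit_const_family\<close>)

lemma is_path_continuous:
  assumes "is_path e f \<gamma>"
  shows "continuous_on {0<..<1} \<gamma>"
proof (intro continuous_at_imp_continuous_on ballI)
  fix t :: real assume t: "t \<in> {0<..<1}"
  define \<epsilon> where "\<epsilon> = min t (1 - t) / 2"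
  have \<epsilon>: "0 < \<epsilon>" "\<epsilon> < 1/2" "t \<in> {\<epsilon><..<1 - \<epsilon>}" using t by (auto simp: \<epsilon>_def min_def field_simps)
  have "\<gamma> piecewise_C1_differentiable_on {trunc_lo e \<epsilon>..trunc_hi f \<epsilon>}"
    using assms \<epsilon>(1,2) unfolding is_path_def by blast
  then have "continuous_on {trunc_lo e \<epsilon>..trunc_hi f \<epsilon>} \<gamma>"
    by (simp add: piecewise_C1_differentiable_on_def)
  moreover have "{\<epsilon><..<1 - \<epsilon>} \<subseteq> {trunc_lo e \<epsilon>..trunc_hi f \<epsilon>}"
    using \<epsilon>(1) unfolding trunc_hi_def by (cases e; cases f) auto
  ultimately have "continuous_on {\<epsilon><..<1 - \<epsilon>} \<gamma>"
    by (rule continuous_on_subset)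
  then show "isCont \<gamma> t"
    using \<epsilon>(3) continuous_on_eq_continuous_at open_greaterThanLessThan by blast
qed

lemma is_path_homotopic_refl: "is_path e f \<gamma> \<Longrightarrow> path_homotopic e f \<gamma> \<gamma>"
  using is_path_continuous [of e f \<gamma>] unfolding is_path_def by (intro path_homotopic_refl) blast+

lemma path_homotopic_left:
  assumes "path_homotopic e f \<gamma> \<gamma>'"
  shows "continuous_on {0<..<1} \<gamma>" "\<gamma> ` {0<..<1} \<subseteq> Ycurve"
    "((\<lambda>t. rescaled e t (\<gamma> t)) \<longlongrightarrow> rescaled_lim e) (at_right 0)"
    "((\<lambda>t. rescaled f t (\<gamma> (1 - t))) \<longlongrightarrow> rescaled_lim f) (at_right 0)"
proof -
  obtain H :: "real \<times> real \<Rightarrow> complex" where H: "continuous_on ({0..1} \<times> {0<..<1}) H" "H ` ({0..1} \<times> {0<..<1}) \<subseteq> Ycurve"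
    "\<forall>t\<in>{0<..<1}. H (0, t) = \<gamma> t \<and> H (1, t) = \<gamma>' t"
    "uniform_limit {0..1} (\<lambda>t s. rescaled e t (H (s, t))) (\<lambda>_. rescaled_lim e) (at_right 0)"
    "uniform_limit {0..1} (\<lambda>t s. rescaled f t (H (s, 1 - t))) (\<lambda>_. rescaled_lim f) (at_right 0)"
    by (rule path_homotopicE [OF assms])
  have "continuous_on {0<..<1} (\<lambda>t. H (0, t))"
    by (rule continuous_on_compose2 [OF H(1)]) (auto intro!: continuous_intros)
  then show "continuous_on {0<..<1} \<gamma>"
    by (rule continuous_on_eq) (use H(3) in auto)
  show "\<gamma> ` {0<..<1} \<subseteq> Ycurve"
  proof
    fix y assume "y \<in> \<gamma> ` {0<..<1}"
    then obtain t where "t \<in> {0<..<1}" "y = H (0, t)" using H(3) by auto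
    then show "y \<in> Ycurve" using H(2) by auto
  qed
  have I: "\<forall>\<^sub>F t in at_right 0. t \<in> {0<..<1 :: real}"
    by (rule eventually_at_right_real) simp
  have "((\<lambda>t. rescaled e t (H (0, t))) \<longlongrightarrow> rescaled_lim e) (at_right 0)"
    by (rule tendsto_uniform_limitI [OF H(4)]) simp
  moreover have "\<forall>\<^sub>F t in at_right 0. rescaled e t (H (0, t)) = rescaled e t (\<gamma> t)"
    using I by eventually_elim (use H(3) in simp)
  ultimately show "((\<lambda>t. rescaled e t (\<gamma> t)) \<longlongrightarrow> rescaled_lim e) (at_right 0)"
    by (rule Lim_transform_eventually)
  have "((\<lambda>t. rescaled f t (H (0, 1 - t))) \<longlongrightarrow> rescaled_lim f) (at_right 0)"
    by (rule tendsto_uniform_limitI [OF H(5)]) simp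
  moreover have "\<forall>\<^sub>F t in at_right 0. rescaled f t (H (0, 1 - t)) = rescaled f t (\<gamma> (1 - t))"
    using I by eventually_elim (use H(3) in simp)
  ultimately show "((\<lambda>t. rescaled f t (\<gamma> (1 - t))) \<longlongrightarrow> rescaled_lim f) (at_right 0)"
    by (rule Lim_transform_eventually)
qed

lemma path_homotopic_sym:
  assumes "path_homotopic e f \<gamma> \<gamma>'"
  shows "path_homotopic e f \<gamma>' \<gamma>"
proof -
  obtain H :: "real \<times> real \<Rightarrow> complex" where H: "continuous_on ({0..1} \<times> {0<..<1}) H" "H ` ({0..1} \<times> {0<..<1}) \<subseteq> Ycurve"
    "\<forall>t\<in>{0<..<1}. H (0, t) = \<gamma> t \<and> H (1, t) = \<gamma>' t"
    "uniform_limit {0..1} (\<lambda>t s. rescaled e t (H (s, t))) (\<lambda>_. rescaled_lim e) (at_right 0)"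
    "uniform_limit {0..1} (\<lambda>t s. rescaled f t (H (s, 1 - t))) (\<lambda>_. rescaled_lim f) (at_right 0)"
    by (rule path_homotopicE [OF assms])
  let ?G = "\<lambda>x. H (1 - fst x, snd x)"
  have "continuous_on ({0..1} \<times> {0<..<1}) ?G"
    by (rule continuous_on_compose2 [OF H(1)]) (auto intro!: continuous_intros)
  moreover have "?G ` ({0..1} \<times> {0<..<1}) \<subseteq> Ycurve"
    using H(2) by (force simp: image_subset_iff)
  moreover have "uniform_limit {0..1} (\<lambda>t s. rescaled e t (?G (s, t))) (\<lambda>_. rescaled_lim e) (at_right 0)"
    unfolding uniform_limit_iff
  proof (intro allI impI)
    fix \<eta> :: real assume "\<eta> > 0"
    from uniform_limitD [OF H(4) this]
    show "\<forall>\<^sub>F t in at_right 0. \<forall>s\<in>{0..1}. dist (rescaled e t (?G (s, t))) (rescaled_lim e) < \<eta>"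
      by eventually_elim auto
  qed
  moreover have "uniform_limit {0..1} (\<lambda>t s. rescaled f t (?G (s, 1 - t))) (\<lambda>_. rescaled_lim f) (at_right 0)"
    unfolding uniform_limit_iff
  proof (intro allI impI)
    fix \<eta> :: real assume "\<eta> > 0"
    from uniform_limitD [OF H(5) this]
    show "\<forall>\<^sub>F t in at_right 0. \<forall>s\<in>{0..1}. dist (rescaled f t (?G (s, 1 - t))) (rescaled_lim f) < \<eta>"
      by eventually_elim auto
  qed
  moreover have "\<forall>t\<in>{0<..<1}. ?G (0, t) = \<gamma>' t \<and> ?G (1, t) = \<gamma> t" using H(3) by simp
  ultimately show ?thesis
    unfolding path_homotopic_def by (intro exI [of _ ?G] conjI)
qed

lemma path_homotopic_trans:
  assumes "path_homotopic e f \<gamma> \<gamma>'" "path_homotopic e f \<gamma>' \<gamma>''"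
  shows "path_homotopic e f \<gamma> \<gamma>''"
proof -
  obtain H :: "real \<times> real \<Rightarrow> complex" where H: "continuous_on ({0..1} \<times> {0<..<1}) H" "H ` ({0..1} \<times> {0<..<1}) \<subseteq> Ycurve"
    "\<forall>t\<in>{0<..<1}. H (0, t) = \<gamma> t \<and> H (1, t) = \<gamma>' t"
    "uniform_limit {0..1} (\<lambda>t s. rescaled e t (H (s, t))) (\<lambda>_. rescaled_lim e) (at_right 0)"
    "uniform_limit {0..1} (\<lambda>t s. rescaled f t (H (s, 1 - t))) (\<lambda>_. rescaled_lim f) (at_right 0)"
    by (rule path_homotopicE [OF assms(1)])
  obtain G :: "real \<times> real \<Rightarrow> complex" where G: "continuous_on ({0..1} \<times> {0<..<1}) G" "G ` ({0..1} \<times> {0<..<1}) \<subseteq> Ycurve"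
    "\<forall>t\<in>{0<..<1}. G (0, t) = \<gamma>' t \<and> G (1, t) = \<gamma>'' t"
    "uniform_limit {0..1} (\<lambda>t s. rescaled e t (G (s, t))) (\<lambda>_. rescaled_lim e) (at_right 0)"
    "uniform_limit {0..1} (\<lambda>t s. rescaled f t (G (s, 1 - t))) (\<lambda>_. rescaled_lim f) (at_right 0)"
    by (rule path_homotopicE [OF assms(2)])
  let ?K = "\<lambda>x. if fst x \<le> 1/2 then H (2 * fst x, snd x) else G (2 * fst x - 1, snd x)"
  have "continuous_on ({0..1} \<times> {0<..<1}) ?K"
  proof (rule continuous_on_cases_le)
    show "continuous_on {x \<in> {0..1} \<times> {0<..<1}. fst x \<le> 1/2} (\<lambda>x. H (2 * fst x, snd x))"
      by (rule continuous_on_compose2 [OF H(1)]) (auto intro!: continuous_intros)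
    show "continuous_on {x \<in> {0..1} \<times> {0<..<1}. 1/2 \<le> fst x} (\<lambda>x. G (2 * fst x - 1, snd x))"
      by (rule continuous_on_compose2 [OF G(1)]) (auto intro!: continuous_intros)
    fix x :: "real \<times> real" assume "x \<in> {0..1} \<times> {0<..<1}" "fst x = 1/2"
    then have "2 * fst x = 1" "snd x \<in> {0<..<1}" by auto
    then show "H (2 * fst x, snd x) = G (2 * fst x - 1, snd x)" using H(3) G(3) by simp
  qed (auto intro!: continuous_intros)
  moreover have "?K ` ({0..1} \<times> {0<..<1}) \<subseteq> Ycurve"
  proof
    fix y assume "y \<in> ?K ` ({0..1} \<times> {0<..<1})"
    then obtain x where x: "y = ?K x" "x \<in> {0..1} \<times> {0<..<1}" by (rule imageE)
    obtain s t where "x = (s, t)" by (cases x)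
    with x have st: "s \<in> {0..1}" "t \<in> {0<..<1}" "y = ?K (s, t)" by simp_all
    show "y \<in> Ycurve"
    proof (cases "s \<le> 1/2")
      case True
      then have "(2 * s, t) \<in> {0..1} \<times> {0<..<1}" using st by auto
      then show ?thesis using H(2) st True by auto
    next
      case False
      then have "(2 * s - 1, t) \<in> {0..1} \<times> {0<..<1}" using st by auto
      then show ?thesis using G(2) st False by auto
    qed
  qed
  moreover have "uniform_limit {0..1} (\<lambda>t s. rescaled e t (?K (s, t))) (\<lambda>_. rescaled_lim e) (at_right 0)"
    unfolding uniform_limit_iff
  proof (intro allI impI)
    fix \<eta> :: real assume "\<eta> > 0"
    from uniform_limitD [OF H(4) this] uniform_limitD [OF G(4) this]
    show "\<forall>\<^sub>F t in at_right 0. \<forall>s\<in>{0..1}. dist (rescaled e t (?K (s, t))) (rescaled_lim e) < \<eta>"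
      by eventually_elim auto
  qed
  moreover have "uniform_limit {0..1} (\<lambda>t s. rescaled f t (?K (s, 1 - t))) (\<lambda>_. rescaled_lim f) (at_right 0)"
    unfolding uniform_limit_iff
  proof (intro allI impI)
    fix \<eta> :: real assume "\<eta> > 0"
    from uniform_limitD [OF H(5) this] uniform_limitD [OF G(5) this]
    show "\<forall>\<^sub>F t in at_right 0. \<forall>s\<in>{0..1}. dist (rescaled f t (?K (s, 1 - t))) (rescaled_lim f) < \<eta>"
      by eventually_elim auto
  qed
  moreover have "\<forall>t\<in>{0<..<1}. ?K (0, t) = \<gamma> t \<and> ?K (1, t) = \<gamma>'' t" using H(3) G(3) by simp
  ultimately show ?thesis
    unfolding path_homotopic_def by (intro exI [of _ ?K] conjI)
qed

subsection \<open>Joined paths\<close>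

definition join_param :: "real \<Rightarrow> real" where
  "join_param t = t + 2 * t\<^sup>2"

lemma join_param_pos: "0 < t \<Longrightarrow> 0 < join_param t"
  by (simp add: join_param_def add_pos_nonneg)

lemma join_param_bounds: "0 < t \<Longrightarrow> t < 1/2 \<Longrightarrow> 0 < join_param t \<and> join_param t < 1"
  using mult_strict_mono [of t "1/2" t "1/2"] join_param_pos [of t]
  by (auto simp: join_param_def power2_eq_square)

lemma join_param_half: "1 - join_param (1/2 - d) = 3 * d - 2 * d\<^sup>2"
  by (simp add: join_param_def power2_eq_square algebra_simps)

lemma filterlim_join_param: "filterlim join_param (at_right 0) (at_right 0)"
proof -
  have "(join_param \<longlongrightarrow> 0) (at_right 0)"
    unfolding join_param_def by (auto intro!: tendsto_eq_intros)
  moreover have "\<forall>\<^sub>F t in at_right 0. join_param t \<in> {0<..} \<and> join_param t \<noteq> 0"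
    using eventually_at_right_less [of "0 :: real"]
    by eventually_elim (use join_param_pos in force)
  ultimately show ?thesis by (simp add: filterlim_at)
qed

text \<open>
  A description by closed conditions that overlap in the breakpoints, as is convenient for
  proving continuity and piecewise differentiability.
\<close>

lemma cut_join_eq:
  assumes "\<delta> > 0"
  shows "cut_join \<delta> u v t =
    (if t \<le> 1/2 - \<delta> then u (join_param t)
     else if t \<le> 1/2 + \<delta> then
       linepath (u (join_param (1/2 - \<delta>))) (v (1 - join_param (1/2 - \<delta>))) ((t - (1/2 - \<delta>)) / (2 * \<delta>))
     else v (1 - join_param (1 - t)))"
proof -
  have 1: "path_join u v (1/2 - \<delta>) = u (join_param (1/2 - \<delta>))"
    using assms by (simp add: path_join_def join_param_def)
  have "1 - (1/2 + \<delta>) = 1/2 - \<delta>" by simp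
  then have 2: "path_join u v (1/2 + \<delta>) = v (1 - join_param (1/2 - \<delta>))"
    using assms unfolding path_join_def join_param_def by simp
  consider "t < 1/2 - \<delta>" | "t = 1/2 - \<delta>" | "\<bar>t - 1/2\<bar> < \<delta>" | "t = 1/2 + \<delta>" | "t > 1/2 + \<delta>"
    by linarith
  then show ?thesis
  proof cases
    case 1
    then show ?thesis using assms by (simp add: cut_join_def path_join_def join_param_def)
  next
    case 2
    then show ?thesis using assms 1 by (simp add: cut_join_def)
  next
    case 3
    then have "\<not> t \<le> 1/2 - \<delta>" "t \<le> 1/2 + \<delta>" by linarith+
    then show ?thesis using 3 unfolding cut_join_def \<open>path_join u v (1/2 - \<delta>) = _\<close> \<open>path_join u v (1/2 + \<delta>) = _\<close>
      by simp
  next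
    case 4
    then have "\<not> \<bar>t - 1/2\<bar> < \<delta>" "\<not> t \<le> 1/2 - \<delta>" "t \<le> 1/2 + \<delta>" "(t - (1/2 - \<delta>)) / (2 * \<delta>) = 1"
      using assms by (auto simp: field_simps)
    then show ?thesis using \<open>path_join u v (1/2 + \<delta>) = _\<close> 4 by (simp add: cut_join_def linepath_def)
  next
    case 5
    then show ?thesis using assms by (simp add: cut_join_def path_join_def join_param_def)
  qed
qed

text \<open>
  The reparametrization has derivative 1 at 0, and so does not change tangent vectors.
\<close>

lemma rescaled_join_param:
  assumes "uniform_limit S (\<lambda>t s. rescaled e t (G s t)) (\<lambda>_. rescaled_lim e) (at_right 0)"
  shows "uniform_limit S (\<lambda>t s. rescaled e t (G s (join_param t))) (\<lambda>_. rescaled_lim e) (at_right 0)"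
proof -
  have comp: "\<forall>\<^sub>F t in at_right 0. \<forall>s\<in>S. dist (rescaled e (join_param t) (G s (join_param t))) (rescaled_lim e) < \<eta>"
    if "\<eta> > 0" for \<eta>
    using eventually_compose_filterlim [OF uniform_limitD [OF assms that] filterlim_join_param] .
  show ?thesis
  proof (cases e)
    case (Pt p)
    then show ?thesis using comp by (simp add: uniform_limit_iff)
  next
    case (Tang a b)
    show ?thesis
      unfolding uniform_limit_iff
    proof (intro allI impI)
      fix \<eta> :: real assume \<eta>: "\<eta> > 0"
      have "\<forall>\<^sub>F t in at_right 0. t \<in> {0<..<min (1/2) (\<eta> / 4)}"
        by (rule eventually_at_right_real) (use \<eta> in simp)
      moreover have "\<eta> / 4 > 0" using \<eta> by simp
      note comp [OF this]
      ultimately show "\<forall>\<^sub>F t in at_right 0. \<forall>s\<in>S. dist (rescaled e t (G s (join_param t))) (rescaled_lim e) < \<eta>"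
      proof eventually_elim
        case (elim t)
        show ?case
        proof
          fix s assume "s \<in> S"
          let ?z = "coord a b (G s (join_param t))"
          define r where "r = ?z / of_real (join_param t)"
          have t: "0 < t" "t < 1/2" "t < \<eta> / 4" using elim by auto
          have r: "norm (r - 1) < \<eta> / 4"
            using elim \<open>s \<in> S\<close> by (simp add: Tang r_def dist_norm)
          have "join_param t \<noteq> 0" using join_param_bounds [of t] t by simp
          then have "?z / of_real t = r * of_real (join_param t / t)"
            using t by (simp add: r_def)
          also have "join_param t / t = 1 + 2 * t"
            using t by (simp add: join_param_def power2_eq_square add_divide_distrib)
          also have "r * of_real (1 + 2 * t) - 1 = (r - 1) * of_real (1 + 2 * t) + of_real (2 * t)"
            by (simp add: algebra_simps)
          finally have "?z / of_real t - 1 = (r - 1) * of_real (1 + 2 * t) + of_real (2 * t)"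
            by simp
          then have "norm (?z / of_real t - 1) \<le> norm (r - 1) * (1 + 2 * t) + 2 * t"
            using t norm_triangle_ineq [of "(r - 1) * of_real (1 + 2 * t)" "of_real (2 * t)"]
            by (simp only: norm_mult norm_of_real abs_of_pos)
          also have "\<dots> \<le> norm (r - 1) * 2 + 2 * t"
            using t by (intro add_mono mult_left_mono) auto
          also have "\<dots> < \<eta>" using r t by simp
          finally show "dist (rescaled e t (G s (join_param t))) (rescaled_lim e) < \<eta>"
            by (simp add: Tang dist_norm)
        qed
      qed
    qed
  qed
qed

lemma linepath_in_convex:
  assumes "convex V" "x \<in> V" "y \<in> V" "c \<in> {0..1 :: real}"
  shows "linepath x y c \<in> V"
  using convexD_alt [OF assms(1-3), of c] assms(4) by (simp add: linepath_def)

text \<open>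
  The joined paths of the members of two homotopies form a homotopy, with the length of the chord
  varying linearly from \<open>\<delta>\<close> to \<open>\<delta>'\<close>. For small lengths both ends of the chord lie in the convex
  neighbourhood of the common end \<open>m\<close>, hence so does the chord. This contains at once that the class
  of a joined path depends neither on the chord nor on the representatives.
\<close>

lemma cut_join_homotopic:
  assumes u: "path_homotopic e m u u'" and v: "path_homotopic m f v v'" and m: "proper_end m"
  shows "\<exists>\<delta>\<^sub>0>0. \<forall>\<delta> \<delta>'. 0 < \<delta> \<longrightarrow> \<delta> < \<delta>\<^sub>0 \<longrightarrow> 0 < \<delta>' \<longrightarrow> \<delta>' < \<delta>\<^sub>0 \<longrightarrow>
    path_homotopic e f (cut_join \<delta> u v) (cut_join \<delta>' u' v')"
proof -
  obtain H :: "real \<times> real \<Rightarrow> complex" where H: "continuous_on ({0..1} \<times> {0<..<1}) H" "H ` ({0..1} \<times> {0<..<1}) \<subseteq> Ycurve"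
    "\<forall>t\<in>{0<..<1}. H (0, t) = u t \<and> H (1, t) = u' t"
    "uniform_limit {0..1} (\<lambda>t s. rescaled e t (H (s, t))) (\<lambda>_. rescaled_lim e) (at_right 0)"
    "uniform_limit {0..1} (\<lambda>t s. rescaled m t (H (s, 1 - t))) (\<lambda>_. rescaled_lim m) (at_right 0)"
    by (rule path_homotopicE [OF u])
  obtain G :: "real \<times> real \<Rightarrow> complex" where G: "continuous_on ({0..1} \<times> {0<..<1}) G" "G ` ({0..1} \<times> {0<..<1}) \<subseteq> Ycurve"
    "\<forall>t\<in>{0<..<1}. G (0, t) = v t \<and> G (1, t) = v' t"
    "uniform_limit {0..1} (\<lambda>t s. rescaled m t (G (s, t))) (\<lambda>_. rescaled_lim m) (at_right 0)"
    "uniform_limit {0..1} (\<lambda>t s. rescaled f t (G (s, 1 - t))) (\<lambda>_. rescaled_lim f) (at_right 0)"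
    by (rule path_homotopicE [OF v])
  obtain a where a: "a > 0" "a < 1" "\<And>t s. 0 < t \<Longrightarrow> t < a \<Longrightarrow> s \<in> {0..1} \<Longrightarrow> H (s, 1 - t) \<in> end_nbhd m"
    using uniform_end_nbhd [OF m H(5)] by metis
  obtain b where b: "b > 0" "b < 1" "\<And>t s. 0 < t \<Longrightarrow> t < b \<Longrightarrow> s \<in> {0..1} \<Longrightarrow> G (s, t) \<in> end_nbhd m"
    using uniform_end_nbhd [OF m G(4)] by metis
  \<comment> \<open>In terms of the parameters of the two paths, a chord of half-length \<open>\<delta>\<close> starts and ends at distance \<open>3 \<delta> - 2 \<delta>\<^sup>2\<close> from the common end.\<close>
  define \<delta>\<^sub>0 where "\<delta>\<^sub>0 = min (1/4) (min (a / 3) (b / 3))"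
  have \<delta>\<^sub>0: "\<delta>\<^sub>0 > 0" "\<delta>\<^sub>0 \<le> 1/4" "3 * \<delta>\<^sub>0 \<le> a" "3 * \<delta>\<^sub>0 \<le> b" using a b by (auto simp: \<delta>\<^sub>0_def)
  have "path_homotopic e f (cut_join \<delta> u v) (cut_join \<delta>' u' v')"
    if \<delta>: "0 < \<delta>" "\<delta> < \<delta>\<^sub>0" "0 < \<delta>'" "\<delta>' < \<delta>\<^sub>0" for \<delta> \<delta>'
  proof -
    let ?S = "{0..1 :: real} \<times> {0<..<1 :: real}"
    define d where "d = (\<lambda>s. (1 - s) * \<delta> + s * \<delta>')"
    have d: "0 < d s" "d s < \<delta>\<^sub>0" if "s \<in> {0..1}" for s
    proof -
      have "d s \<ge> (1 - s) * min \<delta> \<delta>' + s * min \<delta> \<delta>'"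
        unfolding d_def using that by (intro add_mono mult_left_mono) auto
      then have "d s \<ge> min \<delta> \<delta>'" by (simp add: algebra_simps)
      then show "0 < d s" using \<delta> by auto
      have "d s \<le> (1 - s) * max \<delta> \<delta>' + s * max \<delta> \<delta>'"
        unfolding d_def using that by (intro add_mono mult_left_mono) auto
      then have "d s \<le> max \<delta> \<delta>'" by (simp add: algebra_simps)
      then show "d s < \<delta>\<^sub>0" using \<delta> by auto
    qed
    have dcont: "continuous_on A (\<lambda>x. d (fst x))" for A :: "(real \<times> real) set"
      unfolding d_def by (intro continuous_intros)
    have jp: "0 < join_param (1/2 - d s)" "join_param (1/2 - d s) < 1"
      "1 - join_param (1/2 - d s) < 3 * \<delta>\<^sub>0" if "s \<in> {0..1}" for s
    proof -
      show "0 < join_param (1/2 - d s)" "join_param (1/2 - d s) < 1"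
        using join_param_bounds [of "1/2 - d s"] d [OF that] \<delta>\<^sub>0(2) by auto
      show "1 - join_param (1/2 - d s) < 3 * \<delta>\<^sub>0"
        using join_param_half [of "d s"] d [OF that] by (smt (verit) zero_le_power2)
    qed
    let ?K1 = "\<lambda>x. H (fst x, join_param (snd x))"
    let ?K2 = "\<lambda>x. linepath (H (fst x, join_param (1/2 - d (fst x)))) (G (fst x, 1 - join_param (1/2 - d (fst x))))
      ((snd x - (1/2 - d (fst x))) / (2 * d (fst x)))"
    let ?K3 = "\<lambda>x. G (fst x, 1 - join_param (1 - snd x))"
    let ?K = "\<lambda>x. if snd x + d (fst x) \<le> 1/2 then ?K1 x else if snd x - d (fst x) \<le> 1/2 then ?K2 x else ?K3 x"
    have K: "?K (s, t) = cut_join (d s) (\<lambda>x. H (s, x)) (\<lambda>x. G (s, x)) t" if "s \<in> {0..1}" for s t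
      unfolding cut_join_eq [OF d(1) [OF that]] by (simp add: le_diff_eq diff_le_eq add.commute)
    have jcont: "continuous_on A (\<lambda>x. join_param (f x))" if "continuous_on A f" for A :: "(real \<times> real) set" and f
      unfolding join_param_def using that by (intro continuous_intros)
    have c1: "continuous_on A ?K1" if A: "A \<subseteq> ?S" "\<And>x. x \<in> A \<Longrightarrow> snd x < 1/2" for A
    proof (rule continuous_on_compose2 [OF H(1)])
      show "continuous_on A (\<lambda>x. (fst x, join_param (snd x)))"
        by (intro continuous_intros jcont)
      show "(\<lambda>x. (fst x, join_param (snd x))) ` A \<subseteq> ?S"
      proof
        fix y assume "y \<in> (\<lambda>x. (fst x, join_param (snd x))) ` A"
        then obtain x where x: "x \<in> A" "y = (fst x, join_param (snd x))" by auto
        then have "x \<in> ?S" "snd x < 1/2" using A by auto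
        then show "y \<in> ?S" using join_param_bounds [of "snd x"] x(2) by auto
      qed
    qed
    have c2: "continuous_on ?S ?K2"
    proof -
      have 1: "continuous_on ?S (\<lambda>x. H (fst x, join_param (1/2 - d (fst x))))"
        by (rule continuous_on_compose2 [OF H(1)])
          (auto intro!: continuous_intros jcont dcont simp: jp)
      have 2: "continuous_on ?S (\<lambda>x. G (fst x, 1 - join_param (1/2 - d (fst x))))"
        by (rule continuous_on_compose2 [OF G(1)])
          (auto intro!: continuous_intros jcont dcont simp: jp)
      have 3: "continuous_on ?S (\<lambda>x. (snd x - (1/2 - d (fst x))) / (2 * d (fst x)))"
        by (intro continuous_intros dcont) (use d in fastforce)
      show ?thesis
        unfolding linepath_def by (intro continuous_intros 1 2 3)
    qed
    have c3: "continuous_on A ?K3" if A: "A \<subseteq> ?S" "\<And>x. x \<in> A \<Longrightarrow> snd x > 1/2" for A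
    proof (rule continuous_on_compose2 [OF G(1)])
      show "continuous_on A (\<lambda>x. (fst x, 1 - join_param (1 - snd x)))"
        by (intro continuous_intros jcont)
      show "(\<lambda>x. (fst x, 1 - join_param (1 - snd x))) ` A \<subseteq> ?S"
      proof
        fix y assume "y \<in> (\<lambda>x. (fst x, 1 - join_param (1 - snd x))) ` A"
        then obtain x where x: "x \<in> A" "y = (fst x, 1 - join_param (1 - snd x))" by auto
        then have "x \<in> ?S" "snd x > 1/2" using A by auto
        then show "y \<in> ?S" using join_param_bounds [of "1 - snd x"] x(2) by auto
      qed
    qed
    have "continuous_on ?S ?K"
    proof (rule continuous_on_cases_le)
      show "continuous_on {x \<in> ?S. snd x + d (fst x) \<le> 1/2} ?K1"
        by (rule c1) (use d(1) in fastforce)+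
      show "continuous_on {x \<in> ?S. 1/2 \<le> snd x + d (fst x)}
          (\<lambda>x. if snd x - d (fst x) \<le> 1/2 then ?K2 x else ?K3 x)"
      proof (rule continuous_on_cases_le)
        show "continuous_on {x \<in> {x \<in> ?S. 1/2 \<le> snd x + d (fst x)}. snd x - d (fst x) \<le> 1/2} ?K2"
          by (rule continuous_on_subset [OF c2]) auto
        show "continuous_on {x \<in> {x \<in> ?S. 1/2 \<le> snd x + d (fst x)}. 1/2 \<le> snd x - d (fst x)} ?K3"
          by (rule c3) (use d(1) in fastforce)+
        fix x assume x: "x \<in> {x \<in> ?S. 1/2 \<le> snd x + d (fst x)}" "snd x - d (fst x) = 1/2"
        then have "1 - snd x = 1/2 - d (fst x)" "(snd x - (1/2 - d (fst x))) / (2 * d (fst x)) = 1"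
          using d(1) [of "fst x"] by auto
        then show "?K2 x = ?K3 x" by (simp only: linepath_def) simp
      qed (intro continuous_intros dcont)+
      fix x assume x: "x \<in> ?S" "snd x + d (fst x) = 1/2"
      then have "snd x = 1/2 - d (fst x)" "snd x - d (fst x) \<le> 1/2"
        using d(1) [of "fst x"] by auto
      then show "?K1 x = (if snd x - d (fst x) \<le> 1/2 then ?K2 x else ?K3 x)"
        by (simp add: linepath_def)
    qed (intro continuous_intros dcont)+
    moreover have "?K ` ?S \<subseteq> Ycurve"
    proof
      fix y assume "y \<in> ?K ` ?S"
      then obtain x where x: "y = ?K x" "x \<in> {0..1} \<times> {0<..<1}" by (rule imageE)
      obtain s t where "x = (s, t)" by (cases x)
      with x have st: "s \<in> {0..1}" "t \<in> {0<..<1}" "y = ?K (s, t)" by simp_all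
      consider "t + d s \<le> 1/2" | "\<not> t + d s \<le> 1/2" "t - d s \<le> 1/2" | "\<not> t + d s \<le> 1/2" "\<not> t - d s \<le> 1/2"
        by blast
      then show "y \<in> Ycurve"
      proof cases
        case 1
        then have "(s, join_param t) \<in> ?S" using join_param_bounds [of t] st d(1) [OF st(1)] by auto
        then have "H (s, join_param t) \<in> Ycurve" using H(2) by blast
        then show ?thesis using 1 st(3) by simp
      next
        case 2
        let ?j = "join_param (1/2 - d s)"
        have "H (s, 1 - (1 - ?j)) \<in> end_nbhd m"
          by (rule a(3)) (use jp [OF st(1)] st(1) \<delta>\<^sub>0(3) in auto)
        moreover have "G (s, 1 - ?j) \<in> end_nbhd m"
          by (rule b(3)) (use jp [OF st(1)] st(1) \<delta>\<^sub>0(4) in auto)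
        moreover have "(t - (1/2 - d s)) / (2 * d s) \<in> {0..1}"
          using 2 d(1) [OF st(1)] by (auto simp: field_simps)
        ultimately have "?K2 (s, t) \<in> end_nbhd m"
          by (auto intro!: linepath_in_convex [OF convex_end_nbhd])
        then show ?thesis using 2 st(3) end_nbhd_subset [of m] by auto
      next
        case 3
        then have "(s, 1 - join_param (1 - t)) \<in> ?S"
          using join_param_bounds [of "1 - t"] st d(1) [OF st(1)] by auto
        then have "G (s, 1 - join_param (1 - t)) \<in> Ycurve" using G(2) by blast
        then show ?thesis using 3 st(3) by simp
      qed
    qed
    moreover have "\<forall>t\<in>{0<..<1}. ?K (0, t) = cut_join \<delta> u v t \<and> ?K (1, t) = cut_join \<delta>' u' v' t"
    proof
      fix t :: real assume t: "t \<in> {0<..<1}"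
      have jt: "t \<le> 1/2 - d s \<Longrightarrow> 0 < join_param t \<and> join_param t < 1"
        "\<not> t \<le> 1/2 + d s \<Longrightarrow> 0 < join_param (1 - t) \<and> join_param (1 - t) < 1" if "s \<in> {0..1}" for s
        using join_param_bounds [of t] join_param_bounds [of "1 - t"] t d(1) [OF that] by auto
      have d0: "d 0 = \<delta>" "d 1 = \<delta>'" by (simp_all add: d_def)
      have "?K (0, t) = cut_join \<delta> u v t"
        unfolding K [of 0, simplified] d0 cut_join_eq [OF \<delta>(1)]
        using jt [of 0] jp [of 0] H(3) G(3) by (simp add: d0)
      moreover have "?K (1, t) = cut_join \<delta>' u' v' t"
        unfolding K [of 1, simplified] d0 cut_join_eq [OF \<delta>(3)]
        using jt [of 1] jp [of 1] H(3) G(3) by (simp add: d0)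
      ultimately show "?K (0, t) = cut_join \<delta> u v t \<and> ?K (1, t) = cut_join \<delta>' u' v' t" ..
    qed
    moreover have quarter: "\<forall>\<^sub>F t in at_right 0. t \<in> {0<..<1/4 :: real}"
      by (rule eventually_at_right_real) simp
    have "uniform_limit {0..1} (\<lambda>t s. rescaled e t (?K (s, t))) (\<lambda>_. rescaled_lim e) (at_right 0)"
      unfolding uniform_limit_iff
    proof (intro allI impI)
      fix \<eta> :: real assume "\<eta> > 0"
      from uniform_limitD [OF rescaled_join_param [OF H(4)] this] quarter
      show "\<forall>\<^sub>F t in at_right 0. \<forall>s\<in>{0..1}. dist (rescaled e t (?K (s, t))) (rescaled_lim e) < \<eta>"
      proof eventually_elim
        case (elim t)
        show ?case
        proof
          fix s :: real assume s: "s \<in> {0..1}"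
          have "t + d s \<le> 1/2" using d(2) [OF s] \<delta>\<^sub>0(2) elim(2) by auto
          then show "dist (rescaled e t (?K (s, t))) (rescaled_lim e) < \<eta>"
            using elim(1) s by simp
        qed
      qed
    qed
    moreover have "uniform_limit {0..1} (\<lambda>t s. rescaled f t (?K (s, 1 - t))) (\<lambda>_. rescaled_lim f) (at_right 0)"
      unfolding uniform_limit_iff
    proof (intro allI impI)
      fix \<eta> :: real assume "\<eta> > 0"
      from uniform_limitD [OF rescaled_join_param [OF G(5)] this] quarter
      show "\<forall>\<^sub>F t in at_right 0. \<forall>s\<in>{0..1}. dist (rescaled f t (?K (s, 1 - t))) (rescaled_lim f) < \<eta>"
      proof eventually_elim
        case (elim t)
        show ?case
        proof
          fix s :: real assume s: "s \<in> {0..1}"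
          have "\<not> 1 - t + d s \<le> 1/2" "\<not> 1 - t - d s \<le> 1/2"
            using d [OF s] \<delta>\<^sub>0(2) elim(2) by auto
          then show "dist (rescaled f t (?K (s, 1 - t))) (rescaled_lim f) < \<eta>"
            using elim(1) s by simp
        qed
      qed
    qed
    ultimately show ?thesis
      unfolding path_homotopic_def by (intro exI [of _ ?K] conjI)
  qed
  then show ?thesis using \<delta>\<^sub>0(1) by blast
qed

lemma join_param_mono: "0 \<le> s \<Longrightarrow> s \<le> t \<Longrightarrow> join_param s \<le> join_param t"
  by (simp add: join_param_def add_mono power_mono)

lemma join_param_ge: "t \<le> join_param t"
  by (simp add: join_param_def)

lemma inj_on_join_param: "inj_on join_param {0..}"
proof (rule inj_onI)
  fix x y :: real assume "x \<in> {0..}" "y \<in> {0..}" "join_param x = join_param y"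
  then have "(x - y) * (1 + 2 * (x + y)) = 0" "1 + 2 * (x + y) > 0"
    by (auto simp: join_param_def power2_eq_square algebra_simps)
  then show "x = y" by simp
qed

lemma piecewise_C1_join_param:
  assumes u: "u piecewise_C1_differentiable_on {a..b}"
    and S: "S \<subseteq> {0..}" "join_param ` S \<subseteq> {a..b}"
  shows "(\<lambda>t. u (join_param t)) piecewise_C1_differentiable_on S"
proof -
  have "join_param C1_differentiable_on S"
    unfolding join_param_def [abs_def] power2_eq_square
    by (intro derivative_intros C1_differentiable_on_mult)
  then have 1: "join_param piecewise_C1_differentiable_on S"
    by (rule C1_differentiable_imp_piecewise)
  have 2: "u piecewise_C1_differentiable_on (join_param ` S)"
    by (rule piecewise_C1_differentiable_on_subset [OF u S(2)])
  have 3: "finite (S \<inter> join_param -` {x})" for x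
    using finite_vimage_IntI [of "{x}" join_param S] inj_on_subset [OF inj_on_join_param S(1)]
    by (simp add: Int_commute)
  show ?thesis
    using piecewise_C1_differentiable_compose [OF 1 2 3] by (simp add: o_def)
qed

lemma piecewise_C1_reverse:
  fixes u :: "real \<Rightarrow> complex"
  assumes "u piecewise_C1_differentiable_on {a..b}"
  shows "(\<lambda>t. u (1 - t)) piecewise_C1_differentiable_on {1 - b..1 - a}"
proof -
  have "(\<lambda>x. -1 * x + 1) ` {1 - b..1 - a} = {a..b}"
    by (auto simp: image_iff intro!: bexI [of _ "1 - _"])
  then show ?thesis
    using piecewise_C1_differentiable_affine [of u "-1" 1 "{1 - b..1 - a}"] assms
    by (simp add: o_def)
qed

lemma is_path_cut_join:
  assumes u: "is_path (Tang a b) (Tang c d) u" and v: "is_path (Tang c d) f v"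
  shows "\<exists>\<delta>\<^sub>0>0. \<forall>\<delta>. 0 < \<delta> \<longrightarrow> \<delta> < \<delta>\<^sub>0 \<longrightarrow> is_path (Tang a b) f (cut_join \<delta> u v)"
proof -
  have ends: "proper_end (Tang a b)" "proper_end (Tang c d)" "proper_end f"
    using u v by (simp_all only: is_path_def)
  have uC1: "u piecewise_C1_differentiable_on {\<epsilon>..1 - \<epsilon>}" if "0 < \<epsilon>" "\<epsilon> < 1/2" for \<epsilon>
    using u that by (simp add: is_path_def trunc_hi_def)
  have vC1: "v piecewise_C1_differentiable_on {\<epsilon>..trunc_hi f \<epsilon>}" if "0 < \<epsilon>" "\<epsilon> < 1/2" for \<epsilon>
    using v that by (simp add: is_path_def)
  obtain \<delta>\<^sub>0 where \<delta>\<^sub>0: "\<delta>\<^sub>0 > 0" "\<And>\<delta> \<delta>'. 0 < \<delta> \<Longrightarrow> \<delta> < \<delta>\<^sub>0 \<Longrightarrow> 0 < \<delta>' \<Longrightarrow> \<delta>' < \<delta>\<^sub>0 \<Longrightarrow>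
      path_homotopic (Tang a b) f (cut_join \<delta> u v) (cut_join \<delta>' u v)"
    using cut_join_homotopic [OF is_path_homotopic_refl [OF u] is_path_homotopic_refl [OF v] ends(2)] by metis
  have "is_path (Tang a b) f (cut_join \<delta> u v)" if \<delta>: "0 < \<delta>" "\<delta> < min \<delta>\<^sub>0 (1/4)" for \<delta>
  proof -
    have hom: "path_homotopic (Tang a b) f (cut_join \<delta> u v) (cut_join \<delta> u v)"
      using \<delta>\<^sub>0(2) \<delta> by simp
    define \<mu> where "\<mu> = 3 * \<delta> - 2 * \<delta>\<^sup>2"
    have \<mu>: "join_param (1/2 - \<delta>) = 1 - \<mu>" using join_param_half [of \<delta>] by (simp add: \<mu>_def)
    have "\<mu> > 0"
      using \<delta> mult_strict_left_mono [of \<delta> "1/4" \<delta>] by (simp add: \<mu>_def power2_eq_square)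
    have small: "cut_join \<delta> u v piecewise_C1_differentiable_on {\<epsilon>..trunc_hi f \<epsilon>}"
      if \<epsilon>: "0 < \<epsilon>" "\<epsilon> < 1/4" for \<epsilon>
    proof -
      define \<tau> where "\<tau> = min \<epsilon> \<mu>"
      have \<tau>: "0 < \<tau>" "\<tau> < 1/2" "\<tau> \<le> \<epsilon>" "\<tau> \<le> \<mu>" using \<epsilon> \<open>\<mu> > 0\<close> by (auto simp: \<tau>_def)
      have hi: "1 - \<epsilon> \<le> trunc_hi f \<epsilon>" "trunc_hi f \<epsilon> \<le> 1"
        using \<epsilon> by (cases f; simp add: trunc_hi_def)+
      have 1: "(\<lambda>t. u (join_param t)) piecewise_C1_differentiable_on {\<epsilon>..1/2 - \<delta>}"
      proof (rule piecewise_C1_join_param [OF uC1 [OF \<tau>(1,2)]])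
        show "join_param ` {\<epsilon>..1/2 - \<delta>} \<subseteq> {\<tau>..1 - \<tau>}"
        proof
          fix y assume "y \<in> join_param ` {\<epsilon>..1/2 - \<delta>}"
          then obtain t where t: "y = join_param t" "\<epsilon> \<le> t" "t \<le> 1/2 - \<delta>" by auto
          then show "y \<in> {\<tau>..1 - \<tau>}"
            using join_param_ge [of t] join_param_mono [of t "1/2 - \<delta>"] \<tau> \<epsilon> \<mu> by simp
        qed
      qed (use \<epsilon> in auto)
      have "(\<lambda>t. v (1 - t)) piecewise_C1_differentiable_on {1 - trunc_hi f \<tau>..1 - \<tau>}"
        by (rule piecewise_C1_reverse [OF vC1 [OF \<tau>(1,2)]])
      then have "(\<lambda>t. v (1 - join_param t)) piecewise_C1_differentiable_on {1 - trunc_hi f \<epsilon>..1/2 - \<delta>}"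
      proof (rule piecewise_C1_join_param)
        show "join_param ` {1 - trunc_hi f \<epsilon>..1/2 - \<delta>} \<subseteq> {1 - trunc_hi f \<tau>..1 - \<tau>}"
        proof
          fix y assume "y \<in> join_param ` {1 - trunc_hi f \<epsilon>..1/2 - \<delta>}"
          then obtain t where t: "y = join_param t" "1 - trunc_hi f \<epsilon> \<le> t" "t \<le> 1/2 - \<delta>" by auto
          moreover have "1 - trunc_hi f \<tau> \<le> 1 - trunc_hi f \<epsilon>"
            using \<tau>(3) by (cases f) (simp_all add: trunc_hi_def)
          ultimately show "y \<in> {1 - trunc_hi f \<tau>..1 - \<tau>}"
            using join_param_ge [of t] join_param_mono [of t "1/2 - \<delta>"] \<tau> hi \<mu> by simp
        qed
      qed (use hi in auto)
      from piecewise_C1_reverse [OF this]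
      have 3: "(\<lambda>t. v (1 - join_param (1 - t))) piecewise_C1_differentiable_on {1/2 + \<delta>..trunc_hi f \<epsilon>}"
        by (simp add: algebra_simps)
      let ?l = "\<lambda>t. linepath (u (join_param (1/2 - \<delta>))) (v (1 - join_param (1/2 - \<delta>))) ((t - (1/2 - \<delta>)) / (2 * \<delta>))"
      have "?l C1_differentiable_on {1/2 - \<delta>..1/2 + \<delta>}"
      proof -
        let ?x = "u (join_param (1/2 - \<delta>))" and ?y = "v (1 - join_param (1/2 - \<delta>))"
        have "(?l has_vector_derivative (?y - ?x) /\<^sub>R (2 * \<delta>)) (at t)" for t
          unfolding linepath_def using \<delta>
          by (auto intro!: derivative_eq_intros simp: divide_simps scaleR_diff_right)
        then show ?thesis
          unfolding C1_differentiable_on_def by (intro exI [of _ "\<lambda>_. (?y - ?x) /\<^sub>R (2 * \<delta>)"]) auto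
      qed
      then have 2: "?l piecewise_C1_differentiable_on {1/2 - \<delta>..1/2 + \<delta>}"
        by (rule C1_differentiable_imp_piecewise)
      have eq1: "(1 - (1/2 + \<delta>)) = 1/2 - \<delta>" "((1/2 + \<delta>) - (1/2 - \<delta>)) / (2 * \<delta>) = 1"
        using \<delta> by (simp_all add: field_simps)
      have 23: "(\<lambda>t. if t \<le> 1/2 + \<delta> then ?l t else v (1 - join_param (1 - t)))
          piecewise_C1_differentiable_on {1/2 - \<delta>..trunc_hi f \<epsilon>}"
      proof (rule piecewise_C1_differentiable_cases [OF 2 3])
        show "1/2 - \<delta> \<le> 1/2 + \<delta>" "1/2 + \<delta> \<le> trunc_hi f \<epsilon>" using \<delta> \<epsilon> hi by simp_all
        show "?l (1/2 + \<delta>) = v (1 - join_param (1 - (1/2 + \<delta>)))"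
          unfolding eq1 by (simp add: linepath_def)
      qed
      have "(\<lambda>t. if t \<le> 1/2 - \<delta> then u (join_param t) else
          (if t \<le> 1/2 + \<delta> then ?l t else v (1 - join_param (1 - t))))
          piecewise_C1_differentiable_on {\<epsilon>..trunc_hi f \<epsilon>}"
        by (rule piecewise_C1_differentiable_cases [OF 1 23])
          (use \<delta> \<epsilon> hi in \<open>auto simp: linepath_def\<close>)
      then show ?thesis
        by (simp only: cut_join_eq [OF \<delta>(1), abs_def])
    qed
    have "cut_join \<delta> u v piecewise_C1_differentiable_on {\<epsilon>..trunc_hi f \<epsilon>}"
      if \<epsilon>: "0 < \<epsilon>" "\<epsilon> < 1/2" for \<epsilon>
    proof (rule piecewise_C1_differentiable_on_subset [OF small [of "min \<epsilon> (1/8)"]])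
      show "{\<epsilon>..trunc_hi f \<epsilon>} \<subseteq> {min \<epsilon> (1/8)..trunc_hi f (min \<epsilon> (1/8))}"
        by (cases f) (auto simp: trunc_hi_def)
    qed (use \<epsilon> in auto)
    then show ?thesis
      using path_homotopic_left [OF hom] ends by (simp add: is_path_def)
  qed
  then show ?thesis using \<delta>\<^sub>0(1) by (intro exI [of _ "min \<delta>\<^sub>0 (1/4)"]) simp
qed

text \<open>
  The lift along the second path is used as it is, and the lift along the first one is multiplied
  by \<open>T\<close>. Both equal the section of the common end \<open>m\<close> times \<open>T\<close> near that end, so they fit
  together across the chord.
\<close>

lemma transports_cut_join:
  assumes u: "path_homotopic e m u u" "transports e m u S"
    and v: "path_homotopic m f v v" "transports m f v T"
    and m: "proper_end m"
  shows "\<forall>\<^sub>F \<delta> in at_right 0. transports e f (cut_join \<delta> u v) (S \<star> T)"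
proof -
  have S: "S [] = 1" and T: "T [] = 1" using u(2) v(2) by (simp_all only: transports_def)
  obtain \<Phi> where \<Phi>: "lifted \<Phi> u {0<..<1}"
    "\<forall>\<^sub>F t in at_right 0. u t \<in> end_nbhd e \<and> \<Phi> t = end_section e (u t) \<star> S"
    "\<forall>\<^sub>F t in at_right 0. u (1 - t) \<in> end_nbhd m \<and> \<Phi> (1 - t) = end_section m (u (1 - t))"
    using u(2) unfolding transports_def by (elim exE conjE)
  obtain \<Theta> where \<Theta>: "lifted \<Theta> v {0<..<1}"
    "\<forall>\<^sub>F t in at_right 0. v t \<in> end_nbhd m \<and> \<Theta> t = end_section m (v t) \<star> T"
    "\<forall>\<^sub>F t in at_right 0. v (1 - t) \<in> end_nbhd f \<and> \<Theta> (1 - t) = end_section f (v (1 - t))"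
    using v(2) unfolding transports_def by (elim exE conjE)
  obtain a where a: "a > 0" "\<And>t. 0 < t \<Longrightarrow> t < a \<Longrightarrow> u (1 - t) \<in> end_nbhd m \<and> \<Phi> (1 - t) = end_section m (u (1 - t))"
    using \<Phi>(3) unfolding eventually_at_right_field by blast
  obtain b where b: "b > 0" "\<And>t. 0 < t \<Longrightarrow> t < b \<Longrightarrow> v t \<in> end_nbhd m \<and> \<Theta> t = end_section m (v t) \<star> T"
    using \<Theta>(2) unfolding eventually_at_right_field by blast
  obtain \<delta>\<^sub>0 where \<delta>\<^sub>0: "\<delta>\<^sub>0 > 0" "\<And>\<delta> \<delta>'. 0 < \<delta> \<Longrightarrow> \<delta> < \<delta>\<^sub>0 \<Longrightarrow> 0 < \<delta>' \<Longrightarrow> \<delta>' < \<delta>\<^sub>0 \<Longrightarrow>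
      path_homotopic e f (cut_join \<delta> u v) (cut_join \<delta>' u v)"
    using cut_join_homotopic [OF u(1) v(1) m] by metis
  \<comment> \<open>Twice the bound for the chord itself, so that there is room on both of its sides for gluing.\<close>
  define \<delta>\<^sub>1 where "\<delta>\<^sub>1 = min (min \<delta>\<^sub>0 (1/8)) (min (a/6) (b/6))"
  have \<delta>\<^sub>1: "\<delta>\<^sub>1 > 0" "\<delta>\<^sub>1 \<le> \<delta>\<^sub>0" "\<delta>\<^sub>1 \<le> 1/8" "6 * \<delta>\<^sub>1 \<le> a" "6 * \<delta>\<^sub>1 \<le> b"
    using a(1) b(1) \<delta>\<^sub>0(1) by (auto simp: \<delta>\<^sub>1_def)
  have "transports e f (cut_join \<delta> u v) (S \<star> T)" if \<delta>: "0 < \<delta>" "\<delta> < \<delta>\<^sub>1" for \<delta>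
  proof -
    let ?w = "cut_join \<delta> u v"
    have "path_homotopic e f ?w ?w" using \<delta>\<^sub>0(2) \<delta> \<delta>\<^sub>1(2) by simp
    note w_cont = path_homotopic_left(1) [OF this]
    have near: "0 < join_param (1/2 - x)" "0 < 1 - join_param (1/2 - x)" "1 - join_param (1/2 - x) < 6 * \<delta>\<^sub>1"
      if "0 < x" "x < 2 * \<delta>" for x
    proof -
      have x: "x < 1/4" using that \<delta> \<delta>\<^sub>1 by simp
      show "0 < join_param (1/2 - x)" "0 < 1 - join_param (1/2 - x)"
        using join_param_bounds [of "1/2 - x"] that x by auto
      have "3 * x - 2 * x\<^sup>2 \<le> 3 * x" by simp
      also have "\<dots> < 6 * \<delta>\<^sub>1" using that \<delta> by simp
      finally show "1 - join_param (1/2 - x) < 6 * \<delta>\<^sub>1" by (simp only: join_param_half)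
    qed
    have near_u: "u (join_param (1/2 - x)) \<in> end_nbhd m \<and>
        \<Phi> (join_param (1/2 - x)) = end_section m (u (join_param (1/2 - x)))" if "0 < x" "x < 2 * \<delta>" for x
      using a(2) [of "1 - join_param (1/2 - x)"] near [OF that] \<delta>\<^sub>1(4) by simp
    have near_v: "v (1 - join_param (1/2 - x)) \<in> end_nbhd m \<and>
        \<Theta> (1 - join_param (1/2 - x)) = end_section m (v (1 - join_param (1/2 - x))) \<star> T" if "0 < x" "x < 2 * \<delta>" for x
      using b(2) [of "1 - join_param (1/2 - x)"] near [OF that] \<delta>\<^sub>1(5) by simp
    define \<Xi> where "\<Xi> = (\<lambda>t. if t \<le> 1/2 - \<delta> then \<Phi> (join_param t) \<star> T
      else if t \<le> 1/2 + \<delta> then end_section m (?w t) \<star> T else \<Theta> (1 - join_param (1 - t)))"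
    have w1: "?w t = u (join_param t)" if "t \<le> 1/2 - \<delta>" for t
      using that by (simp add: cut_join_eq [OF \<delta>(1)])
    have w3: "?w t = v (1 - join_param (1 - t))" if "t > 1/2 + \<delta>" for t
      using that \<delta>(1) by (simp add: cut_join_eq [OF \<delta>(1)])
    have mid: "?w t \<in> end_nbhd m \<and> \<Xi> t = end_section m (?w t) \<star> T"
      if t: "1/2 - 2 * \<delta> < t" "t < 1/2 + 2 * \<delta>" for t
    proof -
      consider "t \<le> 1/2 - \<delta>" | "1/2 - \<delta> < t" "t \<le> 1/2 + \<delta>" | "t > 1/2 + \<delta>" by linarith
      then show ?thesis
      proof cases
        case 1
        then show ?thesis using near_u [of "1/2 - t"] t \<delta> w1 [of t] by (simp add: \<Xi>_def)
      next
        case 2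
        have "?w t \<in> end_nbhd m"
        proof -
          have "(t - (1/2 - \<delta>)) / (2 * \<delta>) \<in> {0..1}" using 2 \<delta>(1) by (auto simp: field_simps)
          then show ?thesis
            using 2 near_u [of \<delta>] near_v [of \<delta>] \<delta>(1)
            by (auto simp: cut_join_eq [OF \<delta>(1)] intro!: linepath_in_convex [OF convex_end_nbhd])
        qed
        then show ?thesis using 2 by (simp add: \<Xi>_def)
      next
        case 3
        have "1 - t = 1/2 - (t - 1/2)" by simp
        then show ?thesis using near_v [of "t - 1/2"] t \<delta> w3 [of t] 3 by (simp add: \<Xi>_def)
      qed
    qed
    have jcont: "continuous_on A join_param" for A
      unfolding join_param_def by (intro continuous_intros)
    have lift: "lifted \<Xi> ?w {0<..<1}"
    proof (rule lifted_local)
      fix t :: real assume t: "t \<in> {0<..<1}"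
      have op: "openin (top_of_set {0<..<1}) ({0<..<1} \<inter> {x<..<y})" for x y :: real
        by (rule openin_open_Int) simp
      \<comment> \<open>Three overlapping open intervals, on which the lift comes from \<open>u\<close>, from the common end and from \<open>v\<close>.\<close>
      consider "t < 1/2 - \<delta>" | "1/2 - 2 * \<delta> < t" "t < 1/2 + 2 * \<delta>" | "t > 1/2 + \<delta>"
        using \<delta>(1) by linarith
      then show "\<exists>N \<Phi>' h'. openin (top_of_set {0<..<1}) N \<and> t \<in> N \<and> lifted \<Phi>' h' N \<and>
          (\<forall>x\<in>N. \<Xi> x = \<Phi>' x \<and> ?w x = h' x)"
      proof cases
        case 1
        let ?N = "{0<..<1} \<inter> {0<..<1/2 - \<delta>}"
        have "lifted (\<lambda>t. \<Phi> (join_param t)) (\<lambda>t. u (join_param t)) ?N"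
        proof (rule lifted_compose [OF \<Phi>(1) jcont])
          show "join_param ` ?N \<subseteq> {0<..<1}"
          proof
            fix y assume "y \<in> join_param ` ?N"
            then obtain x where "y = join_param x" "x \<in> ?N" by (rule imageE)
            then show "y \<in> {0<..<1}" using join_param_bounds [of x] \<delta>(1) by simp
          qed
        qed
        then have "lifted (\<lambda>t. \<Phi> (join_param t) \<star> T) (\<lambda>t. u (join_param t)) ?N"
          by (rule lifted_mult_const) (rule T)
        moreover have "\<forall>x\<in>?N. \<Xi> x = \<Phi> (join_param x) \<star> T \<and> ?w x = u (join_param x)"
          using w1 by (simp add: \<Xi>_def)
        moreover have "t \<in> ?N" using 1 t by simp
        ultimately show ?thesis
          using op [of 0 "1/2 - \<delta>"] by (intro exI conjI)
      next
        case 2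
        let ?N = "{0<..<1} \<inter> {1/2 - 2 * \<delta><..<1/2 + 2 * \<delta>}"
        have "lifted (\<lambda>t. end_section m (?w t)) ?w ?N"
        proof (rule lifted_flat [OF flat_end_section [OF m] open_end_nbhd])
          show "continuous_on ?N ?w" by (rule continuous_on_subset [OF w_cont]) auto
          show "?w ` ?N \<subseteq> end_nbhd m"
          proof
            fix y assume "y \<in> ?w ` ?N"
            then obtain x where "y = ?w x" "x \<in> ?N" by (rule imageE)
            then show "y \<in> end_nbhd m" using mid [of x] by simp
          qed
        qed
        then have "lifted (\<lambda>t. end_section m (?w t) \<star> T) ?w ?N"
          by (rule lifted_mult_const) (rule T)
        moreover have "\<forall>x\<in>?N. \<Xi> x = end_section m (?w x) \<star> T \<and> ?w x = ?w x"
          using mid by simp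
        moreover have "t \<in> ?N" using 2 t by simp
        ultimately show ?thesis
          using op [of "1/2 - 2 * \<delta>" "1/2 + 2 * \<delta>"] by (intro exI conjI)
      next
        case 3
        let ?N = "{0<..<1} \<inter> {1/2 + \<delta><..<1}"
        have "lifted (\<lambda>t. \<Theta> (1 - join_param (1 - t))) (\<lambda>t. v (1 - join_param (1 - t))) ?N"
        proof (rule lifted_compose [OF \<Theta>(1)])
          show "continuous_on ?N (\<lambda>t. 1 - join_param (1 - t))"
            unfolding join_param_def by (intro continuous_intros)
          show "(\<lambda>t. 1 - join_param (1 - t)) ` ?N \<subseteq> {0<..<1}"
          proof
            fix y assume "y \<in> (\<lambda>t. 1 - join_param (1 - t)) ` ?N"
            then obtain x where "y = 1 - join_param (1 - x)" "x \<in> ?N" by (rule imageE)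
            then show "y \<in> {0<..<1}" using join_param_bounds [of "1 - x"] \<delta>(1) by simp
          qed
        qed
        moreover have "\<forall>x\<in>?N. \<Xi> x = \<Theta> (1 - join_param (1 - x)) \<and> ?w x = v (1 - join_param (1 - x))"
          using w3 \<delta>(1) by (simp add: \<Xi>_def)
        moreover have "t \<in> ?N" using 3 t by simp
        ultimately show ?thesis
          using op [of "1/2 + \<delta>" 1] by (intro exI conjI)
      qed
    qed
    have small: "\<forall>\<^sub>F t in at_right 0. t \<in> {0<..<1/4 :: real}"
      by (rule eventually_at_right_real) simp
    have start: "\<forall>\<^sub>F t in at_right 0. ?w t \<in> end_nbhd e \<and> \<Xi> t = end_section e (?w t) \<star> (S \<star> T)"
      using small eventually_compose_filterlim [OF \<Phi>(2) filterlim_join_param]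
    proof eventually_elim
      case (elim t)
      then have "t \<le> 1/2 - \<delta>" using \<delta> \<delta>\<^sub>1 by simp
      then show ?case using elim w1 [of t] by (simp add: \<Xi>_def nc_mult_assoc)
    qed
    have fin: "\<forall>\<^sub>F t in at_right 0. ?w (1 - t) \<in> end_nbhd f \<and> \<Xi> (1 - t) = end_section f (?w (1 - t))"
      using small eventually_compose_filterlim [OF \<Theta>(3) filterlim_join_param]
    proof eventually_elim
      case (elim t)
      then have "1 - t > 1/2 + \<delta>" using \<delta> \<delta>\<^sub>1 by simp
      then show ?case using elim w3 [of "1 - t"] \<delta>(1) by (simp add: \<Xi>_def)
    qed
    have "(S \<star> T) [] = 1" by (simp add: nc_mult_Nil S T)
    then show ?thesis
      unfolding transports_def using lift start fin by (intro conjI exI [of _ \<Xi>])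
  qed
  then show ?thesis
    unfolding eventually_at_right_field using \<delta>\<^sub>1(1) by blast
qed

lemma concat_class_transports:
  assumes A: "\<And>u. u \<in> A \<Longrightarrow> is_path e m u \<and> transports e m u S"
    and B: "\<And>v. v \<in> B \<Longrightarrow> is_path m f v \<and> transports m f v T"
    and w: "w \<in> concat_class e f A B"
  shows "transports e f w (S \<star> T)"
proof -
  obtain u v where uv: "u \<in> A" "v \<in> B" "\<forall>\<^sub>F \<delta> in at_right 0. path_homotopic e f (cut_join \<delta> u v) w"
    using w unfolding concat_class_def by blast
  have ends: "proper_end e" "proper_end m" "proper_end f"
    using A [OF uv(1)] B [OF uv(2)] by (simp_all only: is_path_def)
  have "\<forall>\<^sub>F \<delta> in at_right 0. transports e f (cut_join \<delta> u v) (S \<star> T)"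
    by (rule transports_cut_join [where m = m]) (use A [OF uv(1)] B [OF uv(2)] ends in \<open>auto intro: is_path_homotopic_refl\<close>)
  with uv(3) have "\<forall>\<^sub>F \<delta> in at_right (0 :: real). path_homotopic e f (cut_join \<delta> u v) w \<and>
      transports e f (cut_join \<delta> u v) (S \<star> T)"
    by (rule eventually_conj)
  then obtain \<delta> :: real where \<delta>: "path_homotopic e f (cut_join \<delta> u v) w" "transports e f (cut_join \<delta> u v) (S \<star> T)"
    using eventually_happens' [OF trivial_limit_at_right_real] by blast
  obtain S' where "transports e f (cut_join \<delta> u v) S'" "transports e f w S'"
    using homotopy_transport [OF \<delta>(1) ends(1,3)] by blast
  then show ?thesis using transports_unique [OF ends(1) \<delta>(2)] by blast
qed

text \<open>
  Concatenation of homotopy classes is well defined: the composite is again a single, nonempty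
  class. Only with this is the multiplication of \<open>G01\<close> closed, which is what makes
  multiplicativity of an isomorphism \<open>\<Psi>\<close> applicable to products of products.
\<close>

lemma concat_class_eq_path_class:
  assumes A: "A \<noteq> {}" "\<And>u. u \<in> A \<Longrightarrow> is_path (Tang a b) (Tang c d) u"
      "\<And>u u'. u \<in> A \<Longrightarrow> u' \<in> A \<Longrightarrow> path_homotopic (Tang a b) (Tang c d) u u'"
    and B: "B \<noteq> {}" "\<And>v. v \<in> B \<Longrightarrow> is_path (Tang c d) f v"
      "\<And>v v'. v \<in> B \<Longrightarrow> v' \<in> B \<Longrightarrow> path_homotopic (Tang c d) f v v'"
  shows "\<exists>w. is_path (Tang a b) f w \<and> concat_class (Tang a b) f A B = path_class (Tang a b) f w"
proof -
  let ?e = "Tang a b" and ?m = "Tang c d"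
  obtain u v where uv: "u \<in> A" "v \<in> B" using A(1) B(1) by blast
  have m: "proper_end ?m" using A(2) [OF uv(1)] by (simp only: is_path_def)
  have hom: "\<exists>\<delta>\<^sub>0>0. \<forall>\<delta> \<delta>'. 0 < \<delta> \<longrightarrow> \<delta> < \<delta>\<^sub>0 \<longrightarrow> 0 < \<delta>' \<longrightarrow> \<delta>' < \<delta>\<^sub>0 \<longrightarrow>
      path_homotopic ?e f (cut_join \<delta> u' v') (cut_join \<delta>' u v)" if "u' \<in> A" "v' \<in> B" for u' v'
    by (rule cut_join_homotopic [OF A(3) [OF that(1) uv(1)] B(3) [OF that(2) uv(2)] m])
  obtain d\<^sub>0 where d0: "d\<^sub>0 > 0" "\<And>\<delta>. 0 < \<delta> \<Longrightarrow> \<delta> < d\<^sub>0 \<Longrightarrow> is_path ?e f (cut_join \<delta> u v)"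
    using is_path_cut_join [OF A(2) [OF uv(1)] B(2) [OF uv(2)]] by blast
  obtain d\<^sub>1 where d1: "d\<^sub>1 > 0" "\<And>\<delta> \<delta>'. 0 < \<delta> \<Longrightarrow> \<delta> < d\<^sub>1 \<Longrightarrow> 0 < \<delta>' \<Longrightarrow> \<delta>' < d\<^sub>1 \<Longrightarrow>
      path_homotopic ?e f (cut_join \<delta> u v) (cut_join \<delta>' u v)"
    using hom [OF uv] by metis
  define \<delta> where "\<delta> = min d\<^sub>0 d\<^sub>1 / 2"
  have \<delta>: "0 < \<delta>" "\<delta> < d\<^sub>0" "\<delta> < d\<^sub>1" using d0(1) d1(1) by (auto simp: \<delta>_def)
  let ?w = "cut_join \<delta> u v"
  have "concat_class ?e f A B = path_class ?e f ?w"
  proof (intro equalityI subsetI)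
    fix w assume "w \<in> concat_class ?e f A B"
    then obtain u' v' where w: "is_path ?e f w" "u' \<in> A" "v' \<in> B"
      "\<forall>\<^sub>F \<delta> in at_right 0. path_homotopic ?e f (cut_join \<delta> u' v') w"
      unfolding concat_class_def by blast
    obtain d\<^sub>2 where d2: "d\<^sub>2 > 0" "\<And>\<delta> \<delta>'. 0 < \<delta> \<Longrightarrow> \<delta> < d\<^sub>2 \<Longrightarrow> 0 < \<delta>' \<Longrightarrow> \<delta>' < d\<^sub>2 \<Longrightarrow>
        path_homotopic ?e f (cut_join \<delta> u' v') (cut_join \<delta>' u v)"
      using hom [OF w(2,3)] by metis
    have "\<forall>\<^sub>F \<epsilon> in at_right 0. \<epsilon> \<in> {0<..<min d\<^sub>1 d\<^sub>2}"
      by (rule eventually_at_right_real) (use d1 d2 in simp)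
    with w(4) have "\<forall>\<^sub>F \<epsilon> in at_right 0. path_homotopic ?e f (cut_join \<epsilon> u' v') w \<and> \<epsilon> \<in> {0<..<min d\<^sub>1 d\<^sub>2}"
      by (rule eventually_conj)
    then obtain \<epsilon> where \<epsilon>: "path_homotopic ?e f (cut_join \<epsilon> u' v') w" "\<epsilon> \<in> {0<..<min d\<^sub>1 d\<^sub>2}"
      using eventually_happens' [OF trivial_limit_at_right_real] by blast
    have "path_homotopic ?e f ?w (cut_join \<epsilon> u v)" using d1(2) \<delta> \<epsilon>(2) by simp
    moreover have "path_homotopic ?e f (cut_join \<epsilon> u v) (cut_join \<epsilon> u' v')"
      using path_homotopic_sym [OF d2(2) [of \<epsilon> \<epsilon>]] \<epsilon>(2) by simp
    ultimately have "path_homotopic ?e f ?w w"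
      using \<epsilon>(1) path_homotopic_trans by blast
    then show "w \<in> path_class ?e f ?w" using w(1) by (simp add: path_class_def)
  next
    fix w assume "w \<in> path_class ?e f ?w"
    then have w: "is_path ?e f w" "path_homotopic ?e f ?w w" by (simp_all add: path_class_def)
    have "\<forall>\<^sub>F \<epsilon> in at_right 0. \<epsilon> \<in> {0<..<d\<^sub>1}"
      by (rule eventually_at_right_real) (rule d1)
    then have "\<forall>\<^sub>F \<epsilon> in at_right 0. path_homotopic ?e f (cut_join \<epsilon> u v) w"
    proof eventually_elim
      case (elim \<epsilon>)
      then have "path_homotopic ?e f (cut_join \<epsilon> u v) ?w" using d1(2) \<delta> by simp
      then show ?case using w(2) by (rule path_homotopic_trans)
    qed
    then show "w \<in> concat_class ?e f A B"
      using w(1) uv unfolding concat_class_def by blast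
  qed
  then show ?thesis using d0(2) [OF \<delta>(1,2)] by blast
qed

lemma path_class_self: "is_path e f \<gamma> \<Longrightarrow> \<gamma> \<in> path_class e f \<gamma>"
  by (simp add: path_class_def is_path_homotopic_refl)

lemma path_class_homotopic:
  "u \<in> path_class e f \<gamma> \<Longrightarrow> u' \<in> path_class e f \<gamma> \<Longrightarrow> path_homotopic e f u u'"
  unfolding path_class_def using path_homotopic_sym path_homotopic_trans by blast

lemma has_chen_series_unique:
  assumes "has_chen_series e f \<gamma> S" "has_chen_series e f \<gamma> S'"
  shows "S = S'"
proof
  fix w
  show "S w = S' w"
    using assms tendsto_unique [OF trivial_limit_at_right_real] unfolding has_chen_series_def by blast
qed

text \<open>
  The set of paths has to be nonempty, since otherwise every series would be a common value.
\<close>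

lemma chen_of_transports:
  assumes A: "A \<noteq> {}" "\<And>\<gamma>. \<gamma> \<in> A \<Longrightarrow> is_path (Tang a b) f \<gamma> \<and> transports (Tang a b) f \<gamma> S"
  shows "chen_of (Tang a b) f A = S"
  unfolding chen_of_def
proof (rule the_equality)
  show "\<forall>\<gamma>\<in>A. has_chen_series (Tang a b) f \<gamma> S"
    using A(2) transports_has_chen_series by blast
  fix S' assume "\<forall>\<gamma>\<in>A. has_chen_series (Tang a b) f \<gamma> S'"
  moreover obtain \<gamma> where "\<gamma> \<in> A" using A(1) by blast
  ultimately show "S' = S"
    using A(2) transports_has_chen_series has_chen_series_unique by blast
qed

lemma path_class_transports:
  assumes "is_path e f \<gamma>"
  shows "\<exists>S. \<forall>\<gamma>'\<in>path_class e f \<gamma>. is_path e f \<gamma>' \<and> transports e f \<gamma>' S"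
proof -
  have ends: "proper_end e" "proper_end f" using assms by (simp_all only: is_path_def)
  obtain S where S: "transports e f \<gamma> S"
    using homotopy_transport [OF is_path_homotopic_refl [OF assms] ends] by blast
  have "transports e f \<gamma>' S" if \<gamma>': "path_homotopic e f \<gamma> \<gamma>'" for \<gamma>'
    using homotopy_transport [OF \<gamma>' ends] transports_unique [OF ends(1) S] by metis
  then show ?thesis by (intro exI [of _ S]) (simp add: path_class_def)
qed

section \<open>The finite group\<close>

lemma mat2_nth [simp]:
  "mat2 a b c d $ 1 $ 1 = a" "mat2 a b c d $ 1 $ 2 = b" "mat2 a b c d $ 2 $ 1 = c" "mat2 a b c d $ 2 $ 2 = d"
  by (simp_all add: mat2_def)

lemma mat2_eq_iff: "A = mat2 a b c d \<longleftrightarrow> A $ 1 $ 1 = a \<and> A $ 1 $ 2 = b \<and> A $ 2 $ 1 = c \<and> A $ 2 $ 2 = d"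
  by (auto simp: vec_eq_iff forall_2)

lemma mat2_mult:
  "mat2 a b c d ** mat2 a' b' c' d' = mat2 (a * a' + b * c') (a * b' + b * d') (c * a' + d * c') (c * b' + d * d' :: 'a :: semiring_1)"
  by (simp add: mat2_eq_iff matrix_matrix_mult_def sum_2)

lemma mat_1_eq_mat2: "(mat 1 :: 'a :: {zero, one}^2^2) = mat2 1 0 0 1"
  by (simp add: mat2_eq_iff mat_def)

lemma mat2_inject: "mat2 a b c d = mat2 a' b' c' d' \<longleftrightarrow> a = a' \<and> b = b' \<and> c = c' \<and> d = d'"
  unfolding mat2_eq_iff by simp

lemma SL2_bit_explicit:
  "(mat 1 :: bit^2^2) = mat2 1 0 0 1" "sigma_bar = mat2 0 1 1 0" "rho_bar = mat2 1 1 0 1"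
  "sigma_bar ** rho_bar = mat2 0 1 1 1" "rho_bar ** sigma_bar = mat2 1 1 1 0"
  "rho_bar ** sigma_bar ** rho_bar = mat2 1 0 1 1"
  by (simp_all add: mat_1_eq_mat2 sigma_bar_def rho_bar_def mat2_mult)

text \<open>
  The table distinguishes the elements by matrices; that these are the six elements in the order of
  the table is verified by multiplying out.
\<close>

lemma six_cases_simps:
  "six_cases (mat2 1 0 0 1) x\<^sub>1 x\<^sub>2 x\<^sub>3 x\<^sub>4 x\<^sub>5 x\<^sub>6 = x\<^sub>1"
  "six_cases (mat2 0 1 1 0) x\<^sub>1 x\<^sub>2 x\<^sub>3 x\<^sub>4 x\<^sub>5 x\<^sub>6 = x\<^sub>2"
  "six_cases (mat2 1 1 0 1) x\<^sub>1 x\<^sub>2 x\<^sub>3 x\<^sub>4 x\<^sub>5 x\<^sub>6 = x\<^sub>3"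
  "six_cases (mat2 0 1 1 1) x\<^sub>1 x\<^sub>2 x\<^sub>3 x\<^sub>4 x\<^sub>5 x\<^sub>6 = x\<^sub>4"
  "six_cases (mat2 1 1 1 0) x\<^sub>1 x\<^sub>2 x\<^sub>3 x\<^sub>4 x\<^sub>5 x\<^sub>6 = x\<^sub>5"
  "six_cases (mat2 1 0 1 1) x\<^sub>1 x\<^sub>2 x\<^sub>3 x\<^sub>4 x\<^sub>5 x\<^sub>6 = x\<^sub>6"
  by (simp_all add: six_cases_def SL2_bit_explicit mat2_mult mat2_inject)

lemma SL2_bit_cases:
  fixes g :: "bit^2^2"
  assumes "det g = 1"
  obtains "g = mat2 1 0 0 1" | "g = mat2 0 1 1 0" | "g = mat2 1 1 0 1"
    | "g = mat2 0 1 1 1" | "g = mat2 1 1 1 0" | "g = mat2 1 0 1 1"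
proof -
  have g: "g = mat2 (g $ 1 $ 1) (g $ 1 $ 2) (g $ 2 $ 1) (g $ 2 $ 2)"
    by (simp add: mat2_eq_iff)
  have "g $ 1 $ 1 * g $ 2 $ 2 - g $ 1 $ 2 * g $ 2 $ 1 = 1"
    using assms by (simp add: det_2)
  then show thesis
    using that g
    by (cases "g $ 1 $ 1"; cases "g $ 1 $ 2"; cases "g $ 2 $ 1"; cases "g $ 2 $ 2") simp_all
qed

lemma det_mat2: "det (mat2 a b c d) = a * d - b * (c :: 'a :: comm_ring_1)"
  by (simp add: det_2)

lemma cusp_act_simps:
  "cusp_act (mat2 1 0 0 1) = case_cusp C0 C1 Cinf" "cusp_act (mat2 0 1 1 0) = case_cusp C1 C0 Cinf"
  "cusp_act (mat2 1 1 0 1) = case_cusp C0 Cinf C1" "cusp_act (mat2 0 1 1 1) = case_cusp C1 Cinf C0"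
  "cusp_act (mat2 1 1 1 0) = case_cusp Cinf C0 C1" "cusp_act (mat2 1 0 1 1) = case_cusp Cinf C1 C0"
  by (simp_all add: cusp_act_def six_cases_simps)

lemma moebius_act_simps:
  "moebius_act (mat2 1 0 0 1) z = z" "moebius_act (mat2 0 1 1 0) z = 1 - z"
  "moebius_act (mat2 1 1 0 1) z = z / (z - 1)" "moebius_act (mat2 0 1 1 1) z = 1 / (1 - z)"
  "moebius_act (mat2 1 1 1 0) z = (z - 1) / z" "moebius_act (mat2 1 0 1 1) z = 1 / z"
  by (simp_all add: moebius_act_def six_cases_simps)

lemma var_act_simps:
  "var_act (mat2 1 0 0 1) = case_letter (nc_var L0) (nc_var L1)"
  "var_act (mat2 0 1 1 0) = case_letter (- nc_var L1) (- nc_var L0)"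
  "var_act (mat2 1 1 0 1) = case_letter (nc_var L0) (nc_var L0 - nc_var L1)"
  "var_act (mat2 0 1 1 1) = case_letter (nc_var L1 - nc_var L0) (- nc_var L0)"
  "var_act (mat2 1 1 1 0) = case_letter (- nc_var L1) (nc_var L0 - nc_var L1)"
  "var_act (mat2 1 0 1 1) = case_letter (nc_var L1 - nc_var L0) (nc_var L1)"
  by (simp_all add: var_act_def Let_def six_cases_simps)

lemma linear_var_act: "linear_series (var_act g i)"
  by (cases i) (simp_all add: var_act_def Let_def six_cases_def linear_series_intros)

lemma cusp_act_neq:
  assumes "det g = 1" "a \<noteq> b"
  shows "cusp_act g a \<noteq> cusp_act g b"
  using assms(1) by (cases rule: SL2_bit_cases) (use assms(2) in \<open>cases a; cases b; simp add: cusp_act_simps\<close>)+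

lemma end_act_mult:
  assumes g: "det g = 1"
  shows "end_act (sigma_bar ** g) (Tang C0 C1) = end_act sigma_bar (end_act g (Tang C0 C1))"
    "end_act (rho_bar ** g) (Tang C0 C1) = end_act rho_bar (end_act g (Tang C0 C1))"
  using g by (cases rule: SL2_bit_cases; simp add: sigma_bar_def rho_bar_def mat2_mult cusp_act_simps)+

lemma end_act_inj:
  assumes "det g = 1" "det h = 1" "end_act g (Tang C0 C1) = end_act h (Tang C0 C1)"
  shows "g = h"
  using assms(1)
  by (cases rule: SL2_bit_cases)
    (use assms(2,3) in \<open>cases h rule: SL2_bit_cases; simp add: cusp_act_simps\<close>)+

lemma end_perm_end_act:
  assumes "det g = 1"
  shows "end_perm (end_act g (Tang C0 C1)) = g"
  unfolding end_perm_def by (rule the_equality) (use assms end_act_inj in auto)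

subsection \<open>Linear fractional transformations of the curve\<close>

lemma Ycurve_iff: "z \<in> Ycurve \<longleftrightarrow> z \<noteq> 0 \<and> z \<noteq> 1"
  by (simp add: Ycurve_def)

lemma open_Ycurve: "open Ycurve"
  by (simp add: Ycurve_def open_Compl)

lemma moebius_act_Ycurve:
  assumes "det g = 1" "z \<in> Ycurve"
  shows "moebius_act g z \<in> Ycurve"
  using assms(1) by (cases rule: SL2_bit_cases)
    (use assms(2) in \<open>simp_all add: moebius_act_simps Ycurve_iff divide_eq_eq\<close>)

lemma moebius_act_inverse:
  assumes "det g = 1"
  shows "\<exists>h. det h = 1 \<and> (\<forall>z\<in>Ycurve. moebius_act h (moebius_act g z) = z)"
proof -
  have "\<exists>h\<in>{mat2 1 0 0 1, mat2 0 1 1 0, mat2 1 1 0 1, mat2 0 1 1 1, mat2 1 1 1 0, mat2 1 0 1 1}.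
      \<forall>z\<in>Ycurve. moebius_act h (moebius_act g z) = z"
    using assms by (cases rule: SL2_bit_cases) (simp_all add: moebius_act_simps Ycurve_iff divide_simps)
  then obtain h :: "bit^2^2"
    where h: "h \<in> {mat2 1 0 0 1, mat2 0 1 1 0, mat2 1 1 0 1, mat2 0 1 1 1, mat2 1 1 1 0, mat2 1 0 1 1}"
      "\<forall>z\<in>Ycurve. moebius_act h (moebius_act g z) = z" by blast
  have "det h = 1" using h(1) by (auto simp: det_mat2)
  then show ?thesis using h(2) by blast
qed

lemma moebius_act_Reals: "z \<in> \<real> \<Longrightarrow> moebius_act g z \<in> \<real>"
  unfolding moebius_act_def six_cases_def by (auto intro!: Reals_divide Reals_diff)

lemma moebius_act_Reals_iff:
  assumes "det g = 1" "z \<in> Ycurve"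
  shows "moebius_act g z \<in> \<real> \<longleftrightarrow> z \<in> \<real>"
  using moebius_act_inverse [OF assms(1)] moebius_act_Reals assms(2) by metis

text \<open>
  The equation says that the pullback of \<open>dz/z gX\<^sub>0 + dz/(1-z) gX\<^sub>1\<close> under \<open>g\<close> is
  \<open>dz/z X\<^sub>0 + dz/(1-z) X\<^sub>1\<close>. This invariance of the connection is the reason why \<open>g\<close> acts on the
  variables in the way it does.
\<close>

lemma moebius_act_has_derivative:
  assumes "det g = 1" "z \<in> Ycurve"
  shows "\<exists>M'. (moebius_act g has_field_derivative M') (at z) \<and>
    (\<forall>j. var_act g L0 [j] * (form_coeff L0 (moebius_act g z) * M') +
         var_act g L1 [j] * (form_coeff L1 (moebius_act g z) * M') = form_coeff j z)"
proof -
  have z: "z \<noteq> 0" "z \<noteq> 1" "1 - z \<noteq> 0" "z - 1 \<noteq> 0" using assms(2) by (auto simp: Ycurve_iff)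
  have eqs: "moebius_act (mat2 1 0 0 1) = (\<lambda>z. z)" "moebius_act (mat2 0 1 1 0) = (\<lambda>z. 1 - z)"
    "moebius_act (mat2 1 1 0 1) = (\<lambda>z. z / (z - 1))" "moebius_act (mat2 0 1 1 1) = (\<lambda>z. 1 / (1 - z))"
    "moebius_act (mat2 1 1 1 0) = (\<lambda>z. (z - 1) / z)" "moebius_act (mat2 1 0 1 1) = (\<lambda>z. 1 / z)"
    by (simp_all add: fun_eq_iff moebius_act_simps)
  have all: "(\<forall>j. P j) \<longleftrightarrow> P L0 \<and> P L1" for P
    using letter.exhaust by metis
  show ?thesis
    using assms(1)
  proof (cases rule: SL2_bit_cases)
    case 1
    show ?thesis unfolding 1 eqs all
      by (intro exI [of _ 1] conjI) (auto simp: var_act_simps nc_var_def)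
  next
    case 2
    have "((\<lambda>z. 1 - z) has_field_derivative -1) (at z)"
      by (auto intro!: derivative_eq_intros)
    then show ?thesis unfolding 2 eqs all
      by (intro exI [of _ "-1"] conjI) (auto simp: var_act_simps nc_var_def)
  next
    case 3
    have "((\<lambda>z. z / (z - 1)) has_field_derivative -1 / (z - 1)\<^sup>2) (at z)"
      using z by (auto intro!: derivative_eq_intros simp: power2_eq_square)
    moreover define u where "u = z - 1"
    then have u: "z = 1 + u" "u \<noteq> 0" "1 + u \<noteq> 0" using z by auto
    have "1 - z / (z - 1) = - 1 / u" unfolding u(1) using u(2) by (simp add: field_simps)
    then have "form_coeff L1 (z / (z - 1)) * (-1 / (z - 1)\<^sup>2) = - form_coeff L1 z"
      unfolding u(1) using u(2) by (simp add: power2_eq_square)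
    moreover have "form_coeff L0 (z / (z - 1)) * (-1 / (z - 1)\<^sup>2) = form_coeff L0 z + form_coeff L1 z"
      unfolding u(1) using u(2,3) by (simp add: divide_simps power2_eq_square)
    ultimately show ?thesis unfolding 3 eqs all
      by (intro exI [of _ "-1 / (z - 1)\<^sup>2"] conjI)
        (simp_all only: var_act_simps letter.case, simp_all add: nc_var_def)
  next
    case 4
    have "((\<lambda>z. 1 / (1 - z)) has_field_derivative 1 / (1 - z)\<^sup>2) (at z)"
      using z by (auto intro!: derivative_eq_intros simp: power2_eq_square)
    moreover define u where "u = 1 - z"
    then have u: "z = 1 - u" "u \<noteq> 0" "1 - u \<noteq> 0" using z by auto
    have "1 - 1 / (1 - z) = - (1 - u) / u" unfolding u(1) using u(2) by (simp add: field_simps)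
    then have "form_coeff L1 (1 / (1 - z)) * (1 / (1 - z)\<^sup>2) = - (form_coeff L0 z + form_coeff L1 z)"
      unfolding u(1) using u(2,3) by (simp add: divide_simps power2_eq_square)
    moreover have "form_coeff L0 (1 / (1 - z)) * (1 / (1 - z)\<^sup>2) = form_coeff L1 z"
      unfolding u(1) using u(2,3) by (simp add: power2_eq_square)
    ultimately show ?thesis unfolding 4 eqs all
      by (intro exI [of _ "1 / (1 - z)\<^sup>2"] conjI)
        (simp_all only: var_act_simps letter.case, simp_all add: nc_var_def)
  next
    case 5
    have "((\<lambda>z. (z - 1) / z) has_field_derivative 1 / z\<^sup>2) (at z)"
      using z by (auto intro!: derivative_eq_intros simp: power2_eq_square)
    moreover have "1 - (z - 1) / z = 1 / z" using z by (simp add: field_simps)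
    then have "form_coeff L1 ((z - 1) / z) * (1 / z\<^sup>2) = form_coeff L0 z"
      using z by (simp add: power2_eq_square)
    moreover have "form_coeff L0 ((z - 1) / z) * (1 / z\<^sup>2) = - (form_coeff L0 z + form_coeff L1 z)"
      using z by (simp add: divide_simps power2_eq_square)
    ultimately show ?thesis unfolding 5 eqs all
      by (intro exI [of _ "1 / z\<^sup>2"] conjI)
        (simp_all only: var_act_simps letter.case, simp_all add: nc_var_def)
  next
    case 6
    have "((\<lambda>z. 1 / z) has_field_derivative - 1 / z\<^sup>2) (at z)"
      using z by (auto intro!: derivative_eq_intros simp: power2_eq_square)
    moreover have "1 - 1 / z = (z - 1) / z" using z by (simp add: field_simps)
    then have "form_coeff L1 (1 / z) * (- 1 / z\<^sup>2) = form_coeff L0 z + form_coeff L1 z"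
      using z by (simp add: divide_simps power2_eq_square)
    moreover have "form_coeff L0 (1 / z) * (- 1 / z\<^sup>2) = - form_coeff L0 z"
      using z by (simp add: power2_eq_square)
    ultimately show ?thesis unfolding 6 eqs all
      by (intro exI [of _ "- 1 / z\<^sup>2"] conjI)
        (simp_all only: var_act_simps letter.case, simp_all add: nc_var_def)
  qed
qed

lemma moebius_act_holomorphic: "det g = 1 \<Longrightarrow> moebius_act g holomorphic_on Ycurve"
  using moebius_act_has_derivative has_field_derivative_at_within
  by (metis holomorphic_onI field_differentiable_def)

text \<open>
  Both sides are local coordinates at the image cusp that have derivative 1 there, so that they
  differ by a linear fractional transformation \<open>c / (1 + \<kappa> c)\<close>. The value of \<open>\<kappa>\<close> depends on whether the
  coordinate takes the value 1 or \<open>\<infinity>\<close> at the second cusp.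
\<close>

lemma moebius_act_coord:
  assumes "det g = 1" "a \<noteq> b"
  shows "\<exists>\<kappa>. \<forall>z\<in>Ycurve. coord (cusp_act g a) (cusp_act g b) (moebius_act g z) =
    coord a b z / (1 + \<kappa> * coord a b z)"
proof -
  \<comment> \<open>1 if the coordinate is 1 at the second cusp, and 0 if it is infinite there\<close>
  define T where "T = (\<lambda>a b. if (a, b) \<in> {(C0, C1), (C1, C0), (Cinf, C1)} then 1 else 0 :: complex)"
  have "coord (cusp_act g a) (cusp_act g b) (moebius_act g z) =
    coord a b z / (1 + (T (cusp_act g a) (cusp_act g b) - T a b) * coord a b z)" if "z \<in> Ycurve" for z
  proof -
    have z: "z \<noteq> 0" "z \<noteq> 1" using that by (auto simp: Ycurve_iff)
    \<comment> \<open>All terms are written as expressions in \<open>z\<close> and \<open>w\<close>.\<close>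
    obtain w where w: "w = 1 - z" by simp
    have norm: "1 - z = w" "z - 1 = - w" "z * (1 - 1 / z) = - w" "1 / w = 1 + z / w" "w / z = 1 / z - 1"
      "1 - w = z" "w - 1 = - z" "1 / (1 + z / w) = w" "1 / (1 - 1 / z) = - (z / w)"
      using z by (simp_all add: w field_simps)
    show ?thesis
      using assms(2) z
      by (cases rule: SL2_bit_cases [OF assms(1)]; cases a; cases b;
          simp_all only: T_def cusp_act_simps moebius_act_simps cusp.case coord.simps; simp add: norm)
  qed
  then show ?thesis by blast
qed

text \<open>
  The invariance of the connection, seen on its residues.
\<close>

lemma var_act_cusp_residue:
  assumes "det g = 1"
  shows "var_act g L0 [j] * cusp_residue (cusp_act g a) [L0] +
    var_act g L1 [j] * cusp_residue (cusp_act g a) [L1] = cusp_residue a [j]"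
  using assms
  by (cases rule: SL2_bit_cases)
    (cases a; cases j; simp add: cusp_act_simps var_act_simps nc_var_def)+

lemma moebius_act_cusp_gap:
  assumes "det g = 1" "z \<in> cusp_gap C0 C1"
  shows "moebius_act g z \<in> cusp_gap (cusp_act g C0) (cusp_act g C1)"
proof -
  obtain x where x: "z = of_real x" "0 < x" "x < 1" using assms(2) by auto
  have eqs: "1 - z = of_real (1 - x)" "z / (z - 1) = of_real (x / (x - 1))" "1 / (1 - z) = of_real (1 / (1 - x))"
    "(z - 1) / z = of_real ((x - 1) / x)" "1 / z = of_real (1 / x)" by (simp_all add: x(1))
  show ?thesis
    using assms(1)
  proof (cases rule: SL2_bit_cases)
    case 1
    show ?thesis using assms(2) by (simp add: 1 cusp_act_simps moebius_act_simps)
  next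
    case 2
    show ?thesis unfolding 2 cusp_act_simps moebius_act_simps eqs(1) cusp.case cusp_gap.simps
      by (rule imageI) (use x in simp)
  next
    case 3
    show ?thesis unfolding 3 cusp_act_simps moebius_act_simps eqs(2) cusp.case cusp_gap.simps
      by (rule imageI) (use x in \<open>simp add: divide_simps\<close>)
  next
    case 4
    show ?thesis unfolding 4 cusp_act_simps moebius_act_simps eqs(3) cusp.case cusp_gap.simps
      by (rule imageI) (use x in \<open>simp add: divide_simps\<close>)
  next
    case 5
    show ?thesis unfolding 5 cusp_act_simps moebius_act_simps eqs(4) cusp.case cusp_gap.simps
      by (rule imageI) (use x in \<open>simp add: divide_simps\<close>)
  next
    case 6
    show ?thesis unfolding 6 cusp_act_simps moebius_act_simps eqs(5) cusp.case cusp_gap.simps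
      by (rule imageI) (use x in \<open>simp add: divide_simps\<close>)
  qed
qed

section \<open>Linear fractional transformations of paths\<close>

lemma end_act_Tang_proper: "det g = 1 \<Longrightarrow> proper_end e \<Longrightarrow> proper_end (end_act g e)"
  by (cases e) (simp_all add: cusp_act_neq moebius_act_Ycurve)

lemma piecewise_C1_moebius:
  assumes g: "det g = 1" and v: "v piecewise_C1_differentiable_on {a..b}" "v ` {a..b} \<subseteq> Ycurve"
  shows "(\<lambda>t. moebius_act g (v t)) piecewise_C1_differentiable_on {a..b}"
proof -
  let ?M = "moebius_act g"
  note hol = moebius_act_holomorphic [OF g]
  obtain F where F: "finite F" "v C1_differentiable_on {a..b} - F" and cont: "continuous_on {a..b} v"
    using v(1) unfolding piecewise_C1_differentiable_on_def by blast
  obtain D where D: "\<And>t. t \<in> {a..b} - F \<Longrightarrow> (v has_vector_derivative D t) (at t)" "continuous_on ({a..b} - F) D"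
    using F(2) unfolding C1_differentiable_on_def by blast
  have M: "(?M has_field_derivative deriv ?M z) (at z)" if "z \<in> Ycurve" for z
    using holomorphic_derivI [OF hol open_Ycurve that] .
  have "continuous_on {a..b} (\<lambda>t. ?M (v t))"
    by (rule continuous_on_compose2 [OF holomorphic_on_imp_continuous_on [OF hol] cont v(2)])
  moreover have "(\<lambda>t. ?M (v t)) C1_differentiable_on {a..b} - F"
    unfolding C1_differentiable_on_def
  proof (intro exI [of _ "\<lambda>t. D t * deriv ?M (v t)"] conjI ballI)
    fix t assume t: "t \<in> {a..b} - F"
    then have "v t \<in> Ycurve" using v(2) by blast
    from field_vector_diff_chain_at [OF D(1) [OF t] M [OF this]]
    show "((\<lambda>t. ?M (v t)) has_vector_derivative D t * deriv ?M (v t)) (at t)" by (simp add: o_def)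
  next
    have "continuous_on Ycurve (deriv ?M)"
      by (intro holomorphic_on_imp_continuous_on holomorphic_deriv hol open_Ycurve)
    then have "continuous_on ({a..b} - F) (\<lambda>t. deriv ?M (v t))"
      by (rule continuous_on_compose2 [OF _ continuous_on_subset [OF cont]]) (use v(2) in auto)
    then show "continuous_on ({a..b} - F) (\<lambda>t. D t * deriv ?M (v t))"
      by (intro continuous_intros D(2))
  qed
  ultimately show ?thesis
    unfolding piecewise_C1_differentiable_on_def using F(1) by blast
qed

text \<open>
  The coordinates before and after the transformation agree to first order at the cusp, which
  preserves unit tangent vectors. Uniformity in \<open>s\<close> makes this applicable to homotopies.
\<close>

lemma moebius_rescaled:
  assumes g: "det g = 1" and ab: "a \<noteq> b"
    and lim: "uniform_limit S (\<lambda>t s. rescaled (Tang a b) t (G s t)) (\<lambda>_. 1) (at_right 0)"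
    and Y: "\<And>s t. s \<in> S \<Longrightarrow> 0 < t \<Longrightarrow> t < 1 \<Longrightarrow> G s t \<in> Ycurve"
  shows "uniform_limit S (\<lambda>t s. rescaled (end_act g (Tang a b)) t (moebius_act g (G s t))) (\<lambda>_. 1) (at_right 0)"
  unfolding uniform_limit_iff
proof (intro allI impI)
  fix \<eta> :: real assume \<eta>: "\<eta> > 0"
  obtain \<kappa> where \<kappa>: "\<And>z. z \<in> Ycurve \<Longrightarrow>
      coord (cusp_act g a) (cusp_act g b) (moebius_act g z) = coord a b z / (1 + \<kappa> * coord a b z)"
    using moebius_act_coord [OF g ab] by blast
  define \<epsilon> where "\<epsilon> = min (1/2) (\<eta> / 8)"
  have \<epsilon>: "0 < \<epsilon>" "\<epsilon> \<le> 1/2" "\<epsilon> \<le> \<eta> / 8" using \<eta> by (auto simp: \<epsilon>_def)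
  define \<beta> where "\<beta> = min 1 (\<epsilon> / (2 * (norm \<kappa> + 1)))"
  have \<beta>: "0 < \<beta>" "\<beta> \<le> 1" "\<beta> \<le> \<epsilon> / (2 * (norm \<kappa> + 1))"
    using \<epsilon> by (auto simp: \<beta>_def add_nonneg_pos)
  have "\<forall>\<^sub>F t in at_right 0. t \<in> {0<..<\<beta>}"
    by (rule eventually_at_right_real) (rule \<beta>)
  with uniform_limitD [OF lim \<epsilon>(1)]
  show "\<forall>\<^sub>F t in at_right 0. \<forall>s\<in>S. dist (rescaled (end_act g (Tang a b)) t (moebius_act g (G s t))) 1 < \<eta>"
  proof eventually_elim
    case (elim t)
    have t: "0 < t" "t < 1" "t < \<beta>" using elim \<beta> by auto
    show ?case
    proof
      fix s assume s: "s \<in> S"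
      define r where "r = coord a b (G s t) / of_real t"
      have c: "coord a b (G s t) = of_real t * r" using t by (simp add: r_def)
      have r1: "norm (r - 1) < \<epsilon>" using elim s by (simp add: r_def dist_norm)
      have "norm r \<le> norm (r - 1) + norm (1 :: complex)"
        by (metis diff_add_cancel norm_triangle_ineq)
      then have r2: "norm r \<le> 2" using r1 \<epsilon> by simp
      let ?x = "\<kappa> * (of_real t * r)"
      have "norm ?x \<le> norm \<kappa> * (t * 2)"
        unfolding norm_mult using t r2 by (intro mult_left_mono) auto
      also have "\<dots> \<le> (norm \<kappa> + 1) * (\<beta> * 2)"
        using t by (intro mult_mono) auto
      also have "\<dots> \<le> \<epsilon>"
        using \<beta>(3) by (simp add: pos_le_divide_eq add_nonneg_pos mult_ac)
      finally have x: "norm ?x \<le> \<epsilon>" .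
      have "1 - norm ?x \<le> norm (1 + ?x)"
        by (metis norm_diff_ineq norm_one)
      then have d: "norm (1 + ?x) \<ge> 1/2" using x \<epsilon> by simp
      then have d0: "1 + ?x \<noteq> 0" by auto
      have "rescaled (end_act g (Tang a b)) t (moebius_act g (G s t)) = r / (1 + ?x)"
        using \<kappa> [OF Y [OF s t(1,2)]] t c by simp
      also have "r / (1 + ?x) - 1 = (r - 1 - ?x) / (1 + ?x)"
        using d0 by (simp add: field_simps)
      finally have eq: "rescaled (end_act g (Tang a b)) t (moebius_act g (G s t)) - 1 = (r - 1 - ?x) / (1 + ?x)"
        by simp
      have "norm (r - 1 - ?x) \<le> norm (r - 1) + norm ?x" by (rule norm_triangle_ineq4)
      also have "\<dots> < \<eta> / 4" using r1 x \<epsilon> by simp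
      finally have "norm (r - 1 - ?x) < \<eta> / 4" .
      then have "norm (r - 1 - ?x) / norm (1 + ?x) \<le> (\<eta> / 4) / (1/2)"
        using d \<eta> by (intro frac_le) auto
      then have "norm (rescaled (end_act g (Tang a b)) t (moebius_act g (G s t)) - 1) \<le> \<eta> / 2"
        unfolding eq norm_divide by simp
      then show "dist (rescaled (end_act g (Tang a b)) t (moebius_act g (G s t))) 1 < \<eta>"
        unfolding dist_norm using \<eta> by linarith
    qed
  qed
qed

lemma moebius_rescaled_pointwise:
  assumes g: "det g = 1" and e: "proper_end e"
    and lim: "((\<lambda>t. rescaled e t (\<gamma> t)) \<longlongrightarrow> rescaled_lim e) (at_right 0)"
    and Y: "\<And>t. 0 < t \<Longrightarrow> t < 1 \<Longrightarrow> \<gamma> t \<in> Ycurve"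
  shows "((\<lambda>t. rescaled (end_act g e) t (moebius_act g (\<gamma> t))) \<longlongrightarrow> rescaled_lim (end_act g e)) (at_right 0)"
proof (cases e)
  case (Tang a b)
  have "uniform_limit {0 :: real} (\<lambda>t s. rescaled (Tang a b) t (\<gamma> t)) (\<lambda>_. 1) (at_right 0)"
    using lim by (simp add: Tang uniform_limit_singleton)
  from moebius_rescaled [OF g _ this] show ?thesis
    using e Y by (simp add: Tang uniform_limit_singleton)
next
  case (Pt p)
  have "p \<in> Ycurve" using e by (simp add: Pt)
  then have "isCont (moebius_act g) p"
    using moebius_act_has_derivative [OF g] DERIV_isCont by blast
  then show ?thesis
    using isCont_tendsto_compose [of p "moebius_act g" \<gamma>] lim by (simp add: Pt)
qed

lemma moebius_is_path:
  assumes g: "det g = 1" and v: "is_path (Tang a b) f v"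
  shows "is_path (end_act g (Tang a b)) (end_act g f) (moebius_act g \<circ> v)"
proof -
  let ?e = "Tang a b"
  have v': "proper_end ?e" "proper_end f" "v ` {0<..<1} \<subseteq> Ycurve"
    "\<And>\<epsilon>. 0 < \<epsilon> \<and> \<epsilon> < 1/2 \<Longrightarrow> v piecewise_C1_differentiable_on {trunc_lo ?e \<epsilon>..trunc_hi f \<epsilon>}"
    "((\<lambda>t. rescaled ?e t (v t)) \<longlongrightarrow> rescaled_lim ?e) (at_right 0)"
    "((\<lambda>t. rescaled f t (v (1 - t))) \<longlongrightarrow> rescaled_lim f) (at_right 0)"
    using v unfolding is_path_def by blast+
  have tr: "trunc_lo (end_act g d) \<epsilon> = trunc_lo d \<epsilon>" "trunc_hi (end_act g d) \<epsilon> = trunc_hi d \<epsilon>" for d \<epsilon>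
    by (cases d; simp add: trunc_hi_def)+
  have C1: "(\<lambda>t. moebius_act g (v t)) piecewise_C1_differentiable_on {trunc_lo ?e \<epsilon>..trunc_hi f \<epsilon>}"
    if \<epsilon>: "0 < \<epsilon> \<and> \<epsilon> < 1/2" for \<epsilon>
  proof (rule piecewise_C1_moebius [OF g v'(4) [OF \<epsilon>]])
    show "v ` {trunc_lo ?e \<epsilon>..trunc_hi f \<epsilon>} \<subseteq> Ycurve"
    proof
      fix y assume "y \<in> v ` {trunc_lo ?e \<epsilon>..trunc_hi f \<epsilon>}"
      then obtain t where t: "y = v t" "\<epsilon> \<le> t" "t \<le> trunc_hi f \<epsilon>" by auto
      show "y \<in> Ycurve"
      proof (cases "t < 1")
        case True
        then show ?thesis using v'(3) t \<epsilon> by auto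
      next
        case False
        then obtain p where p: "f = Pt p" "t = 1"
          using t \<epsilon> by (cases f) (auto simp: trunc_hi_def)
        have "v 1 = p" by (rule is_path_at_end [OF v [unfolded p(1)]])
        then show ?thesis using v'(2) t(1) p by simp
      qed
    qed
  qed
  have Y: "v t \<in> Ycurve" if "0 < t" "t < 1" for t using v'(3) that by auto
  have "is_path (end_act g ?e) (end_act g f) (\<lambda>t. moebius_act g (v t))"
    unfolding is_path_def tr
    using end_act_Tang_proper [OF g v'(1)] end_act_Tang_proper [OF g v'(2)] C1
      moebius_rescaled_pointwise [OF g v'(1,5)] moebius_rescaled_pointwise [OF g v'(2,6)]
      Y moebius_act_Ycurve [OF g]
    by (intro conjI allI impI) auto
  then show ?thesis by (simp add: o_def)
qed

lemma moebius_homotopic: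
  assumes g: "det g = 1" and hom: "path_homotopic (Tang a b) (Tang c d) v v'" and ends: "a \<noteq> b" "c \<noteq> d"
  shows "path_homotopic (end_act g (Tang a b)) (end_act g (Tang c d)) (moebius_act g \<circ> v) (moebius_act g \<circ> v')"
proof -
  obtain H :: "real \<times> real \<Rightarrow> complex" where H: "continuous_on ({0..1} \<times> {0<..<1}) H" "H ` ({0..1} \<times> {0<..<1}) \<subseteq> Ycurve"
    "\<forall>t\<in>{0<..<1}. H (0, t) = v t \<and> H (1, t) = v' t"
    "uniform_limit {0..1} (\<lambda>t s. rescaled (Tang a b) t (H (s, t))) (\<lambda>_. rescaled_lim (Tang a b)) (at_right 0)"
    "uniform_limit {0..1} (\<lambda>t s. rescaled (Tang c d) t (H (s, 1 - t))) (\<lambda>_. rescaled_lim (Tang c d)) (at_right 0)"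
    by (rule path_homotopicE [OF hom])
  let ?G = "\<lambda>x. moebius_act g (H x)"
  have Y: "H (s, t) \<in> Ycurve" if "s \<in> {0..1}" "0 < t" "t < 1" for s t
    using H(2) that by auto
  have "continuous_on ({0..1} \<times> {0<..<1}) ?G"
    by (rule continuous_on_compose2 [OF holomorphic_on_imp_continuous_on [OF moebius_act_holomorphic [OF g]] H(1,2)])
  moreover have "?G ` ({0..1} \<times> {0<..<1}) \<subseteq> Ycurve"
    using H(2) moebius_act_Ycurve [OF g] by blast
  moreover have "\<forall>t\<in>{0<..<1}. ?G (0, t) = (moebius_act g \<circ> v) t \<and> ?G (1, t) = (moebius_act g \<circ> v') t"
    using H(3) by simp
  moreover have "uniform_limit {0..1} (\<lambda>t s. rescaled (end_act g (Tang a b)) t (?G (s, t)))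
      (\<lambda>_. rescaled_lim (end_act g (Tang a b))) (at_right 0)"
    using moebius_rescaled [OF g ends(1), where S = "{0..1}" and G = "\<lambda>s t. H (s, t)"] H(4) Y by simp
  moreover have "uniform_limit {0..1} (\<lambda>t s. rescaled (end_act g (Tang c d)) t (?G (s, 1 - t)))
      (\<lambda>_. rescaled_lim (end_act g (Tang c d))) (at_right 0)"
    using moebius_rescaled [OF g ends(2), where S = "{0..1}" and G = "\<lambda>s t. H (s, 1 - t)"] H(5) Y by simp
  ultimately show ?thesis
    unfolding path_homotopic_def by (intro exI [of _ ?G] conjI)
qed

subsection \<open>Invariance of the Chen series\<close>

text \<open>
  The invariance of the connection form turns flat sections into flat sections.
\<close>

lemma flat_on_moebius:
  assumes g: "det g = 1" and \<Psi>: "flat_on V \<Psi>" "open V"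
  shows "flat_on {z \<in> Ycurve. moebius_act g z \<in> V} (\<lambda>z. nc_subst (\<Psi> (moebius_act g z)) (var_act g))"
  unfolding flat_on_def
proof (intro ballI conjI allI)
  let ?M = "moebius_act g" and ?Z = "var_act g"
  fix z j v assume z: "z \<in> {z \<in> Ycurve. ?M z \<in> V}"
  then have Mz: "?M z \<in> V" by simp
  show "nc_subst (\<Psi> (?M z)) ?Z [] = 1"
    by (simp add: nc_subst_Nil flat_on_Nil [OF \<Psi>(1) Mz])
  obtain M' where M': "(?M has_field_derivative M') (at z)"
    "?Z L0 [j] * (form_coeff L0 (?M z) * M') + ?Z L1 [j] * (form_coeff L1 (?M z) * M') = form_coeff j z"
    using moebius_act_has_derivative [OF g, of z] z by blast
  have D: "((\<lambda>z. nc_subst (\<lambda>u. \<Psi> (?M z) (i # u)) ?Z v) has_field_derivative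
      - (form_coeff i (?M z) * M') * nc_subst (\<Psi> (?M z)) ?Z v) (at z)" for i
  proof -
    have "((\<lambda>z. nc_subst (\<lambda>u. \<Psi> (?M z) (i # u)) ?Z v) has_field_derivative
        (\<Sum>w | length w \<le> length v. (- form_coeff i (?M z) * \<Psi> (?M z) w * M') * nc_word ?Z w v)) (at z)"
      unfolding nc_subst_def
      by (intro DERIV_sum DERIV_cmult_right DERIV_chain2 [OF flat_on_Cons [OF \<Psi>(1) Mz] M'(1)])
    then show ?thesis
      by (simp add: nc_subst_def sum_distrib_left sum_negf mult_ac)
  qed
  have "((\<lambda>z. nc_subst (\<Psi> (?M z)) ?Z (j # v)) has_field_derivative
      ?Z L0 [j] * (- (form_coeff L0 (?M z) * M') * nc_subst (\<Psi> (?M z)) ?Z v) +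
      ?Z L1 [j] * (- (form_coeff L1 (?M z) * M') * nc_subst (\<Psi> (?M z)) ?Z v)) (at z)"
    unfolding nc_subst_Cons [OF linear_var_act] by (intro DERIV_add DERIV_cmult D)
  then show "((\<lambda>z. nc_subst (\<Psi> (?M z)) ?Z (j # v)) has_field_derivative
      - form_coeff j z * nc_subst (\<Psi> (?M z)) ?Z v) (at z)"
    unfolding M'(2) [symmetric] by (simp add: algebra_simps)
qed

lemma lifted_moebius:
  assumes g: "det g = 1" and \<Phi>: "lifted \<Phi> (\<lambda>k. moebius_act g (h k)) K"
    and h: "continuous_on K h" "h ` K \<subseteq> Ycurve"
  shows "lifted (\<lambda>k. nc_subst (\<Phi> k) (var_act g)) h K"
proof (rule lifted_local)
  fix k assume k: "k \<in> K"
  let ?M = "moebius_act g"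
  obtain N V \<Psi> where N: "openin (top_of_set K) N" "k \<in> N" "open V" "convex V"
    "flat_on V \<Psi>" "(\<lambda>k. ?M (h k)) ` N \<subseteq> V" "\<forall>x\<in>N. \<Phi> x = \<Psi> (?M (h x))"
    by (rule liftedE [OF \<Phi> k])
  have NK: "N \<subseteq> K" using N(1) by (rule openin_imp_subset)
  have op: "open {z \<in> Ycurve. ?M z \<in> V}"
    using continuous_open_preimage [OF holomorphic_on_imp_continuous_on [OF moebius_act_holomorphic [OF g]]
        open_Ycurve N(3)]
    by (simp add: vimage_def Int_def)
  have "lifted (\<lambda>k. nc_subst (\<Psi> (?M (h k))) (var_act g)) h N"
    by (rule lifted_flat [OF flat_on_moebius [OF g N(5,3)] op continuous_on_subset [OF h(1) NK]])
      (use N(6) h(2) NK in auto)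
  then show "\<exists>N \<Phi>' h'. openin (top_of_set K) N \<and> k \<in> N \<and> lifted \<Phi>' h' N \<and>
      (\<forall>x\<in>N. nc_subst (\<Phi> x) (var_act g) = \<Phi>' x \<and> h x = h' x)"
    using N(1,2,7)
    by (intro exI [of _ N] exI [of _ "\<lambda>k. nc_subst (\<Psi> (?M (h k))) (var_act g)"] exI [of _ h]) simp
qed

text \<open>
  Both Chen series are read off from a lift along the transformed path and from its image under
  the substitution, which is a lift along the given path.
\<close>

lemma chen_series_moebius:
  assumes g: "det g = 1" and ab: "a \<le> b"
    and \<gamma>: "\<gamma> piecewise_C1_differentiable_on {a..b}" "\<gamma> ` {a..b} \<subseteq> Ycurve"
  shows "nc_subst (chen_series (moebius_act g \<circ> \<gamma>) a b) (var_act g) = chen_series \<gamma> a b"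
proof -
  let ?M\<gamma> = "\<lambda>t. moebius_act g (\<gamma> t)" and ?Z = "var_act g"
  have C1: "?M\<gamma> piecewise_C1_differentiable_on {a..b}" by (rule piecewise_C1_moebius [OF g \<gamma>])
  have cont: "continuous_on {a..b} \<gamma>" "continuous_on {a..b} ?M\<gamma>"
    using \<gamma>(1) C1 by (simp_all add: piecewise_C1_differentiable_on_def)
  obtain \<Phi> where \<Phi>: "lifted \<Phi> ?M\<gamma> {a..b}"
    using lifted_exists_compact [OF _ _ cont(2), of a] \<gamma>(2) moebius_act_Ycurve [OF g] ab by fastforce
  have "chen_series ?M\<gamma> a b = \<Phi> a \<star> nc_inv (\<Phi> b)"
    by (rule chen_series_lifted [OF C1 \<Phi> ab])
  then have "nc_subst (chen_series ?M\<gamma> a b) ?Z = nc_subst (\<Phi> a) ?Z \<star> nc_inv (nc_subst (\<Phi> b) ?Z)"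
    using nc_subst_mult [OF linear_var_act] nc_subst_inv [of ?Z "\<Phi> b", OF linear_var_act lifted_Nil [OF \<Phi>]] ab
    by simp
  also have "\<dots> = chen_series \<gamma> a b"
    by (rule chen_series_lifted [OF \<gamma>(1) lifted_moebius [OF g \<Phi> cont(1) \<gamma>(2)] ab, symmetric])
  finally show ?thesis by (simp add: o_def)
qed

lemma nc_subst_reg_factor:
  assumes g: "det g = 1"
  shows "nc_subst (reg_factor (end_act g e) c) (var_act g) = reg_factor e c"
  by (cases e)
    (simp_all add: nc_subst_one nc_subst_exp [OF linear_var_act linear_cusp_residue linear_cusp_residue
        var_act_cusp_residue [OF g]])

lemma has_chen_series_moebius:
  assumes g: "det g = 1" and \<gamma>: "is_path (Tang a b) (Pt p) \<gamma>"
    and S: "has_chen_series (end_act g (Tang a b)) (end_act g (Pt p)) (moebius_act g \<circ> \<gamma>) S"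
  shows "has_chen_series (Tang a b) (Pt p) \<gamma> (nc_subst S (var_act g))"
  unfolding has_chen_series_def
proof
  fix w
  let ?e = "Tang a b" and ?f = "Pt p" and ?Z = "var_act g"
  let ?L = "\<lambda>\<epsilon>. reg_factor (end_act g ?e) (of_real (ln \<epsilon>)) \<star>
    chen_series (moebius_act g \<circ> \<gamma>) (trunc_lo (end_act g ?e) \<epsilon>) (trunc_hi (end_act g ?f) \<epsilon>) \<star>
    reg_factor (end_act g ?f) (- of_real (ln \<epsilon>))"
  let ?R = "\<lambda>\<epsilon>. reg_factor ?e (of_real (ln \<epsilon>)) \<star> chen_series \<gamma> (trunc_lo ?e \<epsilon>) (trunc_hi ?f \<epsilon>) \<star>
    reg_factor ?f (- of_real (ln \<epsilon>))"
  have "((\<lambda>\<epsilon>. nc_subst (?L \<epsilon>) ?Z w) \<longlongrightarrow> nc_subst S ?Z w) (at_right 0)"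
    using S unfolding has_chen_series_def by (intro nc_subst_tendsto) blast
  moreover have "\<forall>\<^sub>F \<epsilon> in at_right 0. \<epsilon> \<in> {0<..<1/2 :: real}"
    by (rule eventually_at_right_real) simp
  then have "\<forall>\<^sub>F \<epsilon> in at_right 0. nc_subst (?L \<epsilon>) ?Z w = ?R \<epsilon> w"
  proof eventually_elim
    case (elim \<epsilon>)
    have C1: "\<gamma> piecewise_C1_differentiable_on {\<epsilon>..1}"
      using \<gamma> elim unfolding is_path_def by (simp add: trunc_hi_def)
    have "\<gamma> t \<in> Ycurve" if t: "t \<in> {\<epsilon>..1}" for t
    proof (cases "t = 1")
      case True
      then show ?thesis using is_path_at_end [OF \<gamma>] \<gamma> by (simp add: is_path_def)
    next
      case False
      then have "t \<in> {0<..<1}" using t elim by simp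
      then show ?thesis using \<gamma> unfolding is_path_def by blast
    qed
    then have "nc_subst (chen_series (moebius_act g \<circ> \<gamma>) \<epsilon> 1) ?Z = chen_series \<gamma> \<epsilon> 1"
      using elim by (intro chen_series_moebius [OF g _ C1]) auto
    then have "nc_subst (?L \<epsilon>) ?Z = ?R \<epsilon>"
      unfolding nc_subst_mult [OF linear_var_act] nc_subst_reg_factor [OF g] by (simp add: trunc_hi_def)
    then show ?case by simp
  qed
  ultimately show "((\<lambda>\<epsilon>. ?R \<epsilon> w) \<longlongrightarrow> nc_subst S ?Z w) (at_right 0)"
    by (rule Lim_transform_eventually)
qed

section \<open>Direct paths\<close>

text \<open>
  Properties of the gaps that do not depend on which of the three intervals is concerned.
\<close>

lemma cusp_gap_interval:
  assumes "a \<noteq> b"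
  obtains J :: "real set" where "cusp_gap a b = of_real ` J" "open J" "convex J" "J \<noteq> {}" "0 \<notin> J" "1 \<notin> J"
    "\<And>z. z \<in> end_nbhd (Tang a b) \<Longrightarrow> Im z = 0 \<Longrightarrow> Re z \<in> J"
proof -
  have ball: "Re c - r < Re z \<and> Re z < Re c + r" if "z \<in> ball c r" for c z :: complex and r
  proof -
    have "\<bar>Re (c - z)\<bar> < r" using abs_Re_le_cmod [of "c - z"] that by (simp add: dist_norm)
    then show ?thesis by (auto simp: abs_less_iff)
  qed
  consider "a = C0" "b = C1" | "a = C0" "b = Cinf" | "a = C1" "b = C0" | "a = C1" "b = Cinf"
    | "a = Cinf" "b = C0" | "a = Cinf" "b = C1"
    using assms by (cases a; cases b) auto
  then show thesis
  proof cases
    case 1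
    show ?thesis by (rule that [of "{0<..<1}"]) (auto simp: 1 simp del: mem_ball dest!: ball)
  next
    case 2
    show ?thesis by (rule that [of "{..<0}"]) (auto simp: 2 simp del: mem_ball dest!: ball)
  next
    case 3
    show ?thesis by (rule that [of "{0<..<1}"]) (auto simp: 3 simp del: mem_ball dest!: ball)
  next
    case 4
    show ?thesis by (rule that [of "{1<..}"]) (auto simp: 4 simp del: mem_ball dest!: ball)
  next
    case 5
    show ?thesis by (rule that [of "{..<0}"]) (auto simp: 5)
  next
    case 6
    show ?thesis by (rule that [of "{1<..}"]) (auto simp: 6)
  qed
qed

text \<open>
  The plane slit along the two other real segments is starlike about every point of the remaining
  one.
\<close>

lemma slit_plane:
  assumes ab: "a \<noteq> b"
  shows "open (- \<real> \<union> cusp_gap a b)" "starlike (- \<real> \<union> cusp_gap a b)" "- \<real> \<union> cusp_gap a b \<subseteq> Ycurve"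
    "end_nbhd (Tang a b) \<subseteq> - \<real> \<union> cusp_gap a b"
proof -
  obtain J :: "real set" where J: "cusp_gap a b = of_real ` J" "open J" "convex J" "J \<noteq> {}" "0 \<notin> J" "1 \<notin> J"
    "\<And>z. z \<in> end_nbhd (Tang a b) \<Longrightarrow> Im z = 0 \<Longrightarrow> Re z \<in> J"
    using cusp_gap_interval [OF ab] by metis
  have W: "- \<real> \<union> cusp_gap a b = {z. Im z = 0 \<longrightarrow> Re z \<in> J}"
    unfolding J(1) by (auto simp: complex_is_Real_iff image_iff complex_eq_iff)
  have "closed ({z. Im z = 0} \<inter> Re -` (- J))"
    by (intro closed_Int closed_Collect_eq continuous_intros closed_vimage closed_Compl J(2))
  moreover have "- ({z. Im z = 0} \<inter> Re -` (- J)) = {z. Im z = 0 \<longrightarrow> Re z \<in> J}" by auto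
  ultimately show "open (- \<real> \<union> cusp_gap a b)" unfolding W by (metis open_Compl)
  obtain x where x: "x \<in> J" using J(4) by blast
  have "closed_segment (of_real x) z \<subseteq> {z. Im z = 0 \<longrightarrow> Re z \<in> J}" if z: "Im z = 0 \<longrightarrow> Re z \<in> J" for z
  proof
    fix y assume "y \<in> closed_segment (of_real x) z"
    then obtain u where u: "0 \<le> u" "u \<le> 1" "y = (1 - u) *\<^sub>R of_real x + u *\<^sub>R z"
      by (auto simp: in_segment)
    show "y \<in> {z. Im z = 0 \<longrightarrow> Re z \<in> J}"
    proof (cases "u = 0")
      case True
      then show ?thesis using u x by simp
    next
      case False
      then show ?thesis
        using convexD_alt [OF J(3) x, of "Re z" u] z u by simp
    qed
  qed
  then show "starlike (- \<real> \<union> cusp_gap a b)"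
    unfolding W starlike_def using x by (intro bexI [of _ "of_real x"]) auto
  show "- \<real> \<union> cusp_gap a b \<subseteq> Ycurve"
    unfolding W using J(5,6) by (auto simp: Ycurve_iff)
  show "end_nbhd (Tang a b) \<subseteq> - \<real> \<union> cusp_gap a b"
    unfolding W using J(7) by auto
qed

text \<open>
  All direct paths run in a slit plane, which carries a global flat section. Comparing this one
  section with the sections of the two ends gives the transport along all direct paths at once.
\<close>

lemma direct_paths_transports:
  assumes ab: "a \<noteq> b" and p: "p \<in> - \<real> \<union> cusp_gap a b"
  shows "\<exists>S. \<forall>\<gamma>\<in>direct_paths (Tang a b) p. is_path (Tang a b) (Pt p) \<gamma> \<and> transports (Tang a b) (Pt p) \<gamma> S"
proof -
  let ?W = "- \<real> \<union> cusp_gap a b" and ?e = "Tang a b"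
  note W = slit_plane [OF ab]
  have e: "proper_end ?e" using ab by simp
  have pY: "p \<in> Ycurve" using p W(3) by blast
  then have f: "proper_end (Pt p)" by simp
  obtain \<Psi> where \<Psi>: "flat_on ?W \<Psi>" "\<Psi> p = nc_one"
    using flat_on_exists [OF W(2,1,3)] by blast
  obtain S where S: "S [] = 1" "\<And>x. x \<in> end_nbhd ?e \<Longrightarrow> \<Psi> x = end_section ?e x \<star> S"
    using flat_on_eq_mult_const [OF convex_connected [OF convex_end_nbhd] open_end_nbhd
      flat_on_subset [OF \<Psi>(1) W(4)] flat_end_section [OF e]] by metis
  have pU: "p \<in> end_nbhd (Pt p)" using pY by (simp add: Ycurve_iff)
  then obtain r where r: "r > 0" "ball p r \<subseteq> ?W \<inter> end_nbhd (Pt p)"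
    using openE [OF open_Int [OF W(1) open_end_nbhd], of p "Pt p"] p by (metis IntI)
  have near: "\<Psi> x = end_section (Pt p) x" if "x \<in> ball p r" for x
    by (rule flat_on_unique [OF _ open_ball flat_on_subset [OF \<Psi>(1)] flat_on_subset [OF flat_end_section [OF f]],
        where z = p, OF _ _ _ _ _ that])
      (use r \<Psi>(2) end_section_Pt [OF pY] in auto)
  have "is_path ?e (Pt p) \<gamma> \<and> transports ?e (Pt p) \<gamma> S" if \<gamma>: "\<gamma> \<in> direct_paths ?e p" for \<gamma>
  proof
    show path: "is_path ?e (Pt p) \<gamma>" using \<gamma> by (simp add: direct_paths_def)
    have \<gamma>W: "\<gamma> ` {0<..1} \<subseteq> ?W"
      using \<gamma> unfolding direct_paths_def by (auto split: if_splits)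
    have lim: "((\<lambda>t. rescaled ?e t (\<gamma> t)) \<longlongrightarrow> rescaled_lim ?e) (at_right 0)"
      "((\<lambda>t. \<gamma> (1 - t)) \<longlongrightarrow> p) (at_right 0)"
      using path by (simp_all add: is_path_def)
    have 1: "lifted (\<lambda>t. \<Psi> (\<gamma> t)) \<gamma> {0<..<1}"
      by (rule lifted_flat [OF \<Psi>(1) W(1) is_path_continuous [OF path]]) (use \<gamma>W in force)
    obtain \<eta> where \<eta>: "\<eta> > 0" "\<forall>t z. 0 < t \<longrightarrow> t < \<eta> \<longrightarrow> dist (rescaled ?e t z) (rescaled_lim ?e) < \<eta> \<longrightarrow> z \<in> end_nbhd ?e"
      using eventually_end_nbhd [OF e] by blast
    have "\<forall>\<^sub>F t in at_right 0. t \<in> {0<..<\<eta>}"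
      by (rule eventually_at_right_real) (rule \<eta>)
    with tendstoD [OF lim(1) \<eta>(1)]
    have 2: "\<forall>\<^sub>F t in at_right 0. \<gamma> t \<in> end_nbhd ?e \<and> \<Psi> (\<gamma> t) = end_section ?e (\<gamma> t) \<star> S"
    proof eventually_elim
      case (elim t)
      then have "\<gamma> t \<in> end_nbhd ?e" using \<eta>(2) by auto
      then show ?case using S(2) by blast
    qed
    from tendstoD [OF lim(2) r(1)]
    have 3: "\<forall>\<^sub>F t in at_right 0. \<gamma> (1 - t) \<in> end_nbhd (Pt p) \<and> \<Psi> (\<gamma> (1 - t)) = end_section (Pt p) (\<gamma> (1 - t))"
    proof eventually_elim
      case (elim t)
      then have "\<gamma> (1 - t) \<in> ball p r" by (simp add: dist_commute)
      then show ?case using near r(2) by blast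
    qed
    show "transports ?e (Pt p) \<gamma> S"
      unfolding transports_def using S(1) 1 2 3 by (intro conjI exI [of _ "\<lambda>t. \<Psi> (\<gamma> t)"])
  qed
  then show ?thesis by blast
qed

text \<open>
  This parabola leaves 0 in the direction of 1 and ends in \<open>z\<close>. Its imaginary part is \<open>t\<^sup>2\<close> times
  that of \<open>z\<close>, so it meets the real axis only if it is contained in it.
\<close>

lemma direct_path_parabola:
  fixes z :: complex
  defines "\<gamma> \<equiv> \<lambda>t. of_real (t * (1 - t)) + z * of_real (t\<^sup>2)"
  assumes z: "z \<in> - \<real> \<union> cusp_gap C0 C1"
  shows "\<gamma> \<in> direct_paths (Tang C0 C1) z"
proof -
  have Im: "Im (\<gamma> t) = Im z * t\<^sup>2" and Re: "Re (\<gamma> t) = t * (1 - t) + Re z * t\<^sup>2" for t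
    by (simp_all add: \<gamma>_def)
  have real: "\<gamma> t \<in> cusp_gap C0 C1" if zr: "z \<in> \<real>" and t: "t \<in> {0<..1}" for t
  proof -
    obtain x where x: "z = of_real x" "0 < x" "x < 1" using z zr by auto
    have eq: "\<gamma> t = of_real (t * (1 - t * (1 - x)))"
      by (simp add: \<gamma>_def x(1) power2_eq_square algebra_simps)
    have "t * (1 - x) \<le> 1 * (1 - x)" using t x by (intro mult_right_mono) auto
    also have "\<dots> < 1" using x by simp
    finally have "t * (1 - x) < 1" .
    then have "0 < t * (1 - t * (1 - x))" using t by simp
    moreover have "t * (1 - t * (1 - x)) < 1 * 1"
    proof (rule mult_le_less_imp_less)
      show "t \<le> 1" "0 < t" using t by auto
      show "1 - t * (1 - x) < 1" using t x by simp
      show "0 \<le> 1 - t * (1 - x)" using \<open>t * (1 - x) < 1\<close> by simp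
    qed
    ultimately show ?thesis unfolding eq cusp_gap.simps by (intro imageI) simp
  qed
  have nonreal: "\<gamma> t \<in> - \<real>" if "z \<notin> \<real>" "t \<in> {0<..1}" for t
    using that Im [of t] by (auto simp: complex_is_Real_iff)
  have W: "\<gamma> t \<in> - \<real> \<union> cusp_gap C0 C1" if "t \<in> {0<..1}" for t
    using real nonreal that by blast
  have Y: "\<gamma> t \<in> Ycurve" if "t \<in> {0<..1}" for t
    using W [OF that] slit_plane(3) [of C0 C1] by blast
  have zY: "z \<in> Ycurve" using z slit_plane(3) [of C0 C1] by blast
  have C1: "\<gamma> piecewise_C1_differentiable_on A" for A
  proof -
    have "(\<gamma> has_vector_derivative of_real (1 - 2 * t) + z * of_real (2 * t)) (at t)" for t
    proof -
      have d1: "((\<lambda>t. complex_of_real (t * (1 - t))) has_vector_derivative of_real (1 - 2 * t)) (at t)"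
        by (rule has_vector_derivative_of_real) (auto intro!: derivative_eq_intros)
      have d2: "((\<lambda>t. complex_of_real (t\<^sup>2)) has_vector_derivative of_real (2 * t)) (at t)"
        by (rule has_vector_derivative_of_real) (auto intro!: derivative_eq_intros)
      show ?thesis
        unfolding \<gamma>_def by (intro has_vector_derivative_add d1 has_vector_derivative_mult_right d2)
    qed
    moreover have "continuous_on A (\<lambda>t. of_real (1 - 2 * t) + z * of_real (2 * t))"
      by (intro continuous_intros)
    ultimately show ?thesis
      by (intro C1_differentiable_imp_piecewise)
        (auto simp: C1_differentiable_on_def intro!: exI [of _ "\<lambda>t. of_real (1 - 2 * t) + z * of_real (2 * t)"])
  qed
  have "((\<lambda>t. of_real (1 - t) + z * of_real t) \<longlongrightarrow> of_real (1 - 0) + z * of_real 0) (at_right (0 :: real))"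
    by (intro tendsto_intros)
  moreover have "\<forall>\<^sub>F t in at_right 0. of_real (1 - t) + z * of_real t = \<gamma> t / of_real t"
    using eventually_at_right_less [of "0 :: real"]
    by eventually_elim (simp add: \<gamma>_def power2_eq_square field_simps)
  ultimately have "((\<lambda>t. \<gamma> t / of_real t) \<longlongrightarrow> of_real (1 - 0) + z * of_real 0) (at_right (0 :: real))"
    by (rule Lim_transform_eventually)
  then have l0: "((\<lambda>t. \<gamma> t / of_real t) \<longlongrightarrow> 1) (at_right (0 :: real))" by simp
  have "((\<lambda>t. \<gamma> (1 - t)) \<longlongrightarrow> of_real ((1 - 0) * (1 - (1 - 0))) + z * of_real ((1 - 0)\<^sup>2)) (at_right (0 :: real))"
    unfolding \<gamma>_def by (intro tendsto_intros)
  then have l1: "((\<lambda>t. \<gamma> (1 - t)) \<longlongrightarrow> z) (at_right (0 :: real))" by simp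
  have "is_path (Tang C0 C1) (Pt z) \<gamma>"
    unfolding is_path_def using C1 l0 l1 zY Y by auto
  then show ?thesis
    unfolding direct_paths_def using real nonreal by auto
qed

lemma direct_path_moebius:
  assumes g: "det g = 1" and \<gamma>: "\<gamma> \<in> direct_paths (Tang C0 C1) z"
  shows "moebius_act g \<circ> \<gamma> \<in> direct_paths (end_act g (Tang C0 C1)) (moebius_act g z)"
proof -
  have path: "is_path (Tang C0 C1) (Pt z) \<gamma>" using \<gamma> by (simp add: direct_paths_def)
  have zY: "z \<in> Ycurve" using path by (simp add: is_path_def)
  note iff = moebius_act_Reals_iff [OF g]
  have sub: "if z \<in> \<real> then \<gamma> ` {0<..1} \<subseteq> - \<real> \<union> cusp_gap C0 C1 else \<gamma> ` {0<..1} \<subseteq> - \<real>"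
    using \<gamma> unfolding direct_paths_def by fastforce
  have Y: "\<gamma> t \<in> Ycurve" if "t \<in> {0<..1}" for t
  proof -
    have "\<gamma> ` {0<..1} \<subseteq> - \<real> \<union> cusp_gap C0 C1" using sub by (auto split: if_splits)
    then show ?thesis using that slit_plane(3) [of C0 C1] by blast
  qed
  have A: "moebius_act g (\<gamma> t) \<in> - \<real> \<union> cusp_gap (cusp_act g C0) (cusp_act g C1)"
    if "z \<in> \<real>" "t \<in> {0<..1}" for t
  proof (cases "\<gamma> t \<in> \<real>")
    case True
    have "\<gamma> ` {0<..1} \<subseteq> - \<real> \<union> cusp_gap C0 C1" using sub that(1) by (simp only: if_True)
    then have "\<gamma> t \<in> cusp_gap C0 C1" using True that(2) by blast
    then show ?thesis using moebius_act_cusp_gap [OF g] by blast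
  next
    case False
    then show ?thesis using iff [OF Y [OF that(2)]] by simp
  qed
  have B: "moebius_act g (\<gamma> t) \<in> - \<real>" if "z \<notin> \<real>" "t \<in> {0<..1}" for t
  proof -
    have "\<gamma> ` {0<..1} \<subseteq> - \<real>" using sub that(1) by simp
    then have "\<gamma> t \<notin> \<real>" using that(2) by blast
    then show ?thesis using iff [OF Y [OF that(2)]] by simp
  qed
  have "if moebius_act g z \<in> \<real>
    then (moebius_act g \<circ> \<gamma>) ` {0<..1} \<subseteq> - \<real> \<union> cusp_gap (cusp_act g C0) (cusp_act g C1)
    else (moebius_act g \<circ> \<gamma>) ` {0<..1} \<subseteq> - \<real>"
  proof (cases "z \<in> \<real>")
    case True
    then show ?thesis using iff [OF zY] A by (simp only: image_subset_iff o_apply) simp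
  next
    case False
    then show ?thesis using iff [OF zY] B by (simp only: image_subset_iff o_apply) simp
  qed
  then show ?thesis
    using moebius_is_path [OF g path] unfolding direct_paths_def by simp
qed

section \<open>The endpoint of a path class\<close>

text \<open>
  These are the paths that define \<open>s_class\<close> and \<open>r_class\<close>.
\<close>

lemma path_class_rs:
  "is_path (Tang C0 C1) (Tang C1 C0) of_real"
  "is_path (Tang C0 C1) (Tang C0 Cinf) (\<lambda>t. of_real (t * (1 - t)) * exp (\<i> * of_real (pi * t)))"
proof -
  have ne: "\<forall>\<^sub>F t in at_right 0. (t :: real) \<noteq> 0"
    using eventually_at_right_less [of "0 :: real"] by eventually_elim simp
  have "((\<lambda>t. complex_of_real t / of_real t) \<longlongrightarrow> 1) (at_right 0)"
    by (rule Lim_transform_eventually [OF tendsto_const [of 1]]) (use ne in eventually_elim, simp)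
  moreover have "of_real t \<in> Ycurve" if "0 < t" "t < 1" for t :: real
    using that by (simp add: Ycurve_iff)
  ultimately show "is_path (Tang C0 C1) (Tang C1 C0) of_real"
    by (auto simp: is_path_def piecewise_C1_differentiable_on_of_real)
  let ?r = "\<lambda>t. complex_of_real (t * (1 - t)) * exp (\<i> * of_real (pi * t))"
  have Y: "?r t \<in> Ycurve" if t: "0 < t" "t < 1" for t
  proof -
    have "norm (?r t) = \<bar>t * (1 - t)\<bar> * 1"
      by (simp only: norm_mult norm_of_real norm_exp_i_times abs_mult)
    then have "norm (?r t) = t * (1 - t)" using t by (simp add: abs_mult)
    moreover have "t * (1 - t) < 1 * 1" using t by (intro mult_strict_mono) auto
    ultimately have "?r t \<noteq> 1" "?r t \<noteq> 0" using t by (metis less_irrefl mult_1 norm_one, simp)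
    then show ?thesis by (simp add: Ycurve_iff)
  qed
  have C1: "?r piecewise_C1_differentiable_on A" for A
  proof -
    let ?d = "\<lambda>t. of_real (1 - 2 * t) * exp (\<i> * of_real (pi * t)) +
      of_real (t * (1 - t)) * (\<i> * of_real pi * exp (\<i> * of_real (pi * t)))"
    have "(?r has_vector_derivative ?d t) (at t)" for t
    proof -
      have "((\<lambda>z. (z * (1 - z)) * exp (\<i> * (of_real pi * z))) has_field_derivative ?d t) (at (of_real t))"
        by (rule derivative_eq_intros refl | simp add: algebra_simps)+
      from field_vector_diff_chain_at [OF has_vector_derivative_of_real [OF DERIV_ident] this]
      show ?thesis by (simp add: o_def)
    qed
    moreover have "continuous_on A ?d" by (intro continuous_intros)
    ultimately show ?thesis
      by (intro C1_differentiable_imp_piecewise) (auto simp: C1_differentiable_on_def intro!: exI [of _ ?d])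
  qed
  have "((\<lambda>t. of_real (1 - t) * exp (\<i> * of_real (pi * t))) \<longlongrightarrow> of_real (1 - 0) * exp (\<i> * of_real (pi * 0))) (at_right 0)"
    by (intro tendsto_intros)
  then have "((\<lambda>t. of_real (1 - t) * exp (\<i> * of_real (pi * t))) \<longlongrightarrow> 1) (at_right 0)" by simp
  then have 1: "((\<lambda>t. ?r t / of_real t) \<longlongrightarrow> 1) (at_right 0)"
    by (rule Lim_transform_eventually) (use ne in eventually_elim, simp)
  have "((\<lambda>t. - (of_real (1 - t) * exp (\<i> * of_real (pi * (1 - t))))) \<longlongrightarrow> - (of_real (1 - 0) * exp (\<i> * of_real (pi * (1 - 0))))) (at_right 0)"
    by (intro tendsto_intros)
  moreover have "exp (\<i> * complex_of_real pi) = -1" by (simp add: mult.commute)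
  ultimately have "((\<lambda>t. - (of_real (1 - t) * exp (\<i> * of_real (pi * (1 - t))))) \<longlongrightarrow> 1) (at_right 0)" by simp
  then have 2: "((\<lambda>t. - ?r (1 - t) / of_real t) \<longlongrightarrow> 1) (at_right 0)"
    by (rule Lim_transform_eventually) (use ne in eventually_elim, simp)
  show "is_path (Tang C0 C1) (Tang C0 Cinf) ?r"
    unfolding is_path_def using Y C1 1 2 by auto
qed

lemma G01_carrierE:
  assumes "x \<in> carrier G01"
  obtains a b \<gamma> where "x = (Tang a b, path_class (Tang C0 C1) (Tang a b) \<gamma>)" "a \<noteq> b"
    "is_path (Tang C0 C1) (Tang a b) \<gamma>"
proof -
  obtain f \<gamma> where x: "x = (f, path_class (Tang C0 C1) f \<gamma>)" "f \<in> range (case_prod Tang)" "is_path (Tang C0 C1) f \<gamma>"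
    using assms by (auto simp: G01_def)
  then obtain a b where f: "f = Tang a b" by auto
  then have "a \<noteq> b" using x(3) by (simp add: is_path_def)
  then show thesis using that [of a b \<gamma>] x(1,3) unfolding f by simp
qed

lemma G01_carrierI:
  assumes "is_path (Tang C0 C1) (Tang a b) \<gamma>"
  shows "(Tang a b, path_class (Tang C0 C1) (Tang a b) \<gamma>) \<in> carrier G01"
  using assms by (auto simp: G01_def intro!: exI [of _ \<gamma>])

text \<open>
  The endpoint of a product is the image of the second endpoint under the transformation that
  belongs to the first one.
\<close>

lemma G01_mult_closed:
  assumes g: "det g = 1" and y: "y \<in> carrier G01" "fst y = end_act g (Tang C0 C1)" and x: "x \<in> carrier G01"
  shows "y \<otimes>\<^bsub>G01\<^esub> x \<in> carrier G01" "fst (y \<otimes>\<^bsub>G01\<^esub> x) = end_act g (fst x)"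
proof -
  obtain c d \<gamma> where y': "y = (Tang c d, path_class (Tang C0 C1) (Tang c d) \<gamma>)" "c \<noteq> d"
    "is_path (Tang C0 C1) (Tang c d) \<gamma>"
    by (rule G01_carrierE [OF y(1)])
  obtain a b \<beta> where x': "x = (Tang a b, path_class (Tang C0 C1) (Tang a b) \<beta>)" "a \<noteq> b"
    "is_path (Tang C0 C1) (Tang a b) \<beta>"
    by (rule G01_carrierE [OF x])
  have cd: "end_act g (Tang C0 C1) = Tang c d" using y(2) y'(1) by simp
  have perm: "end_perm (Tang c d) = g" using end_perm_end_act [OF g] unfolding cd .
  obtain a' b' where ab': "end_act g (Tang a b) = Tang a' b'" by simp
  let ?A = "path_class (Tang C0 C1) (Tang c d) \<gamma>"
  let ?B = "(\<lambda>v. moebius_act g \<circ> v) ` path_class (Tang C0 C1) (Tang a b) \<beta>"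
  have prod: "y \<otimes>\<^bsub>G01\<^esub> x = (Tang a' b', concat_class (Tang C0 C1) (Tang a' b') ?A ?B)"
    unfolding G01_def y'(1) x'(1) by (simp add: Let_def perm flip: ab' del: end_act.simps)
  have "\<exists>w. is_path (Tang C0 C1) (Tang a' b') w \<and>
      concat_class (Tang C0 C1) (Tang a' b') ?A ?B = path_class (Tang C0 C1) (Tang a' b') w"
  proof (rule concat_class_eq_path_class)
    show "?A \<noteq> {}" using path_class_self [OF y'(3)] by blast
    show "?B \<noteq> {}" using path_class_self [OF x'(3)] by blast
    show "is_path (Tang C0 C1) (Tang c d) u" if "u \<in> ?A" for u using that by (simp add: path_class_def)
    show "path_homotopic (Tang C0 C1) (Tang c d) u u'" if "u \<in> ?A" "u' \<in> ?A" for u u'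
      using path_class_homotopic that by blast
    show "is_path (Tang c d) (Tang a' b') v" if "v \<in> ?B" for v
    proof -
      obtain u where "v = moebius_act g \<circ> u" "is_path (Tang C0 C1) (Tang a b) u"
        using \<open>v \<in> ?B\<close> by (auto simp: path_class_def)
      then show ?thesis using moebius_is_path [OF g, of C0 C1 "Tang a b" u] unfolding cd ab' by simp
    qed
    show "path_homotopic (Tang c d) (Tang a' b') v v'" if "v \<in> ?B" "v' \<in> ?B" for v v'
    proof -
      obtain u u' where u: "v = moebius_act g \<circ> u" "v' = moebius_act g \<circ> u'"
        "path_homotopic (Tang C0 C1) (Tang a b) u u'"
        using \<open>v \<in> ?B\<close> \<open>v' \<in> ?B\<close> path_class_homotopic by blast
      show ?thesis
        using moebius_homotopic [OF g u(3) _ x'(2)] by (simp add: u(1,2) cd ab' del: end_act.simps)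
    qed
  qed
  then show "y \<otimes>\<^bsub>G01\<^esub> x \<in> carrier G01" unfolding prod using G01_carrierI by metis
  show "fst (y \<otimes>\<^bsub>G01\<^esub> x) = end_act g (fst x)" unfolding prod by (simp add: x'(1) ab' del: end_act.simps)
qed

subsection \<open>Generators of the modular group\<close>

lemma mat2_uminus: "- mat2 a b c d = mat2 (- a) (- b) (- c) (- d :: 'a :: ab_group_add)"
  by (simp add: mat2_eq_iff)

text \<open>
  Euclid's algorithm on the first column, by descent on the absolute value of the lower left entry.
  Inverses of the generators are avoided, since up to sign \<open>T\<^bsup>-1\<^esup>\<close> is the word \<open>S T S T S\<close>.
\<close>

lemma SL2Z_generated:
  fixes P :: "int^2^2 \<Rightarrow> bool"
  assumes one: "P (mat 1)"
    and S: "\<And>A. P A \<Longrightarrow> P (mat2 0 (-1) 1 0 ** A)" and T: "\<And>A. P A \<Longrightarrow> P (mat2 1 1 0 1 ** A)"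
    and neg: "\<And>A. P A \<Longrightarrow> P (- A)"
  shows "det A = 1 \<Longrightarrow> P A"
proof (induction "nat \<bar>A $ 2 $ 1\<bar>" arbitrary: A rule: less_induct)
  case less
  obtain a b c d where A: "A = mat2 a b c d"
    using mat2_eq_iff [of A] by blast
  have det: "a * d - b * c = 1" using less.prems by (simp add: A det_mat2)
  have T': "P (mat2 1 (-1) 0 1 ** B)" if "P B" for B
  proof -
    obtain x y z w where B: "B = mat2 x y z w" using mat2_eq_iff [of B] by blast
    have "P (- (mat2 0 (-1) 1 0 ** (mat2 1 1 0 1 ** (mat2 0 (-1) 1 0 ** (mat2 1 1 0 1 ** (mat2 0 (-1) 1 0 ** B))))))"
      using that S T neg by blast
    then show ?thesis by (simp add: B mat2_mult mat2_uminus)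
  qed
  have Tk: "P (mat2 1 k 0 1 ** B)" if "P B" for k B
  proof (induction k rule: int_induct [where k = 0])
    case base
    have "mat2 1 0 0 1 ** B = B" by (metis mat_1_eq_mat2 matrix_mul_lid)
    then show ?case using that by simp
  next
    case (step1 i)
    have "mat2 1 1 0 1 ** (mat2 1 i 0 1 ** B) = mat2 1 (i + 1) 0 1 ** B"
      by (simp add: matrix_mul_assoc mat2_mult)
    then show ?case using T [OF step1(2)] by simp
  next
    case (step2 i)
    have "mat2 1 (-1) 0 1 ** (mat2 1 i 0 1 ** B) = mat2 1 (i - 1) 0 1 ** B"
      by (simp add: matrix_mul_assoc mat2_mult)
    then show ?case using T' [OF step2(2)] by simp
  qed
  show "P A"
  proof (cases "c = 0")
    case True
    then have "a * d = 1" using det by simp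
    then consider "a = 1" "d = 1" | "a = -1" "d = -1" by (auto simp: zmult_eq_1_iff)
    then show ?thesis
    proof cases
      case 1
      have "P (mat2 1 b 0 1 ** mat 1)" by (rule Tk [OF one])
      then show ?thesis by (simp add: A 1 True)
    next
      case 2
      have "P (- (mat2 1 (- b) 0 1 ** mat 1))" by (rule neg [OF Tk [OF one]])
      then show ?thesis by (simp add: A 2 True mat2_uminus)
    qed
  next
    case False
    define k where "k = a div c"
    \<comment> \<open>\<open>B\<close> is \<open>S T\<^bsup>-k\<^esup> A\<close>; its lower left entry is the remainder of \<open>a\<close> modulo \<open>c\<close>.\<close>
    define B where "B = mat2 (- c) (- d) (a - k * c) (b - k * d)"
    have "det B = 1" using det by (simp add: B_def det_mat2 algebra_simps)
    moreover have "\<bar>a - k * c\<bar> < \<bar>c\<bar>"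
      using abs_mod_less [OF False, of a] by (simp add: k_def minus_div_mult_eq_mod)
    then have "nat \<bar>B $ 2 $ 1\<bar> < nat \<bar>A $ 2 $ 1\<bar>" by (simp add: A B_def)
    ultimately have "P B" using less.hyps by blast
    then have "P (mat2 1 k 0 1 ** - (mat2 0 (-1) 1 0 ** B))" by (intro Tk neg S)
    then show ?thesis by (simp add: A B_def mat2_mult mat2_uminus algebra_simps)
  qed
qed

definition reduce_mod2 :: "int^2^2 \<Rightarrow> bit^2^2" where
  "reduce_mod2 A = (\<chi> i j. of_int (A $ i $ j))"

lemma reduce_mod2_mat2: "reduce_mod2 (mat2 a b c d) = mat2 (of_int a) (of_int b) (of_int c) (of_int d)"
  by (simp add: mat2_eq_iff reduce_mod2_def)

lemma reduce_mod2_uminus: "reduce_mod2 (- A) = reduce_mod2 A"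
  by (simp add: reduce_mod2_def vec_eq_iff)

lemma reduce_mod2_mult: "reduce_mod2 (A ** B) = reduce_mod2 A ** reduce_mod2 B"
  by (simp add: reduce_mod2_def vec_eq_iff matrix_matrix_mult_def)

lemma det_reduce_mod2: "det (reduce_mod2 A) = of_int (det A)"
  by (simp add: reduce_mod2_def det_2)

lemma reduction_pair: "reduction {A, - A} = reduce_mod2 A"
proof -
  have "(\<lambda>A. \<chi> i j. of_int (A $ i $ j)) ` {A, - A} = {reduce_mod2 A}"
    using reduce_mod2_uminus [of A] by (simp add: reduce_mod2_def)
  then show ?thesis unfolding reduction_def by simp
qed

lemma SL2Z_coset: "{mat 1, - mat 1} #>\<^bsub>SL2Z\<^esub> A = {A, - A}"
proof -
  have "- mat 1 ** A = - A"
    by (simp add: vec_eq_iff matrix_matrix_mult_def mat_def sum_negf if_distrib [of "\<lambda>x. x * _"] sum.delta cong: if_cong)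
  then show ?thesis by (simp add: r_coset_def SL2Z_def insert_commute)
qed

lemma PSL2Z_carrierE:
  assumes "\<alpha> \<in> carrier PSL2Z"
  obtains A where "det A = 1" "\<alpha> = {A, - A}"
  using assms by (auto simp: PSL2Z_def FactGroup_def RCOSETS_def SL2Z_coset) (auto simp: SL2Z_def)

lemma matrix_mult_uminus:
  "(- A) ** B = - (A ** B)" "A ** (- B) = - (A ** (B :: int^2^2))"
  by (simp_all add: vec_eq_iff matrix_matrix_mult_def sum_negf)

lemma PSL2Z_mult: "{A, - A} \<otimes>\<^bsub>PSL2Z\<^esub> {B, - B} = {A ** B, - (A ** B)}"
  by (auto simp: PSL2Z_def FactGroup_def set_mult_def SL2Z_def matrix_mult_uminus)

text \<open>
  Both the endpoint of a path class and the reduction modulo 2 are multiplicative, and they agree on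
  the generators. So they agree on all words in \<open>s\<close> and \<open>r\<close>, which exhaust the modular group.
\<close>

lemma path_element_endpoint:
  assumes \<Psi>: "\<Psi> \<in> iso G01 PSL2Z" "\<Psi> r_class = rho_psl" "\<Psi> s_class = sigma_psl"
    and \<alpha>: "\<alpha> \<in> carrier PSL2Z"
  shows "path_element \<Psi> \<alpha> \<in> carrier G01" "det (reduction \<alpha>) = 1"
    "fst (path_element \<Psi> \<alpha>) = end_act (reduction \<alpha>) (Tang C0 C1)"
proof -
  have hom: "\<Psi> (x \<otimes>\<^bsub>G01\<^esub> y) = \<Psi> x \<otimes>\<^bsub>PSL2Z\<^esub> \<Psi> y" if "x \<in> carrier G01" "y \<in> carrier G01" for x y
    using \<Psi>(1) that by (simp add: iso_def hom_def)
  have inj: "inj_on \<Psi> (carrier G01)" using \<Psi>(1) by (simp add: iso_def bij_betw_def)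
  let ?T = "Tang C0 C1"
  define Q where "Q = (\<lambda>A. \<exists>x\<in>carrier G01. \<Psi> x = {A, - A} \<and> fst x = end_act (reduce_mod2 A) ?T)"
  have step: "Q (B ** A)"
    if A: "Q A" and y: "y \<in> carrier G01" "\<Psi> y = {B, - B}" "fst y = end_act g ?T"
      and g: "det g = 1" "reduce_mod2 B = g" "\<And>f. det f = 1 \<Longrightarrow> end_act (g ** f) ?T = end_act g (end_act f ?T)"
      and d: "det A = 1" for A B g y
  proof -
    obtain x where x: "x \<in> carrier G01" "\<Psi> x = {A, - A}" "fst x = end_act (reduce_mod2 A) ?T"
      using A unfolding Q_def by blast
    have "\<Psi> (y \<otimes>\<^bsub>G01\<^esub> x) = {B ** A, - (B ** A)}"
      using hom [OF y(1) x(1)] by (simp add: y(2) x(2) PSL2Z_mult)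
    moreover have "fst (y \<otimes>\<^bsub>G01\<^esub> x) = end_act (reduce_mod2 (B ** A)) ?T"
      using G01_mult_closed(2) [OF g(1) y(1,3) x(1)] g(3) [of "reduce_mod2 A"] d
      by (simp add: x(3) reduce_mod2_mult g(2) det_reduce_mod2 del: end_act.simps)
    ultimately show ?thesis
      unfolding Q_def using G01_mult_closed(1) [OF g(1) y(1,3) x(1)] by blast
  qed
  let ?S = "mat2 0 (-1) 1 0 :: int^2^2" and ?R = "mat2 1 1 0 1 :: int^2^2"
  have s: "s_class \<in> carrier G01" "\<Psi> s_class = {?S, - ?S}" "fst s_class = end_act sigma_bar ?T"
    "det sigma_bar = 1" "reduce_mod2 ?S = sigma_bar"
    using G01_carrierI [OF path_class_rs(1)] \<Psi>(3)
    by (simp_all add: s_class_def sigma_psl_def SL2Z_coset sigma_bar_def cusp_act_simps det_mat2 reduce_mod2_mat2)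
  have r: "r_class \<in> carrier G01" "\<Psi> r_class = {?R, - ?R}" "fst r_class = end_act rho_bar ?T"
    "det rho_bar = 1" "reduce_mod2 ?R = rho_bar"
    using G01_carrierI [OF path_class_rs(2)] \<Psi>(2)
    by (simp_all add: r_class_def rho_psl_def SL2Z_coset rho_bar_def cusp_act_simps det_mat2 reduce_mod2_mat2)
  have QS: "det (?S ** A) = 1 \<and> Q (?S ** A)" if "det A = 1 \<and> Q A" for A
    using step [OF _ s(1-3) s(4,5) end_act_mult(1)] that by (simp add: det_mul det_mat2)
  have QR: "det (?R ** A) = 1 \<and> Q (?R ** A)" if "det A = 1 \<and> Q A" for A
    using step [OF _ r(1-3) r(4,5) end_act_mult(2)] that by (simp add: det_mul det_mat2)
  have Qneg: "det (- A) = 1 \<and> Q (- A)" if "det A = 1 \<and> Q A" for A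
    using that by (simp add: Q_def reduce_mod2_uminus insert_commute det_2)
  \<comment> \<open>The induction starts at \<open>\<sigma>\<close> and reaches the identity as \<open>- \<sigma> \<sigma>\<close>.\<close>
  have "Q ?S" unfolding Q_def using s by (intro bexI [of _ s_class]) auto
  then have "det (- (?S ** ?S)) = 1 \<and> Q (- (?S ** ?S))"
    by (intro Qneg QS) (simp add: det_mat2)
  moreover have "- (?S ** ?S) = mat 1" by (simp add: mat2_mult mat2_uminus mat_1_eq_mat2)
  ultimately have one: "det (mat 1 :: int^2^2) = 1 \<and> Q (mat 1)" by simp
  obtain A where A: "det A = 1" "\<alpha> = {A, - A}" by (rule PSL2Z_carrierE [OF \<alpha>])
  have "det A = 1 \<and> Q A"
    by (rule SL2Z_generated [where P = "\<lambda>A. det A = 1 \<and> Q A", OF one QS QR Qneg A(1)])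
  then obtain x where x: "x \<in> carrier G01" "\<Psi> x = \<alpha>" "fst x = end_act (reduction \<alpha>) ?T"
    unfolding Q_def A(2) reduction_pair by blast
  have "path_element \<Psi> \<alpha> = x"
    unfolding path_element_def x(2) [symmetric] by (rule inv_into_f_f [OF inj x(1)])
  then show "path_element \<Psi> \<alpha> \<in> carrier G01"
    "fst (path_element \<Psi> \<alpha>) = end_act (reduction \<alpha>) (Tang C0 C1)" using x by simp_all
  show "det (reduction \<alpha>) = 1" by (simp add: A reduction_pair det_reduce_mod2)
qed

section \<open>The action on the polylogarithm generating function\<close>

text \<open>
  Direct paths to \<open>z\<close> are carried to direct paths to \<open>g z\<close>. Along one such path the substitution turns
  the regularized Chen series of the image into that of the path itself, which is \<open>Li z\<close>.
\<close>

lemma Li_moebius: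
  assumes g: "det g = 1" and z: "z \<in> - \<real> \<union> cusp_gap C0 C1"
    and S: "\<And>\<gamma>. \<gamma> \<in> direct_paths (end_act g (Tang C0 C1)) (moebius_act g z) \<Longrightarrow>
      has_chen_series (end_act g (Tang C0 C1)) (Pt (moebius_act g z)) \<gamma> S"
  shows "nc_subst S (var_act g) = Li z"
proof -
  obtain \<gamma> where \<gamma>: "\<gamma> \<in> direct_paths (Tang C0 C1) z"
    using direct_path_parabola [OF z] by blast
  then have path: "is_path (Tang C0 C1) (Pt z) \<gamma>" by (simp add: direct_paths_def)
  obtain L where L: "\<forall>\<gamma>\<in>direct_paths (Tang C0 C1) z. is_path (Tang C0 C1) (Pt z) \<gamma> \<and>
      transports (Tang C0 C1) (Pt z) \<gamma> L"
    using direct_paths_transports [of C0 C1 z] z by blast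
  have "Li z = L" unfolding Li_def by (rule chen_of_transports) (use \<gamma> L in auto)
  moreover have "has_chen_series (Tang C0 C1) (Pt z) \<gamma> L"
    using transports_has_chen_series [OF path] L \<gamma> by blast
  moreover have "has_chen_series (Tang C0 C1) (Pt z) \<gamma> (nc_subst S (var_act g))"
    using has_chen_series_moebius [OF g path, of S] S [OF direct_path_moebius [OF g \<gamma>]] by simp
  ultimately show ?thesis using has_chen_series_unique by blast
qed

theorem proposition1p15:
  fixes \<Psi> :: "path_elt \<Rightarrow> (int^2^2) set"
    and \<alpha> :: "(int^2^2) set" and z :: complex
  assumes "\<Psi> \<in> iso G01 PSL2Z" and "\<Psi> r_class = rho_psl" and "\<Psi> s_class = sigma_psl"
    and "\<alpha> \<in> carrier PSL2Z"
    and "z \<notin> of_real ` ({..0} \<union> {1..})"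
  shows "Li_act \<Psi> \<alpha> z = F_series \<Psi> \<alpha> \<star> Li z"
proof -
  define g where "g = reduction \<alpha>"
  define p where "p = moebius_act g z"
  let ?T = "Tang C0 C1"
  note pe = path_element_endpoint [OF assms(1-4), folded g_def]
  have g: "det g = 1" by (rule pe(2))
  obtain a b \<gamma> where x: "path_element \<Psi> \<alpha> = (Tang a b, path_class ?T (Tang a b) \<gamma>)" "a \<noteq> b"
    "is_path ?T (Tang a b) \<gamma>"
    by (rule G01_carrierE [OF pe(1)])
  have f: "end_act g ?T = Tang a b" using pe(3) x(1) by simp
  let ?A = "path_class ?T (Tang a b) \<gamma>" and ?D = "direct_paths (Tang a b) p"
  have zW: "z \<in> - \<real> \<union> cusp_gap C0 C1"
  proof (cases "z \<in> \<real>")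
    case True
    then obtain y where "z = of_real y" by (rule Reals_cases)
    moreover from this have "0 < y" "y < 1" using assms(5) by force+
    ultimately show ?thesis by simp
  qed simp
  have zY: "z \<in> Ycurve" using zW slit_plane(3) [of C0 C1] by blast
  have pW: "p \<in> - \<real> \<union> cusp_gap a b"
    using zW moebius_act_cusp_gap [OF g] moebius_act_Reals_iff [OF g zY] f by (auto simp: p_def)
  obtain S where S: "\<forall>u\<in>?A. is_path ?T (Tang a b) u \<and> transports ?T (Tang a b) u S"
    using path_class_transports [OF x(3)] by blast
  obtain D where D: "\<forall>v\<in>?D. is_path (Tang a b) (Pt p) v \<and> transports (Tang a b) (Pt p) v D"
    using direct_paths_transports [OF x(2) pW] by blast
  obtain v where v: "v \<in> ?D"
    using direct_path_moebius [OF g direct_path_parabola [OF zW]] f unfolding p_def by metis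
  have \<gamma>A: "\<gamma> \<in> ?A" by (rule path_class_self [OF x(3)])
  \<comment> \<open>A composite of one pair of representatives shows that the class is nonempty, as its Chen series requires.\<close>
  have "concat_class ?T (Pt p) {\<gamma>} {v} \<subseteq> concat_class ?T (Pt p) ?A ?D"
    using \<gamma>A v unfolding concat_class_def by blast
  moreover have "\<exists>w. is_path ?T (Pt p) w \<and> concat_class ?T (Pt p) {\<gamma>} {v} = path_class ?T (Pt p) w"
    by (rule concat_class_eq_path_class) (use x(3) D v in \<open>auto intro: is_path_homotopic_refl\<close>)
  ultimately have "concat_class ?T (Pt p) ?A ?D \<noteq> {}"
    using path_class_self by blast
  then have concat: "chen_of ?T (Pt p) (concat_class ?T (Pt p) ?A ?D) = S \<star> D"
  proof (rule chen_of_transports)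
    fix w assume w: "w \<in> concat_class ?T (Pt p) ?A ?D"
    then have "transports ?T (Pt p) w (S \<star> D)"
      using S D by (intro concat_class_transports [of ?A _ "Tang a b"]) auto
    then show "is_path ?T (Pt p) w \<and> transports ?T (Pt p) w (S \<star> D)"
      using w by (simp add: concat_class_def)
  qed
  have "chen_of ?T (Tang a b) ?A = S"
    by (rule chen_of_transports) (use \<gamma>A S in auto)
  then have F: "F_series \<Psi> \<alpha> = nc_subst S (var_act g)"
    by (simp add: F_series_def x(1) g_def)
  have "nc_subst D (var_act g) = Li z"
  proof (rule Li_moebius [OF g zW])
    fix \<beta> assume "\<beta> \<in> direct_paths (end_act g ?T) (moebius_act g z)"
    then have "\<beta> \<in> ?D" by (simp only: f p_def)
    then show "has_chen_series (end_act g ?T) (Pt (moebius_act g z)) \<beta> D"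
      using D transports_has_chen_series unfolding f p_def [symmetric] by blast
  qed
  moreover have "Li_act \<Psi> \<alpha> z = nc_subst (S \<star> D) (var_act g)"
    unfolding Li_act_def x(1) by (simp add: Let_def flip: g_def p_def) (simp only: concat)
  ultimately show ?thesis
    unfolding F by (simp add: nc_subst_mult linear_var_act)
qed

end
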